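(* Consider the random walk in random environment on the rooted regular tree $\mathbb{V}$ of order $d$ described in the context, with associated random vector $(\eta_1,\dots,\eta_d)$, function $f(x)=\mathbb{E}\big(\sum_{i=1}^d \eta_i^x\big)$, chaos process $(Y_n)_{n\ge 0}$ and sum process $(Z_n)_{n\ge 0}$. Let $\lambda=\inf_{x\in[0,1]} f(x)$ and let $x_0\in[0,1]$ be such that $f(x_0)=\lambda$. Then: 1. If $\lambda<1$, then for almost every realisation of the environment the random walk is ergodic, and $Z_\infty<\infty$ almost surely. 2. If $\lambda>1$, then for almost every realisation of the environment the random walk is transient, and almost surely $Y_\infty=\infty$ and $Z_\infty=\infty$. 3. If $\lambda=1$ and moreover $f'(1)<0$, then almost surely $0<Y_\infty<\infty$ and $Z_\infty=\infty$, and for almost every realisation of the environment the random walk is null-recurrent.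
   Context: Tree. Let $d\ge 1$ be an integer. The vertex set is $\mathbb{V}=\bigcup_{n\ge 0}\mathbb{V}_n$ with $\mathbb{V}_0=\{\emptyset\}$ (the root) and $\mathbb{V}_n=\{1,\dots,d\}^n$. For $v=(v_1,\dots,v_n)\in\mathbb{V}_n$ put $|v|=n$ and, for $k\le n$, $v|_k=(v_1,\dots,v_k)$. Write $vj=(v_1,\dots,v_n,j)$. The parent of $v\ne\emptyset$ is $v|_{|v|-1}$, and the edge joining $v\neq\emptyset$ to its parent is denoted $a(v)$. Put $\mathring{\mathbb{V}}=\mathbb{V}\setminus\{\emptyset\}$. Environment. To each $v\in\mathring{\mathbb{V}}$ is attached a random vector $(p_{v,0},\dots,p_{v,d})$ with positive components and $\sum_{j=0}^d p_{v,j}=1$; to the root is attached a random vector $(p_{\emptyset,1},\dots,p_{\emptyset,d})$ with positive components and $\sum_{j=1}^d p_{\emptyset,j}=1$. These vectors are independent for different vertices, and those attached to $v\in\mathring{\mathbb{V}}$ all have the same distribution (the components of one vector need not be identically distributed, and no other assumption is made on their joint law). It is assumed that $\mathbb{E}(1/p_{v,0})<\infty$ for $v\in\mathring{\mathbb V}$. Random walk. Given the environment, $(X_n)$ is the Markov chain on $\mathbb{V}$ with $\mathbb{P}(X_{n+1}=uj\mid X_n=u)=p_{u,j}$ for $u\in\mathbb{V}$, $j=1,\dots,d$, and $\mathbb{P}(X_{n+1}=u|_{|u|-1}\mid X_n=u)=p_{u,0}$ for $u\in\mathring{\mathbb{V}}$; all other transition probabilities are $0$. "Ergodic" means positive recurrent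 (i.e. admitting a stationary probability distribution; the chain has period 2). Vector $\eta$ and function $f$. Let $(\eta_1,\dots,\eta_d)$ be a random vector with the law of $(p_{v,1}/p_{v,0},\dots,p_{v,d}/p_{v,0})$, $v\in\mathring{\mathbb{V}}$. It is assumed that $\mathbb{E}\,\eta_i<\infty$ and $\mathbb{E}\,\eta_i\log^+\eta_i<\infty$ for all $i$, where $\log^+ z=\max(0,\log z)$, and that the laws of the $\eta_i$ have no atom at $0$. $f'(1)$ denotes the (left) derivative of $f$ at $1$, equal to $\sum_{i=1}^d\mathbb{E}(\eta_i\log\eta_i)$. Chaos processes. Edge variables: $\xi_{a(v)}=p_{v|_{|v|-1},v_{|v|}}/p_{v|_{|v|-1},0}$ if $|v|\ge 2$, and $\xi_{a(v)}=p_{\emptyset,v_1}$ if $|v|=1$. For $v\in\mathbb{V}$, $\xi[v]=\prod_{k=1}^{|v|}\xi_{a(v|_k)}$ (with $\xi[\emptyset]=1$). $Y_n=\sum_{v\in\mathbb{V}_n}\xi[v]$, $Z_n=\sum_{k=0}^n Y_k$, $Y_\infty=\lim_{n\to\infty} Y_n$ (the existence of the limit, finite or infinite, being part of the assertions in which $Y_\infty$ appears) and $Z_\infty=\lim_{n\to\infty} Z_n=\sum_{v\in\mathbb{V}}\xi[v]$. *)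

theory Defs
  imports "HOL-Probability.Probability"
begin

definition chain_step ::
    "('s \<Rightarrow> 's pmf) \<Rightarrow> 's \<Rightarrow> nat \<Rightarrow> (nat \<Rightarrow> 's) \<Rightarrow> 's measure" where
  "chain_step K x n X = measure_pmf (if n = 0 then return_pmf x else K (X (n - 1)))"

text \<open>The law, on the space of trajectories with the product sigma-algebra, of the Markov
  chain with transition kernel \<open>K\<close> started at \<open>x\<close>.\<close>

definition path_law :: "('s \<Rightarrow> 's pmf) \<Rightarrow> 's \<Rightarrow> (nat \<Rightarrow> 's) measure" where
  "path_law K x =
     projective_family.lim UNIV
       (Ionescu_Tulcea.CI (chain_step K x) (\<lambda>_. count_space UNIV)) (\<lambda>_. count_space UNIV)"

lemma Ionescu_Tulcea_chain_step:
  fixes K :: "'s \<Rightarrow> 's pmf"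
  shows "Ionescu_Tulcea (chain_step K x) (\<lambda>_. count_space UNIV)"
proof (rule Ionescu_Tulcea.intro)
  fix i :: nat
  show "chain_step K x i \<in>
      measurable (PiM {0..<i} (\<lambda>_. count_space UNIV)) (subprob_algebra (count_space UNIV))"
  proof (cases i)
    case 0
    have "measure_pmf (return_pmf x) \<in> space (subprob_algebra (count_space UNIV))"
      by (auto simp: space_subprob_algebra intro: prob_space_imp_subprob_space
          measure_pmf.prob_space_axioms)
    then show ?thesis
      by (simp add: chain_step_def[abs_def] 0)
  next
    case (Suc m)
    have 1: "(\<lambda>X. X m) \<in> measurable (PiM {0..<i} (\<lambda>_. count_space UNIV)) (count_space UNIV)"
      by (rule measurable_component_singleton) (simp add: Suc)
    have 2: "(\<lambda>u. measure_pmf (K u)) \<in>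
        measurable (count_space UNIV) (subprob_algebra (count_space UNIV))"
      by (auto simp: space_subprob_algebra intro: prob_space_imp_subprob_space
          measure_pmf.prob_space_axioms)
    show ?thesis
      using measurable_compose[OF 1 2] by (simp add: chain_step_def[abs_def] Suc)
  qed
next
  fix i and X :: "nat \<Rightarrow> 's"
  show "prob_space (chain_step K x i X)"
    unfolding chain_step_def by (rule measure_pmf.prob_space_axioms)
qed

lemma
  shows prob_space_path_law: "prob_space (path_law K x)"
    and sets_path_law: "sets (path_law K x) = sets (PiM UNIV (\<lambda>_. count_space UNIV))"
    and space_path_law: "space (path_law K x) = UNIV"
proof -
  interpret IT: Ionescu_Tulcea "chain_step K x" "\<lambda>_. count_space UNIV"
    by (rule Ionescu_Tulcea_chain_step)
  show s: "sets (path_law K x) = sets (PiM UNIV (\<lambda>_. count_space UNIV))"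
    by (simp add: path_law_def)
  show u: "space (path_law K x) = UNIV"
    using sets_eq_imp_space_eq[OF s] by (simp add: space_PiM)
  have "IT.PF.emb UNIV {} (space (PiM {} (\<lambda>_. count_space UNIV))) = UNIV"
    by (auto simp: prod_emb_def space_PiM)
  then have "emeasure IT.PF.lim UNIV = emeasure IT.PF.lim (IT.PF.emb UNIV {} (space (PiM {} (\<lambda>_. count_space UNIV))))"
    by simp
  also have "\<dots> = emeasure (IT.CI {}) (space (PiM {} (\<lambda>_. count_space UNIV)))"
    by (rule IT.lim) auto
  also have "\<dots> = 1"
    using prob_space.emeasure_space_1[OF IT.PF.prob_space_P[of "{}"]]
    by (simp add: IT.CI_def)
  finally have "emeasure (path_law K x) UNIV = 1"
    by (simp add: path_law_def)
  then show "prob_space (path_law K x)"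
    by (intro prob_spaceI) (simp add: u)
qed

lemma emeasure_path_law_cylinder:
  fixes K :: "'s \<Rightarrow> 's pmf"
  shows "emeasure (path_law K x) {X. \<forall>k\<le>n. X k = xs k} =
    (if xs 0 = x then ennreal (\<Prod>k<n. pmf (K (xs k)) (xs (Suc k))) else 0)"
proof -
  let ?M = "\<lambda>_::nat. count_space (UNIV :: 's set)"
  interpret IT: Ionescu_Tulcea "chain_step K x" ?M
    by (rule Ionescu_Tulcea_chain_step)
  define A where "A n = (PiE {0..<n} (\<lambda>k. {xs k}))" for n
  have A[measurable]: "A n \<in> sets (PiM {0..<n} ?M)" for n
    unfolding A_def by (rule sets_PiM_I_finite) auto
  have A0: "A n = {restrict xs {0..<n}}" for n
    unfolding A_def by (auto simp: PiE_iff extensional_def fun_eq_iff)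
  have "{X. \<forall>k\<le>n. X k = xs k} = IT.PF.emb UNIV {0..<Suc n} (A (Suc n))"
    by (auto simp: A_def prod_emb_def space_PiM PiE_iff extensional_def)
  then have "emeasure (path_law K x) {X. \<forall>k\<le>n. X k = xs k} = emeasure (IT.CI {0..<Suc n}) (A (Suc n))"
    using IT.lim[of "{0..<Suc n}" "A (Suc n)"] A by (simp add: path_law_def)
  also have "\<dots> = emeasure (IT.C 0 (Suc n) (\<lambda>_. undefined)) (A (Suc n))"
  proof -
    have "IT.PF.emb {0..<Suc n} {0..<Suc n} (A (Suc n)) = A (Suc n)"
      by (rule prod_emb_id) (auto simp: A_def PiE_iff)
    then show ?thesis
      by (subst IT.emeasure_CI[OF subset_refl A]) (simp only:)
  qed
  also have "\<dots> = (if xs 0 = x then ennreal (\<Prod>k<n. pmf (K (xs k)) (xs (Suc k))) else 0)"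
  proof -
    have step: "emeasure (IT.C 0 (Suc n) (\<lambda>_. undefined)) (A (Suc n)) =
        emeasure (IT.C 0 n (\<lambda>_. undefined)) (A n) *
          emeasure (chain_step K x n (restrict xs {0..<n})) {xs n}" for n
    proof -
      have ne: "space (IT.C 0 n (\<lambda>_. undefined)) = space (PiM {0..<n} ?M)"
        using IT.space_C[of "\<lambda>_. undefined" 0 n] by simp
      have se: "sets (IT.C 0 n (\<lambda>_. undefined)) = sets (PiM {0..<n} ?M)"
        using IT.sets_C[of "\<lambda>_. undefined" 0 n] by simp
      have m: "IT.eP n \<in> measurable (IT.C 0 n (\<lambda>_. undefined)) (subprob_algebra (PiM {0..<Suc n} ?M))"
        using IT.measurable_eP[of n] measurable_cong_sets[OF se refl] by blast
      have "emeasure (IT.C 0 (Suc n) (\<lambda>_. undefined)) (A (Suc n)) =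
          (\<integral>\<^sup>+ \<omega>. emeasure (IT.eP n \<omega>) (A (Suc n)) \<partial>IT.C 0 n (\<lambda>_. undefined))"
        using m ne by (simp add: emeasure_bind[where N="PiM {0..<Suc n} ?M"])
      also have "\<dots> = (\<integral>\<^sup>+ \<omega>. emeasure (chain_step K x n (restrict xs {0..<n})) {xs n} * indicator (A n) \<omega>
            \<partial>IT.C 0 n (\<lambda>_. undefined))"
      proof (rule nn_integral_cong)
        fix \<omega> assume "\<omega> \<in> space (IT.C 0 n (\<lambda>_. undefined))"
        then have w: "\<omega> \<in> space (PiM {0..<n} ?M)" by (simp add: ne)
        then have ext: "\<omega> i = undefined" if "\<not> i < n" for i
          using that by (auto simp: space_PiM PiE_iff extensional_def)
        have "fun_upd \<omega> n -` A (Suc n) \<inter> space (?M n) = (if \<omega> \<in> A n then {xs n} else {})"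
        proof -
          have "fun_upd \<omega> n y \<in> A (Suc n) \<longleftrightarrow> \<omega> \<in> A n \<and> y = xs n" for y
          proof
            assume "fun_upd \<omega> n y \<in> A (Suc n)"
            then have *: "(fun_upd \<omega> n y) k = xs k" if "k < Suc n" for k
              using that by (auto simp: A_def PiE_iff)
            have "\<omega> k = xs k" if "k < n" for k
              using *[of k] that by simp
            then show "\<omega> \<in> A n \<and> y = xs n"
              using *[of n] ext by (auto simp: A_def PiE_iff extensional_def)
          next
            assume "\<omega> \<in> A n \<and> y = xs n"
            then show "fun_upd \<omega> n y \<in> A (Suc n)"
              by (auto simp: A_def PiE_iff extensional_def)
          qed
          then show ?thesis by auto
        qed
        then show "emeasure (IT.eP n \<omega>) (A (Suc n)) =
            emeasure (chain_step K x n (restrict xs {0..<n})) {xs n} * indicator (A n) \<omega>"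
          using IT.emeasure_eP[OF w A] by (auto simp: A0)
      qed
      also have "\<dots> = emeasure (chain_step K x n (restrict xs {0..<n})) {xs n} *
            emeasure (IT.C 0 n (\<lambda>_. undefined)) (A n)"
        using A[of n] by (subst nn_integral_cmult_indicator) (auto simp: se)
      finally show ?thesis by (simp add: mult.commute)
    qed
    have s: "emeasure (chain_step K x (Suc n) (restrict xs {0..<Suc n})) {xs (Suc n)} =
        ennreal (pmf (K (xs n)) (xs (Suc n)))" for n
      by (simp add: chain_step_def emeasure_pmf_single)
    show ?thesis
    proof (induction n)
      case 0
      have "emeasure (IT.C 0 0 (\<lambda>_. undefined)) (A 0) = 1"
        by (simp add: A0 restrict_def PiM_empty)
      moreover have "emeasure (chain_step K x 0 (restrict xs {0..<0})) {xs 0} =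
          (if xs 0 = x then 1 else 0)"
        by (simp add: chain_step_def)
      ultimately show ?case
        unfolding step[of 0] by simp
    next
      case (Suc n)
      then show ?case
        by (simp only: step[of "Suc n"] s)
           (auto simp: ennreal_mult[symmetric] prod_nonneg)
    qed
  qed
  finally show ?thesis .
qed

definition recurrent_state :: "('s \<Rightarrow> 's pmf) \<Rightarrow> 's \<Rightarrow> bool" where
  "recurrent_state K x \<longleftrightarrow> measure (path_law K x) {X. \<exists>n\<ge>1. X n = x} = 1"

definition transient_state :: "('s \<Rightarrow> 's pmf) \<Rightarrow> 's \<Rightarrow> bool" where
  "transient_state K x \<longleftrightarrow> measure (path_law K x) {X. \<exists>n\<ge>1. X n = x} < 1"

definition return_time :: "'s \<Rightarrow> (nat \<Rightarrow> 's) \<Rightarrow> ennreal" where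
  "return_time x X = (INF n\<in>{n. n \<ge> 1 \<and> X n = x}. of_nat n)"

definition mean_return_time :: "('s \<Rightarrow> 's pmf) \<Rightarrow> 's \<Rightarrow> ennreal" where
  "mean_return_time K x = (\<integral>\<^sup>+ X. return_time x X \<partial>path_law K x)"

definition stationary :: "('s \<Rightarrow> 's pmf) \<Rightarrow> 's pmf \<Rightarrow> bool" where
  "stationary K \<mu> \<longleftrightarrow> bind_pmf \<mu> K = \<mu>"

text \<open>The following notions are meant for irreducible chains on the whole type. For those, the
  two conjuncts of \<open>ergodic\<close> (positive recurrence and existence of a stationary probability
  distribution) are equivalent. Aperiodicity is not part of ergodicity here.\<close>

definition ergodic :: "('s \<Rightarrow> 's pmf) \<Rightarrow> bool" where
  "ergodic K \<longleftrightarrow>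
     (\<forall>x. recurrent_state K x \<and> mean_return_time K x < \<infinity>) \<and> (\<exists>\<mu>. stationary K \<mu>)"

definition null_recurrent :: "('s \<Rightarrow> 's pmf) \<Rightarrow> bool" where
  "null_recurrent K \<longleftrightarrow> (\<forall>x. recurrent_state K x \<and> mean_return_time K x = \<infinity>)"

definition transient :: "('s \<Rightarrow> 's pmf) \<Rightarrow> bool" where
  "transient K \<longleftrightarrow> (\<forall>x. transient_state K x)"

text \<open>The tree of order \<open>d = CARD('d)\<close> has vertex set \<open>'d list\<close>, where the finite nonempty type
  \<open>'d\<close> plays the role of \<open>{1,\<dots>,d}\<close>; the root is \<open>[]\<close>, the parent of \<open>v \<noteq> []\<close> is \<open>butlast v\<close>, and
  \<open>v @ [j]\<close> is the child \<open>vj\<close>. In a weight family \<open>w :: 'd list \<Rightarrow> 'd option \<Rightarrow> real\<close>,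
  \<open>w v None\<close> stands for \<open>p\<^sub>v\<^sub>,\<^sub>0\<close> and \<open>w v (Some j)\<close> for \<open>p\<^sub>v\<^sub>,\<^sub>j\<close>. At the root there is no component
  \<open>None\<close>: the value \<open>w [] None\<close> is never used.\<close>

definition moves :: "'d list \<Rightarrow> 'd option set" where
  "moves v = (if v = [] then range Some else UNIV)"

definition transition_prob ::
    "('d list \<Rightarrow> 'd option \<Rightarrow> real) \<Rightarrow> 'd list \<Rightarrow> 'd list \<Rightarrow> real" where
  "transition_prob w u v =
     (if v \<noteq> [] \<and> u = butlast v then w u (Some (last v))
      else if u \<noteq> [] \<and> v = butlast u then w u None
      else 0)"

definition tree_kernel ::
    "('d list \<Rightarrow> 'd option \<Rightarrow> real) \<Rightarrow> 'd list \<Rightarrow> 'd list pmf" where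
  "tree_kernel w u = embed_pmf (transition_prob w u)"

lemma pmf_tree_kernel:
  fixes w :: "'d::finite list \<Rightarrow> 'd option \<Rightarrow> real"
  assumes pos: "\<forall>i\<in>moves u. w u i > 0" and sum1: "(\<Sum>i\<in>moves u. w u i) = 1"
  shows "pmf (tree_kernel w u) v = transition_prob w u v"
proof -
  define g where "g i = (case i of None \<Rightarrow> butlast u | Some j \<Rightarrow> u @ [j])" for i
  have ne: "butlast u \<noteq> u @ [j]" for j
  proof
    assume "butlast u = u @ [j]"
    then have "length (butlast u) = length (u @ [j])" by simp
    then show False by simp
  qed
  have ne2: "u \<noteq> butlast (butlast u)" if "u \<noteq> []"
  proof
    assume "u = butlast (butlast u)"
    then have "length u = length (butlast (butlast u))" by simp
    then have "length u = length u - 1 - 1" by (simp only: length_butlast)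
    with that show False by (cases u) auto
  qed
  have inj: "inj_on g (moves u)"
    by (auto simp: inj_on_def g_def ne ne[symmetric] split: option.splits)
  have g: "transition_prob w u (g i) = w u i" if "i \<in> moves u" for i
    using that ne ne2 by (cases i) (auto simp: transition_prob_def g_def moves_def split: if_splits)
  have out: "transition_prob w u v = 0" if "v \<notin> g ` moves u" for v
  proof (rule ccontr)
    assume "transition_prob w u v \<noteq> 0"
    then consider "v \<noteq> []" "u = butlast v" | "u \<noteq> []" "v = butlast u"
      unfolding transition_prob_def by metis
    then have "v \<in> g ` moves u"
    proof cases
      case 1
      then have "v = g (Some (last v))" by (simp add: g_def)
      then show ?thesis by (rule image_eqI) (simp add: moves_def)
    next
      case 2
      then have "v = g None" by (simp add: g_def)
      then show ?thesis by (rule image_eqI) (simp add: moves_def 2)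
    qed
    with that show False by simp
  qed
  have nonneg: "transition_prob w u v \<ge> 0" for v
  proof (cases "v \<in> g ` moves u")
    case True
    then obtain i where "i \<in> moves u" "v = g i" by blast
    then show ?thesis using g[of i] pos less_imp_le by metis
  qed (simp add: out)
  have "(\<integral>\<^sup>+ v. ennreal (transition_prob w u v) \<partial>count_space UNIV) =
      (\<Sum>v\<in>g ` moves u. ennreal (transition_prob w u v))"
    by (rule nn_integral_count_space') (auto simp: out)
  also have "\<dots> = (\<Sum>i\<in>moves u. ennreal (w u i))"
    by (simp add: sum.reindex[OF inj] g)
  also have "\<dots> = ennreal (\<Sum>i\<in>moves u. w u i)"
    using pos by (intro sum_ennreal) (simp add: less_imp_le)
  finally have total: "(\<integral>\<^sup>+ v. ennreal (transition_prob w u v) \<partial>count_space UNIV) = 1"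
    by (simp only: sum1 ennreal_1)
  show ?thesis
    unfolding tree_kernel_def by (rule pmf_embed_pmf[OF nonneg total])
qed

locale rwre_environment = prob_space M for M :: "'w measure" +
  fixes p :: "'d::finite list \<Rightarrow> 'd option \<Rightarrow> 'w \<Rightarrow> real"
  assumes indep_environment:
      "indep_vars (\<lambda>v. PiM (moves v) (\<lambda>_. borel)) (\<lambda>v \<omega>. \<lambda>i\<in>moves v. p v i \<omega>) UNIV"
    and same_law:
      "\<And>u v. u \<noteq> [] \<Longrightarrow> v \<noteq> [] \<Longrightarrow>
         distr M (PiM UNIV (\<lambda>_. borel)) (\<lambda>\<omega> i. p u i \<omega>) =
         distr M (PiM UNIV (\<lambda>_. borel)) (\<lambda>\<omega> i. p v i \<omega>)"
    and positive: "\<And>v i. i \<in> moves v \<Longrightarrow> AE \<omega> in M. p v i \<omega> > 0"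
    and sum_one: "\<And>v. AE \<omega> in M. (\<Sum>i\<in>moves v. p v i \<omega>) = 1"
    and inverse_integrable: "\<And>v. v \<noteq> [] \<Longrightarrow> integrable M (\<lambda>\<omega>. 1 / p v None \<omega>)"

text \<open>A random vector \<open>\<eta>\<close>, possibly on another probability space, with the common law of the
  vectors \<open>(p\<^sub>v\<^sub>,\<^sub>j / p\<^sub>v\<^sub>,\<^sub>0)\<^sub>j\<close>, \<open>v \<noteq> []\<close>.\<close>

locale rwre = rwre_environment M p + N: prob_space N
  for M :: "'w measure" and p :: "'d::finite list \<Rightarrow> 'd option \<Rightarrow> 'w \<Rightarrow> real"
    and N :: "'e measure" +
  fixes \<eta> :: "'d \<Rightarrow> 'e \<Rightarrow> real"
  assumes eta_measurable: "\<And>j. \<eta> j \<in> borel_measurable N"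
    and eta_law:
      "\<And>v. v \<noteq> [] \<Longrightarrow>
         distr N (PiM UNIV (\<lambda>_. borel)) (\<lambda>\<omega> j. \<eta> j \<omega>) =
         distr M (PiM UNIV (\<lambda>_. borel)) (\<lambda>\<omega> j. p v (Some j) \<omega> / p v None \<omega>)"
    and eta_integrable: "\<And>j. integrable N (\<eta> j)"
    and eta_log_integrable: "\<And>j. integrable N (\<lambda>\<omega>. \<eta> j \<omega> * max 0 (ln (\<eta> j \<omega>)))"
    and eta_no_atom: "\<And>j. measure (distr N borel (\<eta> j)) {0} = 0"

definition moment_sum :: "'e measure \<Rightarrow> ('d::finite \<Rightarrow> 'e \<Rightarrow> real) \<Rightarrow> real \<Rightarrow> real" where
  "moment_sum N \<eta> x = (\<integral>\<omega>. (\<Sum>i\<in>UNIV. \<eta> i \<omega> powr x) \<partial>N)"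

text \<open>For \<open>v \<noteq> []\<close>, the variable \<open>\<xi>\<close> of the edge joining \<open>v\<close> to its parent.\<close>

definition edge_weight :: "('d list \<Rightarrow> 'd option \<Rightarrow> real) \<Rightarrow> 'd list \<Rightarrow> real" where
  "edge_weight w v =
     (if length v = 1 then w [] (Some (last v))
      else w (butlast v) (Some (last v)) / w (butlast v) None)"

definition path_weight :: "('d list \<Rightarrow> 'd option \<Rightarrow> real) \<Rightarrow> 'd list \<Rightarrow> real" where
  "path_weight w v = (\<Prod>k=1..length v. edge_weight w (take k v))"

definition chaos :: "('d::finite list \<Rightarrow> 'd option \<Rightarrow> real) \<Rightarrow> nat \<Rightarrow> real" where
  "chaos w n = (\<Sum>v\<in>{v. length v = n}. path_weight w v)"

definition chaos_sum :: "('d::finite list \<Rightarrow> 'd option \<Rightarrow> real) \<Rightarrow> nat \<Rightarrow> real" where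
  "chaos_sum w n = (\<Sum>k\<le>n. chaos w k)"

end

theory Submission
  imports Defs
begin

text \<open>
  In a fixed environment the walk is reversible with respect to \<open>\<pi>(v) = \<xi>[v] / p\<^sub>v\<^sub>,\<^sub>0\<close>, and
  \<open>\<pi>(v)\<close> is \<open>\<xi>[v]\<close> plus the sum of \<open>\<xi>[vj]\<close> over the children, so \<open>\<pi>\<close> is finite exactly when
  \<open>Z\<^sub>\<infinity> < \<infinity>\<close>. For an invariant measure Kac's identity \<open>\<pi>(x) E\<^sub>x T\<^sub>x = \<Sum>\<^sub>y \<pi>(y) P\<^sub>y(T\<^sub>x < \<infinity>)\<close> then
  decides between positive and null recurrence. The probability of never visiting the parent
  satisfies a recursion along the tree; if it is positive the walk is transient, and the
  Nash-Williams bound on the energy of the resulting current gives \<open>\<Sum> 1 / Y\<^sub>n < \<infinity>\<close>, hence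
  \<open>Y\<^sub>n \<rightarrow> \<infinity>\<close>. Conversely a bounded \<open>Y\<close> forces recurrence.

  If \<open>f(x\<^sub>0) < 1\<close>, then \<open>\<Sum> \<xi>[v] powr x\<^sub>0\<close> has finite mean.

  If \<open>f > 1\<close> on \<open>[0,1]\<close>, let \<open>\<beta>\<^sub>n\<close> be the probability of climbing \<open>n\<close> levels before visiting the
  parent. Apply to \<open>\<beta>\<^sub>n\<close> a function \<open>\<phi>\<close> that is linear near 0, constant far from 0, and whose
  logarithmic slope decreases very slowly from 1 to 0: locally \<open>\<phi>\<close> is a power with exponent
  in \<open>[0,1]\<close>, so \<open>E \<Sum>\<^sub>j \<phi>(\<eta>\<^sub>j b) \<ge> (1 + \<delta>) \<phi>(b)\<close>, while \<open>\<phi>\<close> is superadditive up to products. Thus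
  \<open>e\<^sub>n = E \<phi>(\<beta>\<^sub>n)\<close> satisfies \<open>(1 + \<delta>) e\<^sub>n \<le> e\<^sub>n\<^sub>+\<^sub>1 + C e\<^sub>n\<^sup>2 \<le> e\<^sub>n + C e\<^sub>n\<^sup>2\<close> and stays away from 0.

  If \<open>\<lambda> = 1\<close> and \<open>f'(1) < 0\<close>, convexity gives \<open>f(1) = 1\<close> and \<open>d \<ge> 2\<close>, and \<open>Y\<close> is essentially a
  nonnegative martingale. The inequality of Kahane and Peyriere for \<open>E W\<^sub>n powr h\<close> yields, as
  \<open>h\<close> tends to 1, a lower bound on \<open>E (sqrt W\<^sub>n)\<close> in terms of \<open>- f'(1)\<close>, so that the limit does
  not vanish identically. In both cases the event \<open>A\<close> of a zero limit satisfies
  \<open>P(A) \<le> P(A)\<^sup>2\<close>, since it is inherited by two independent subtrees.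
\<close>

section \<open>Real inequalities\<close>

text \<open>The components of one vector may depend on each other and need not have moments of order
  above 1, so second-moment bounds are out of reach. In the transient regime nothing is known about
  the law of the escape probability at a given height, and no single exponent can be fixed: near
  each value \<open>b\<close> the test function sees its own exponent in [0,1], so the bound on
  \<open>f\<close> is used on the whole interval. Linearity near 0 makes the test function exactly
  additive on small sums and leads back from it to the escape probability; the plateau absorbs the
  saturation of \<open>S / (1 + S)\<close>, which costs only a factor close to 1 where
  \<open>S\<close> is small. In the critical regime the error term of the moment inequality carries
  the factor \<open>1 - h\<close>, the order of the gain \<open>f h - 1\<close> itself, so the limit
  at \<open>h = 1\<close> leaves a bound free of \<open>n\<close>. The vector at the root has a law
  of its own; it enters as positive weights in a finite sum over the subtrees above the first level,
  each of which has the product law.\<close>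

definition gcut :: "real \<Rightarrow> real" where
  "gcut u = u - (max 0 u)\<^sup>2 / 2 + (max 0 (u - 1))\<^sup>2 / 2"

lemma gcut_le0: "u \<le> 0 \<Longrightarrow> gcut u = u"
  by (simp add: gcut_def)

lemma gcut_mid: "0 \<le> u \<Longrightarrow> u \<le> 1 \<Longrightarrow> gcut u = 1/2 - (1 - u)\<^sup>2 / 2"
  by (simp add: gcut_def power2_eq_square field_simps)

lemma gcut_ge1: "1 \<le> u \<Longrightarrow> gcut u = 1/2"
  by (simp add: gcut_def power2_eq_square field_simps)

text \<open>The slope of \<open>gcut\<close> lies between 0 and 1; the proof adds up the three
  ranges on which \<open>gcut\<close> has a closed form.\<close>

lemma gcut_incr: "u \<le> v \<Longrightarrow> gcut u \<le> gcut v \<and> gcut v - gcut u \<le> v - u"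
proof -
  have mid: "gcut u \<le> gcut v \<and> gcut v - gcut u \<le> v - u" if "0 \<le> u" "u \<le> v" "v \<le> 1" for u v
  proof -
    have d: "gcut v - gcut u = (v - u) * (1 - (u + v) / 2)"
      using that by (simp add: gcut_mid power2_eq_square field_simps)
    have "0 \<le> 1 - (u + v) / 2" "1 - (u + v) / 2 \<le> 1" using that by auto
    then have "0 \<le> (v - u) * (1 - (u + v) / 2)" "(v - u) * (1 - (u + v) / 2) \<le> (v - u)"
      using that by (auto intro!: mult_nonneg_nonneg mult_left_le)
    then show ?thesis using d by linarith
  qed
  have lo: "gcut u \<le> gcut v \<and> gcut v - gcut u \<le> v - u" if "u \<le> v" "v \<le> 0" for u v
    using that by (simp add: gcut_le0)
  have hi: "gcut u \<le> gcut v \<and> gcut v - gcut u \<le> v - u" if "u \<le> v" "1 \<le> u" for u v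
    using that by (simp add: gcut_ge1)
  define c where "c x = max 0 (min 1 x)" for x :: real
  assume uv: "u \<le> v"
  have 1: "gcut (min u 0) \<le> gcut (min v 0) \<and> gcut (min v 0) - gcut (min u 0) \<le> min v 0 - min u 0"
    by (rule lo) (use uv in auto)
  have 2: "gcut (c u) \<le> gcut (c v) \<and> gcut (c v) - gcut (c u) \<le> c v - c u"
    by (rule mid) (use uv in \<open>auto simp: c_def\<close>)
  have 3: "gcut (max u 1) \<le> gcut (max v 1) \<and> gcut (max v 1) - gcut (max u 1) \<le> max v 1 - max u 1"
    by (rule hi) (use uv in auto)
  \<comment> \<open>\<open>gcut\<close> and the identity both split, up to constants, over the three
    clipped copies of \<open>x\<close>, so the estimates on the pieces add.\<close>
  have dec: "gcut x = gcut (min x 0) + gcut (c x) + gcut (max x 1) - 1/2" for x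
    using gcut_le0[of 0] gcut_ge1[of 1] gcut_le0[of "min x 0"] gcut_ge1[of "max x 1"]
    by (cases "x \<le> 0"; cases "x \<le> 1") (auto simp: c_def min_def max_def gcut_ge1)
  have id: "x = min x 0 + c x + max x 1 - 1" for x
    by (auto simp: c_def min_def max_def)
  show ?thesis using 1 2 3 dec[of u] dec[of v] id[of u] id[of v] by linarith
qed

text \<open>The slope of \<open>gcut\<close> is 1 below 0, falls linearly to 0 on [0,1] and vanishes
  beyond, so it lies in [0,1] and is 1-Lipschitz. The number \<open>x\<close> is this slope at
  \<open>u\<close>; it later becomes the local exponent of \<open>phi\<close>.\<close>

lemma gcut_taylor:
  "\<exists>x\<in>{0..1}. \<forall>T. gcut u + x * T - T\<^sup>2 / 2 \<le> gcut (u + T)"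
proof (intro bexI allI)
  fix T :: real
  have conv: "(max 0 u)\<^sup>2 / 2 + max 0 u * T \<le> (max 0 (u + T))\<^sup>2 / 2" for u T :: real
  proof -
    have "(max 0 (u + T))\<^sup>2 - (max 0 u)\<^sup>2 - 2 * (max 0 u) * T \<ge> 0"
    proof (cases "u \<ge> 0")
      case True
      show ?thesis
      proof (cases "u + T \<ge> 0")
        case T2: True
        have "(u + T)\<^sup>2 - u\<^sup>2 - 2 * u * T = T\<^sup>2" by (simp add: power2_eq_square algebra_simps)
        then show ?thesis using True T2 by (simp add: max_def)
      next
        case False
        have "- u\<^sup>2 - 2 * u * T = u * (- u - 2 * T)" by (simp add: power2_eq_square algebra_simps)
        moreover have "0 \<le> u * (- u - 2 * T)" using True False by (intro mult_nonneg_nonneg) auto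
        ultimately show ?thesis using True False by (simp add: max_def)
      qed
    qed (simp add: max_def)
    then show ?thesis by simp
  qed
  have upper: "(max 0 (u + T))\<^sup>2 / 2 \<le> (max 0 u)\<^sup>2 / 2 + max 0 u * T + T\<^sup>2 / 2" for u T :: real
  proof -
    have "(max 0 u)\<^sup>2 + 2 * max 0 u * T + T\<^sup>2 = (max 0 u + T)\<^sup>2"
      by (simp add: power2_eq_square algebra_simps)
    moreover have "(max 0 (u + T))\<^sup>2 \<le> (max 0 u + T)\<^sup>2"
    proof (cases "u + T \<ge> 0")
      case True
      then show ?thesis by (intro power_mono) auto
    qed simp
    ultimately show ?thesis by simp
  qed
  \<comment> \<open>The witness is the slope at \<open>u\<close>. Half the square of the positive
    part is convex with second derivative at most 1, which bounds the subtracted square from above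
    and the added one from below.\<close>
  show "gcut u + (1 - max 0 u + max 0 (u - 1)) * T - T\<^sup>2 / 2 \<le> gcut (u + T)"
    using upper[of u T] conv[of "u - 1" T]
    by (simp add: gcut_def algebra_simps)
qed auto

text \<open>\<open>phi h\<close> is the identity on \<open>[0,1]\<close>, constant above \<open>exp (1/h)\<close>, and in logarithmic
  coordinates its slope decreases from 1 to 0 at rate at most \<open>h\<close>. It is therefore locally a power
  with exponent in \<open>[0,1]\<close>.\<close>

definition phi :: "real \<Rightarrow> real \<Rightarrow> real" where
  "phi h b = (if b \<le> 0 then 0 else exp (gcut (h * ln b) / h))"

context
  fixes h :: real
  assumes h: "h > 0"
begin

lemma phi_nonneg: "phi h b \<ge> 0"
  by (simp add: phi_def)

lemma phi_pos: "b > 0 \<Longrightarrow> phi h b > 0"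
  by (simp add: phi_def)

lemma phi_id: "0 \<le> b \<Longrightarrow> b \<le> 1 \<Longrightarrow> phi h b = b"
  using h by (auto simp: phi_def gcut_le0 mult_nonneg_nonpos)

lemma phi_mono: "b \<le> c \<Longrightarrow> phi h b \<le> phi h c"
  using h gcut_incr[of "h * ln b" "h * ln c"] by (auto simp: phi_def divide_right_mono)

text \<open>In logarithmic coordinates the slope of \<open>phi h\<close> is at most 1, so
  \<open>phi h b / b\<close> does not increase.\<close>

lemma phi_scale:
  assumes "c \<ge> 1" "b \<ge> 0"
  shows "phi h (c * b) \<le> c * phi h b"
proof (cases "b = 0")
  case False
  then have b: "b > 0" "c > 0" using assms by auto
  have "gcut (h * ln (c * b)) / h \<le> (gcut (h * ln b) + h * ln c) / h"
    using gcut_incr[of "h * ln b" "h * ln (c * b)"] h b assms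
    by (intro divide_right_mono) (auto simp: ln_mult algebra_simps)
  also have "\<dots> = gcut (h * ln b) / h + ln c" using h by (simp add: add_divide_distrib)
  finally show ?thesis using b by (simp add: phi_def exp_add[symmetric] exp_diff mult_less_0_iff
      flip: exp_ln) (metis exp_add exp_le_cancel_iff exp_ln mult.commute)
qed (simp add: phi_def)

lemma phi_shrink:
  assumes "0 < r" "r \<le> 1" "b \<ge> 0"
  shows "r * phi h b \<le> phi h (r * b)"
proof -
  have "phi h ((1 / r) * (r * b)) \<le> (1 / r) * phi h (r * b)"
    by (rule phi_scale) (use assms in auto)
  then show ?thesis using assms by (simp add: field_simps)
qed

lemma phi_const:
  assumes "b \<ge> exp (1 / h)"
  shows "phi h b = exp (1 / (2 * h))"
proof -
  have b: "b > 0" using assms exp_gt_zero[of "1 / h"] by linarith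
  have "1 / h \<le> ln b" using assms b by (simp add: ln_ge_iff)
  then have "1 \<le> h * ln b" using h by (simp add: field_simps)
  then show ?thesis using b by (simp add: phi_def gcut_ge1)
qed

lemma phi_bounded: "phi h b \<le> exp (1 / (2 * h))"
  using phi_mono[of b "max b (exp (1 / h))"] phi_const[of "max b (exp (1 / h))"] by simp

lemma phi_le_self: "b \<ge> 0 \<Longrightarrow> phi h b \<le> b"
proof (cases "b \<le> 1")
  case False
  then show ?thesis using phi_scale[of b 1] phi_id[of 1] by simp
qed (simp add: phi_id)

text \<open>This is \<open>gcut_taylor\<close> at \<open>h * ln b\<close> with increment
  \<open>h * T\<close>. After division by \<open>h\<close> the quadratic error is
  \<open>h * T\<^sup>2 / 2\<close>, small for bounded \<open>T\<close> once \<open>h\<close> is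
  small.\<close>

lemma phi_taylor:
  assumes b: "b > 0"
  shows "\<exists>x\<in>{0..1}. \<forall>T. phi h b * exp (x * T - h * T\<^sup>2 / 2) \<le> phi h (b * exp T)"
proof -
  obtain x where x: "x \<in> {0..1}" and ge: "\<And>T. gcut (h * ln b) + x * T - T\<^sup>2 / 2 \<le> gcut (h * ln b + T)"
    using gcut_taylor by blast
  have "phi h b * exp (x * T - h * T\<^sup>2 / 2) \<le> phi h (b * exp T)" for T
  proof -
    have "gcut (h * ln b) / h + (x * T - h * T\<^sup>2 / 2) =
        (gcut (h * ln b) + x * (h * T) - (h * T)\<^sup>2 / 2) / h"
      using h by (simp add: field_simps power2_eq_square)
    also have "\<dots> \<le> gcut (h * ln b + h * T) / h"
      using ge[of "h * T"] h by (intro divide_right_mono) auto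
    also have "\<dots> = gcut (h * ln (b * exp T)) / h"
      using b by (simp add: ln_mult algebra_simps)
    finally show ?thesis
      using b by (simp add: phi_def exp_add[symmetric] mult_le_0_iff not_le)
  qed
  then show ?thesis using x by blast
qed

text \<open>Up to total 1 the function \<open>phi h\<close> is the identity. Otherwise some term is
  at least \<open>1 / card I\<close>, so \<open>card I\<close> times its image is at least 1, and
  the other images are absorbed into the products with it.\<close>

lemma phi_superadditive:
  assumes fin: "finite I" and a: "\<And>i. i \<in> I \<Longrightarrow> a i \<ge> 0"
  shows "(\<Sum>i\<in>I. phi h (a i)) - real (card I) * (\<Sum>i\<in>I. \<Sum>j\<in>I - {i}. phi h (a i) * phi h (a j))
    \<le> phi h (\<Sum>i\<in>I. a i)"
proof (cases "(\<Sum>i\<in>I. a i) \<le> 1")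
  case True
  have le: "a i \<le> 1" if "i \<in> I" for i
    using member_le_sum[OF that, of a] a fin True by fastforce
  have "(\<Sum>i\<in>I. phi h (a i)) = (\<Sum>i\<in>I. a i)"
    by (intro sum.cong) (auto simp: phi_id a le)
  moreover have "phi h (\<Sum>i\<in>I. a i) = (\<Sum>i\<in>I. a i)"
    using True a by (intro phi_id sum_nonneg) auto
  moreover have "0 \<le> real (card I) * (\<Sum>i\<in>I. \<Sum>j\<in>I - {i}. phi h (a i) * phi h (a j))"
    by (intro mult_nonneg_nonneg sum_nonneg phi_nonneg) auto
  ultimately show ?thesis by simp
next
  case False
  then have ne: "I \<noteq> {}" by auto
  define d where "d = real (card I)"
  have d: "d \<ge> 1" using fin ne by (simp add: d_def Suc_le_eq card_gt_0_iff)
  obtain m where m: "m \<in> I" "a m \<ge> 1 / d"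
  proof (rule ccontr)
    assume "\<not> thesis"
    then have "\<And>i. i \<in> I \<Longrightarrow> a i \<le> 1 / d" using that by force
    then have "(\<Sum>i\<in>I. a i) \<le> d * (1 / d)" unfolding d_def by (rule sum_bounded_above)
    then show False using False d by simp
  qed
  have pm: "1 \<le> d * phi h (a m)"
    using phi_mono[OF m(2)] phi_id[of "1 / d"] d by (simp add: field_simps)
  have "(\<Sum>i\<in>I. phi h (a i)) = phi h (a m) + (\<Sum>j\<in>I - {m}. phi h (a j))"
    using sum.remove[OF fin m(1), of "\<lambda>i. phi h (a i)"] .
  also have "(\<Sum>j\<in>I - {m}. phi h (a j)) \<le> (\<Sum>j\<in>I - {m}. d * phi h (a m) * phi h (a j))"
    using pm phi_nonneg by (intro sum_mono) (metis mult.left_neutral mult_right_mono)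
  also have "\<dots> = d * (\<Sum>j\<in>I - {m}. phi h (a m) * phi h (a j))"
    by (simp add: sum_distrib_left mult.assoc)
  also have "\<dots> \<le> d * (\<Sum>i\<in>I. \<Sum>j\<in>I - {i}. phi h (a i) * phi h (a j))"
    using d m(1) fin phi_nonneg
    by (intro mult_left_mono member_le_sum[of m I "\<lambda>i. \<Sum>j\<in>I - {i}. phi h (a i) * phi h (a j)"])
      (auto intro!: sum_nonneg)
  also have "phi h (a m) \<le> phi h (\<Sum>i\<in>I. a i)"
    using member_le_sum[OF m(1), of a] a fin by (intro phi_mono) auto
  finally show ?thesis by (simp add: d_def)
qed

end

lemma phi_measurable [measurable]: "phi h \<in> borel_measurable borel"
  unfolding phi_def[abs_def] gcut_def[abs_def] by measurable

section \<open>Inequalities for powers with exponent in [0,1]\<close>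

lemma powr_le_one_plus: "0 < z \<Longrightarrow> 0 \<le> p \<Longrightarrow> p \<le> 1 \<Longrightarrow> z powr p \<le> 1 + (z::real)"
proof (cases "z \<le> 1")
  case True
  assume "0 < z" "0 \<le> p" "p \<le> 1"
  then have "z powr p \<le> 1" using True powr_le1[of p z] by simp
  then show ?thesis using \<open>0 < z\<close> by simp
next
  case False
  assume "0 < z" "0 \<le> p" "p \<le> 1"
  then have "z powr p \<le> z powr 1" using False by (intro powr_mono) auto
  then show ?thesis using \<open>0 < z\<close> by simp
qed

lemma powr_subadditive_pair:
  fixes x y p :: real
  assumes "x \<ge> 0" "y \<ge> 0" "0 < p" "p \<le> 1"
  shows "(x + y) powr p \<le> x powr p + y powr p"
proof (cases "x + y = 0")
  case True
  then show ?thesis using assms by simp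
next
  case False
  define s where "s = x + y"
  have s: "s > 0" using False assms by (simp add: s_def)
  \<comment> \<open>A share of the total lies in [0,1] and does not shrink when raised to a power at
    most 1; splitting \<open>s powr p\<close> by the two shares gives the claim.\<close>
  have key: "z / s * s powr p \<le> z powr p" if "0 \<le> z" "z \<le> s" for z
  proof (cases "z = 0")
    case False
    have "z / s = (z / s) powr 1" using that s by simp
    also have "\<dots> \<le> (z / s) powr p"
      using that s assms by (intro powr_mono') auto
    finally have "z / s * s powr p \<le> (z / s) powr p * s powr p"
      by (intro mult_right_mono) auto
    also have "\<dots> = z powr p" using that s by (simp add: powr_mult[symmetric])
    finally show ?thesis .
  qed simp
  have "s powr p = x / s * s powr p + y / s * s powr p"
    using s by (simp add: s_def add_divide_distrib[symmetric] distrib_right[symmetric])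
  also have "\<dots> \<le> x powr p + y powr p"
    using assms by (intro add_mono key) (auto simp: s_def)
  finally show ?thesis by (simp add: s_def)
qed

lemma powr_subadditive:
  fixes a :: "'i \<Rightarrow> real" and p :: real
  assumes "finite I" "\<And>i. i \<in> I \<Longrightarrow> a i \<ge> 0" "0 < p" "p \<le> 1"
  shows "(\<Sum>i\<in>I. a i) powr p \<le> (\<Sum>i\<in>I. a i powr p)"
  using assms(1,2)
proof (induction I rule: finite_induct)
  case (insert i I)
  have "(\<Sum>i\<in>insert i I. a i) powr p \<le> a i powr p + (\<Sum>i\<in>I. a i) powr p"
    using insert by (simp add: powr_subadditive_pair sum_nonneg assms)
  then show ?case using insert by fastforce
qed simp

text \<open>With \<open>s\<close> the sum, \<open>s powr h\<close> is the sum of the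
  \<open>a i * s powr (h - 1)\<close>. Each loss \<open>a i powr h - a i * s powr (h - 1)\<close> is
  at most \<open>(1 - h) * a i powr h * ln (s / a i)\<close>, and a bound on the logarithm by a
  power of order \<open>h / 2\<close> turns it into products of different terms. The factor
  \<open>1 - h\<close> is the point of the estimate; 4 bounds \<open>2 / h\<close>.\<close>

lemma kahane_peyriere_inequality:
  fixes a :: "'i \<Rightarrow> real" and h :: real
  assumes fin: "finite I" and a: "\<And>i. i \<in> I \<Longrightarrow> a i > 0" and h: "1/2 \<le> h" "h \<le> 1"
  shows "(\<Sum>i\<in>I. a i powr h) - 4 * (1 - h) * (\<Sum>i\<in>I. \<Sum>j\<in>I - {i}. a i powr (h/2) * a j powr (h/2))
    \<le> (\<Sum>i\<in>I. a i) powr h"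
proof -
  define s where "s = (\<Sum>i\<in>I. a i)"
  have each: "a i powr h - a i * s powr (h - 1) \<le>
      4 * (1 - h) * (\<Sum>j\<in>I - {i}. a i powr (h/2) * a j powr (h/2))" if i: "i \<in> I" for i
  proof -
    define z where "z = (\<Sum>j\<in>I - {i}. a j)"
    have z: "z \<ge> 0" unfolding z_def using a by (intro sum_nonneg) (auto simp: less_imp_le)
    have s: "s = a i + z" unfolding s_def z_def by (rule sum.remove[OF fin i])
    have ai: "a i > 0" by (rule a[OF i])
    have sp: "s > 0" using s z ai by simp
    have zp: "0 < 1 + z / a i" using z ai by (intro add_pos_nonneg) auto
    then have zn: "1 + z / a i \<noteq> 0" by simp
    define q where "q = h / 2"
    have q: "0 < q" "q \<le> 1" "1 / q \<le> 4" using h by (auto simp: q_def field_simps)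
    have "a i * s powr (h - 1) = a i powr h * (s / a i) powr (h - 1)"
    proof -
      have "a i powr h * (s / a i) powr (h - 1) = (a i powr h / a i powr (h - 1)) * s powr (h - 1)"
        using ai sp by (simp add: powr_divide)
      also have "a i powr h / a i powr (h - 1) = a i"
        using ai by (simp add: powr_diff[symmetric])
      finally show ?thesis by simp
    qed
    moreover have "(s / a i) powr (h - 1) \<ge> 1 + (h - 1) * ln (s / a i)"
      using exp_ge_add_one_self[of "(h - 1) * ln (s / a i)"] ai sp by (simp add: powr_def)
    ultimately have "a i powr h - a i * s powr (h - 1) \<le> a i powr h * ((1 - h) * ln (s / a i))"
      using mult_left_mono[of "1 + (h - 1) * ln (s / a i)" "(s / a i) powr (h - 1)" "a i powr h"]
      by (simp add: algebra_simps)
    \<comment> \<open>\<open>ln (1 + y)\<close> equals \<open>ln ((1 + y) powr q) / q\<close>, and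
      subadditivity of the power bounds this by \<open>y powr q / q\<close>.\<close>
    also have "ln (s / a i) \<le> 4 * (z / a i) powr q"
    proof -
      have "ln (s / a i) = (1 / q) * ln ((1 + z / a i) powr q)"
        using q z ai s by (simp add: ln_powr add_divide_distrib add_pos_nonneg)
      also have "ln ((1 + z / a i) powr q) \<le> ln (1 powr q + (z / a i) powr q)"
      proof (rule ln_mono)
        show "0 < (1 + z / a i) powr q" using zn by simp
        show "(1 + z / a i) powr q \<le> 1 powr q + (z / a i) powr q"
          using z ai q by (intro powr_subadditive_pair) auto
      qed
      also have "\<dots> \<le> (z / a i) powr q"
        using ln_add_one_self_le_self[of "(z / a i) powr q"] by simp
      finally have "ln (s / a i) \<le> (1 / q) * (z / a i) powr q"
        using q by (simp add: mult_left_mono divide_right_mono)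
      also have "\<dots> \<le> 4 * (z / a i) powr q" using q by (intro mult_right_mono) auto
      finally show ?thesis .
    qed
    also have "a i powr h * ((1 - h) * (4 * (z / a i) powr q)) = 4 * (1 - h) * (a i powr q * z powr q)"
    proof -
      have "a i powr h * (z / a i) powr q = a i powr q * z powr q"
        using ai z by (simp add: powr_divide q_def powr_diff[symmetric] field_simps powr_add[symmetric])
      then show ?thesis by (simp add: algebra_simps)
    qed
    also have "\<dots> \<le> 4 * (1 - h) * (a i powr q * (\<Sum>j\<in>I - {i}. a j powr q))"
      unfolding z_def using fin a q h
      by (intro mult_left_mono powr_subadditive) (auto simp: less_imp_le)
    finally show ?thesis using h by (simp add: q_def sum_distrib_left mult_left_mono)
  qed
  have "(\<Sum>i\<in>I. a i powr h) - s powr h \<le> (\<Sum>i\<in>I. a i powr h - a i * s powr (h - 1))"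
  proof (cases "I = {}")
    case False
    have "s > 0" unfolding s_def using a fin False by (intro sum_pos) auto
    then have "(\<Sum>i\<in>I. a i * s powr (h - 1)) = s powr h"
      using powr_mult_base[of s "h - 1"] by (simp add: sum_distrib_right[symmetric] s_def[symmetric])
    then show ?thesis by (simp add: sum_subtractf)
  qed simp
  also have "\<dots> \<le> (\<Sum>i\<in>I. 4 * (1 - h) * (\<Sum>j\<in>I - {i}. a i powr (h/2) * a j powr (h/2)))"
    by (intro sum_mono each)
  finally show ?thesis by (simp add: s_def sum_distrib_left)
qed

section \<open>Convergence of nonnegative supermartingales\<close>

text \<open>Upcrossings of \<open>[a,b]\<close>: \<open>up\<close> tells whether the sequence has visited \<open>[0,a]\<close> after its last
  completed upcrossing.\<close>

primrec up :: "real \<Rightarrow> real \<Rightarrow> (nat \<Rightarrow> real) \<Rightarrow> nat \<Rightarrow> bool" where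
  "up a b x 0 = False"
| "up a b x (Suc n) = (if up a b x n then x (Suc n) < b else x (Suc n) \<le> a)"

primrec crossings :: "real \<Rightarrow> real \<Rightarrow> (nat \<Rightarrow> real) \<Rightarrow> nat \<Rightarrow> nat" where
  "crossings a b x 0 = 0"
| "crossings a b x (Suc n) = crossings a b x n + (if up a b x n \<and> b \<le> x (Suc n) then 1 else 0)"

lemma up_cong: "(\<And>k. k \<le> n \<Longrightarrow> x k = y k) \<Longrightarrow> up a b x n = up a b y n"
  by (induction n) auto

lemma crossings_mono: "m \<le> n \<Longrightarrow> crossings a b x m \<le> crossings a b x n"
  by (rule lift_Suc_mono_le[where f = "crossings a b x"]) auto

text \<open>If no crossing were completed after \<open>n\<close>, the state \<open>up\<close>, once
  reached, would persist with values below \<open>b\<close>, against the unbounded set of visits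
  above \<open>b\<close>; a visit below \<open>a\<close> makes it reached.\<close>

lemma crossings_unbounded:
  assumes ab: "a < b" and lo: "\<And>n. \<exists>m>n. x m \<le> a" and hi: "\<And>n. \<exists>m>n. b \<le> x m"
  shows "\<exists>n. crossings a b x n \<ge> N"
proof (induction N)
  case (Suc N)
  then obtain n where n: "crossings a b x n \<ge> N" by blast
  have "\<exists>n'\<ge>n. crossings a b x n' \<noteq> crossings a b x n"
  proof (rule ccontr)
    assume "\<not> ?thesis"
    then have const: "crossings a b x n' = crossings a b x n" if "n' \<ge> n" for n' using that by blast
    have stay: "x (Suc m) < b" if "m \<ge> n" "up a b x m" for m
      using const[of m] const[of "Suc m"] that by (auto split: if_splits)
    have persist: "up a b x (m + k)" if "m \<ge> n" "up a b x m" for m k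
      using that by (induction k) (auto intro: stay)
    have "\<exists>m\<ge>n. up a b x m"
    proof -
      obtain m where m: "m > n" "x m \<le> a" using lo by blast
      then obtain m' where "m = Suc m'" "m' \<ge> n" by (cases m) auto
      then show ?thesis using m persist[of m' 1] by (cases "up a b x m'") (auto intro!: exI[of _ m])
    qed
    then obtain m where m: "m \<ge> n" "up a b x m" by blast
    obtain l where l: "l > m" "b \<le> x l" using hi by blast
    then obtain k where "l = Suc (m + k)" using less_imp_Suc_add by blast
    then show False using stay[OF _ persist[OF m, of k]] m l by simp
  qed
  then obtain n' where "n' \<ge> n" "crossings a b x n' \<noteq> crossings a b x n" by blast
  then show ?case using crossings_mono[of n n' a b x] n by (intro exI[of _ n']) auto
qed auto

text \<open>A lower bound for the gain of a player who holds one unit exactly while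
  \<open>up\<close> is true. The last term values an unfinished upcrossing relative to
  \<open>a\<close>; it is nonpositive at the moment of purchase.\<close>

definition crossing_potential :: "real \<Rightarrow> real \<Rightarrow> (nat \<Rightarrow> real) \<Rightarrow> nat \<Rightarrow> real" where
  "crossing_potential a b x n = (b - a) * crossings a b x n + (if up a b x n then x n - a else 0)"

lemma crossing_potential_step:
  assumes "a < b"
  shows "crossing_potential a b x (Suc n) - crossing_potential a b x n \<le>
    (if up a b x n then x (Suc n) - x n else 0)"
  using assms by (auto simp: crossing_potential_def algebra_simps)

context prob_space
begin

text \<open>Doob's upcrossing argument. In place of a filtration, the history up to time
  \<open>n\<close> is encoded by events that cannot separate two points with the same first
  values.\<close>

lemma integrable_supermartingale_converges:
  fixes X :: "nat \<Rightarrow> 'a \<Rightarrow> real"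
  assumes int: "\<And>n. integrable M (X n)" and nn: "\<And>n \<omega>. \<omega> \<in> space M \<Longrightarrow> X n \<omega> \<ge> 0"
    and super: "\<And>n A. A \<in> sets M \<Longrightarrow>
      (\<And>\<omega> \<omega>'. \<omega> \<in> space M \<Longrightarrow> \<omega>' \<in> space M \<Longrightarrow> (\<And>k. k \<le> n \<Longrightarrow> X k \<omega> = X k \<omega>') \<Longrightarrow>
        \<omega> \<in> A \<longleftrightarrow> \<omega>' \<in> A) \<Longrightarrow>
      (\<integral>\<omega>. indicator A \<omega> * X (Suc n) \<omega> \<partial>M) \<le> (\<integral>\<omega>. indicator A \<omega> * X n \<omega> \<partial>M)"
  shows "AE \<omega> in M. \<exists>l. (\<lambda>n. X n \<omega>) \<longlonglongrightarrow> l"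
proof -
  note [measurable] = borel_measurable_integrable[OF int]
  have bounded: "AE \<omega> in M. \<exists>K. \<forall>n. crossings a b (\<lambda>k. X k \<omega>) n \<le> K"
    if ab: "0 \<le> a" "a < b" for a b
  proof -
    have up_m [measurable]: "Measurable.pred M (\<lambda>\<omega>. up a b (\<lambda>k. X k \<omega>) n)" for n
      by (induction n) (simp_all, measurable)
    have cr_m [measurable]: "(\<lambda>\<omega>. crossings a b (\<lambda>k. X k \<omega>) n) \<in> measurable M (count_space UNIV)" for n
    proof (induction n)
      case (Suc n)
      note [measurable] = Suc
      show ?case by simp measurable
    qed simp
    define V where "V n \<omega> = crossing_potential a b (\<lambda>k. X k \<omega>) n" for n \<omega>
    have cr_le: "crossings a b x n \<le> n" for x n
      by (induction n) auto
    have cr_int: "integrable M (\<lambda>\<omega>. real (crossings a b (\<lambda>k. X k \<omega>) n))" for n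
      by (rule integrable_const_bound[where B = "real n"]) (auto simp: cr_le)
    have V_int: "integrable M (V n)" for n
    proof -
      have "integrable M (\<lambda>\<omega>. if up a b (\<lambda>k. X k \<omega>) n then X n \<omega> - a else 0)"
        by (rule Bochner_Integration.integrable_bound[of _ "\<lambda>\<omega>. norm (X n \<omega>) + \<bar>a\<bar>"])
          (auto intro!: Bochner_Integration.integrable_add integrable_abs int)
      then show ?thesis
        unfolding V_def[abs_def] crossing_potential_def using cr_int by simp
    qed
    \<comment> \<open>The potential grows at most by the increment of the process on the event
      \<open>up\<close>, which is decided by time \<open>n\<close>, so the supermartingale
      inequality applies to that event.\<close>
    have V0: "(\<integral>\<omega>. V n \<omega> \<partial>M) \<le> 0" for n
    proof (induction n)
      case 0
      then show ?case by (simp add: V_def crossing_potential_def)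
    next
      case (Suc n)
      define A where "A = {\<omega> \<in> space M. up a b (\<lambda>k. X k \<omega>) n}"
      have A: "A \<in> sets M" unfolding A_def by measurable
      have iA: "integrable M (\<lambda>\<omega>. indicator A \<omega> * X m \<omega>)" for m
        using integrable_real_mult_indicator[OF A int[of m]] by (simp add: mult.commute)
      have "(\<integral>\<omega>. V (Suc n) \<omega> \<partial>M) - (\<integral>\<omega>. V n \<omega> \<partial>M) = (\<integral>\<omega>. V (Suc n) \<omega> - V n \<omega> \<partial>M)"
        using V_int by simp
      also have "\<dots> \<le> (\<integral>\<omega>. indicator A \<omega> * X (Suc n) \<omega> - indicator A \<omega> * X n \<omega> \<partial>M)"
      proof (rule integral_mono)
        show "V (Suc n) \<omega> - V n \<omega> \<le> indicator A \<omega> * X (Suc n) \<omega> - indicator A \<omega> * X n \<omega>"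
          if "\<omega> \<in> space M" for \<omega>
          using crossing_potential_step[OF ab(2), of "\<lambda>k. X k \<omega>" n] that
          by (auto simp: V_def A_def indicator_def split: if_splits)
      qed (use V_int iA in auto)
      also have "\<dots> = (\<integral>\<omega>. indicator A \<omega> * X (Suc n) \<omega> \<partial>M) - (\<integral>\<omega>. indicator A \<omega> * X n \<omega> \<partial>M)"
        using iA by simp
      also have "\<dots> \<le> 0"
      proof -
        have "(\<integral>\<omega>. indicator A \<omega> * X (Suc n) \<omega> \<partial>M) \<le> (\<integral>\<omega>. indicator A \<omega> * X n \<omega> \<partial>M)"
        proof (rule super[OF A])
          fix \<omega> \<omega>' assume eq: "\<omega> \<in> space M" "\<omega>' \<in> space M" "\<And>k. k \<le> n \<Longrightarrow> X k \<omega> = X k \<omega>'"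
          have "up a b (\<lambda>k. X k \<omega>) n = up a b (\<lambda>k. X k \<omega>') n"
            by (rule up_cong) (rule eq(3))
          then show "\<omega> \<in> A \<longleftrightarrow> \<omega>' \<in> A" using eq(1,2) by (simp add: A_def)
        qed
        then show ?thesis by linarith
      qed
      finally show ?case using Suc by simp
    qed
    \<comment> \<open>Nonnegativity of the process limits the loss on an unfinished upcrossing to
      \<open>a\<close>.\<close>
    have V1: "(b - a) * (\<integral>\<omega>. real (crossings a b (\<lambda>k. X k \<omega>) n) \<partial>M) - a \<le> (\<integral>\<omega>. V n \<omega> \<partial>M)" for n
    proof -
      have "(\<integral>\<omega>. (b - a) * real (crossings a b (\<lambda>k. X k \<omega>) n) - a \<partial>M) \<le> (\<integral>\<omega>. V n \<omega> \<partial>M)"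
      proof (rule integral_mono[OF _ V_int])
        show "(b - a) * real (crossings a b (\<lambda>k. X k \<omega>) n) - a \<le> V n \<omega>" if "\<omega> \<in> space M" for \<omega>
          using nn[OF that, of n] ab by (simp add: V_def crossing_potential_def)
      qed (use cr_int in auto)
      then show ?thesis using cr_int by (simp add: prob_space)
    qed
    have "(b - a) * (\<integral>\<omega>. real (crossings a b (\<lambda>k. X k \<omega>) n) \<partial>M) \<le> a" for n
      using V0[of n] V1[of n] by linarith
    then have le: "(\<integral>\<omega>. real (crossings a b (\<lambda>k. X k \<omega>) n) \<partial>M) \<le> a / (b - a)" for n
      using ab by (simp add: pos_le_divide_eq mult.commute)
    have "(\<integral>\<^sup>+\<omega>. (SUP n. ennreal (real (crossings a b (\<lambda>k. X k \<omega>) n))) \<partial>M) =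
        (SUP n. \<integral>\<^sup>+\<omega>. ennreal (real (crossings a b (\<lambda>k. X k \<omega>) n)) \<partial>M)"
      by (rule nn_integral_monotone_convergence_SUP)
        (auto simp: incseq_def le_fun_def intro!: ennreal_leI crossings_mono)
    also have "\<dots> \<le> ennreal (a / (b - a))"
      using le by (intro SUP_least) (simp add: nn_integral_eq_integral[OF cr_int] ennreal_leI)
    finally have fin: "(\<integral>\<^sup>+\<omega>. (SUP n. ennreal (real (crossings a b (\<lambda>k. X k \<omega>) n))) \<partial>M) \<noteq> \<infinity>"
      using ennreal_less_top neq_top_trans by (metis infinity_ennreal_def less_top)
    have "AE \<omega> in M. (SUP n. ennreal (real (crossings a b (\<lambda>k. X k \<omega>) n))) \<noteq> \<infinity>"
      by (rule nn_integral_PInf_AE[OF _ fin]) measurable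
    then show ?thesis
    proof eventually_elim
      case (elim \<omega>)
      then obtain r where r: "(SUP n. ennreal (real (crossings a b (\<lambda>k. X k \<omega>) n))) = ennreal r" "r \<ge> 0"
        by (cases "SUP n. ennreal (real (crossings a b (\<lambda>k. X k \<omega>) n))") auto
      have "real (crossings a b (\<lambda>k. X k \<omega>) n) \<le> r" for n
        using SUP_upper[of n UNIV "\<lambda>n. ennreal (real (crossings a b (\<lambda>k. X k \<omega>) n))"] r by simp
      then have "crossings a b (\<lambda>k. X k \<omega>) n \<le> nat \<lfloor>r\<rfloor>" for n
        by (simp add: le_nat_floor)
      then show ?case by blast
    qed
  qed
  \<comment> \<open>Countably many pairs of levels suffice, since rationals separate a lower limit
    from a larger upper limit.\<close>
  have allq: "AE \<omega> in M. \<forall>a b :: rat. 0 \<le> a \<and> a < b \<longrightarrow>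
      (\<exists>K. \<forall>n. crossings (real_of_rat a) (real_of_rat b) (\<lambda>k. X k \<omega>) n \<le> K)"
    unfolding AE_all_countable
  proof (intro allI)
    fix a b :: rat
    show "AE \<omega> in M. 0 \<le> a \<and> a < b \<longrightarrow>
      (\<exists>K. \<forall>n. crossings (real_of_rat a) (real_of_rat b) (\<lambda>k. X k \<omega>) n \<le> K)"
    proof (cases "0 \<le> a \<and> a < b")
      case True
      then show ?thesis using bounded[of "real_of_rat a" "real_of_rat b"] by (simp add: of_rat_less)
    next
      case False
      then show ?thesis by (intro AE_I2) blast
    qed
  qed
  have dec: "(\<integral>\<omega>. X n \<omega> \<partial>M) \<le> (\<integral>\<omega>. X 0 \<omega> \<partial>M)" for n
  proof (induction n)
    case (Suc n)
    have "(\<integral>\<omega>. indicator (space M) \<omega> * X (Suc n) \<omega> \<partial>M) \<le> (\<integral>\<omega>. indicator (space M) \<omega> * X n \<omega> \<partial>M)"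
      by (rule super) auto
    moreover have "(\<integral>\<omega>. indicator (space M) \<omega> * X m \<omega> \<partial>M) = (\<integral>\<omega>. X m \<omega> \<partial>M)" for m
      by (rule Bochner_Integration.integral_cong) auto
    ultimately show ?case using Suc by simp
  qed simp
  \<comment> \<open>Fatou's lemma and the decreasing means make the lower limit finite, which
    excludes divergence to infinity.\<close>
  have "(\<integral>\<^sup>+\<omega>. liminf (\<lambda>n. ennreal (X n \<omega>)) \<partial>M) \<le> liminf (\<lambda>n. \<integral>\<^sup>+\<omega>. ennreal (X n \<omega>) \<partial>M)"
    by (rule nn_integral_liminf) simp
  also have "\<dots> \<le> liminf (\<lambda>n. ennreal (\<integral>\<omega>. X 0 \<omega> \<partial>M))"
    using dec nn by (intro Liminf_mono always_eventually) 
      (auto simp: nn_integral_eq_integral[OF int] intro!: ennreal_leI)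
  also have "\<dots> = ennreal (\<integral>\<omega>. X 0 \<omega> \<partial>M)" by (simp add: Liminf_const)
  finally have "(\<integral>\<^sup>+\<omega>. liminf (\<lambda>n. ennreal (X n \<omega>)) \<partial>M) \<noteq> \<infinity>"
    by (metis ennreal_less_top infinity_ennreal_def leD)
  then have "AE \<omega> in M. liminf (\<lambda>n. ennreal (X n \<omega>)) \<noteq> \<infinity>"
    by (intro nn_integral_PInf_AE) measurable
  with allq show ?thesis
    using AE_space
  proof eventually_elim
    case (elim \<omega>)
    let ?x = "\<lambda>n. ennreal (X n \<omega>)"
    have eq: "liminf ?x = limsup ?x"
    proof (rule ccontr)
      assume "liminf ?x \<noteq> limsup ?x"
      then have "liminf ?x < limsup ?x"
        using Liminf_le_Limsup[of sequentially ?x] by (simp add: order_le_less)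
      then obtain a :: rat where a: "liminf ?x < ennreal (real_of_rat a)" "ennreal (real_of_rat a) < limsup ?x"
        using ennreal_rat_dense by blast
      then obtain b :: rat where b: "ennreal (real_of_rat a) < ennreal (real_of_rat b)" "ennreal (real_of_rat b) < limsup ?x"
        using ennreal_rat_dense by blast
      have a0: "0 \<le> real_of_rat a" using a(1) by (metis ennreal_neg not_less_zero linear)
      have ab: "real_of_rat a < real_of_rat b"
        using b(1) a0 by (simp add: ennreal_less_iff)
      have lo: "\<exists>m>n. X m \<omega> \<le> real_of_rat a" for n
      proof (rule ccontr)
        assume "\<not> ?thesis"
        then have "eventually (\<lambda>m. ennreal (real_of_rat a) \<le> ?x m) sequentially"
          unfolding eventually_sequentially by (intro exI[of _ "Suc n"]) (auto intro!: ennreal_leI simp: not_le less_imp_le Suc_le_eq)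
        then have "ennreal (real_of_rat a) \<le> liminf ?x"
          by (rule Liminf_bounded)
        then show False using a(1) by simp
      qed
      have hi: "\<exists>m>n. real_of_rat b \<le> X m \<omega>" for n
      proof (rule ccontr)
        assume "\<not> ?thesis"
        then have "eventually (\<lambda>m. ?x m \<le> ennreal (real_of_rat b)) sequentially"
          unfolding eventually_sequentially by (intro exI[of _ "Suc n"]) (auto intro!: ennreal_leI simp: not_le less_imp_le Suc_le_eq)
        then have "limsup ?x \<le> ennreal (real_of_rat b)"
          by (rule Limsup_bounded)
        then show False using b(2) by simp
      qed
      have "\<exists>K. \<forall>n. crossings (real_of_rat a) (real_of_rat b) (\<lambda>k. X k \<omega>) n \<le> K"
        using elim(1) a0 ab by (simp add: of_rat_less)
      then obtain K where K: "\<And>n. crossings (real_of_rat a) (real_of_rat b) (\<lambda>k. X k \<omega>) n \<le> K"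
        by blast
      obtain n where "crossings (real_of_rat a) (real_of_rat b) (\<lambda>k. X k \<omega>) n \<ge> Suc K"
        using crossings_unbounded[OF ab lo hi] by blast
      then show False using K[of n] by simp
    qed
    obtain l where l: "liminf ?x = ennreal l" "l \<ge> 0"
      using elim(2) by (cases "liminf ?x") auto
    have "?x \<longlonglongrightarrow> ennreal l"
      using eq l by (simp add: tendsto_iff_Liminf_eq_Limsup)
    then have "(\<lambda>n. X n \<omega>) \<longlonglongrightarrow> l"
      by (rule tendsto_ennrealD) (use l nn elim(3) in auto)
    then show ?case by blast
  qed
qed

end

section \<open>Hitting probabilities and return times of a Markov chain\<close>

declare One_nat_def [simp del]

section \<open>Path laws on a countable state space\<close>

definition cyl :: "nat \<Rightarrow> (nat \<Rightarrow> 's) \<Rightarrow> (nat \<Rightarrow> 's) set" where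
  "cyl n xs = {X. \<forall>k\<le>n. X k = xs k}"

abbreviation path_space :: "(nat \<Rightarrow> 's) measure" where
  "path_space \<equiv> PiM UNIV (\<lambda>_. count_space UNIV)"

lemma space_path_space [simp]: "space path_space = UNIV"
  by (simp add: space_PiM)

lemma measurable_path_component [measurable]: "(\<lambda>X. X k) \<in> measurable path_space (count_space UNIV)"
  by (rule measurable_component_singleton) simp

lemma sets_path_component [measurable]: "Measurable.pred path_space (\<lambda>X. X k = a)"
  by measurable

lemma sets_cyl [measurable]: "cyl n xs \<in> sets path_space"
proof -
  have "Measurable.pred path_space (\<lambda>X. \<forall>k\<le>n. X k = xs k)"
    by measurable
  then show ?thesis by (simp add: cyl_def pred_def)
qed

text \<open>Since the state space is countable, a finite-dimensional product set is a countable
  disjoint union of cylinders of one common length; lists of length \<open>Suc n\<close> index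
  them.\<close>

lemma measure_eq_if_cyl_eq:
  fixes P Q :: "(nat \<Rightarrow> 's::countable) measure"
  assumes P: "sets P = sets path_space" and Q: "sets Q = sets path_space"
    and fin: "finite_measure P"
    and eq: "\<And>n xs. emeasure P (cyl n xs) = emeasure Q (cyl n xs)"
  shows "P = Q"
proof (rule measure_eqI_PiM_infinite[OF P Q _ fin])
  fix A :: "nat \<Rightarrow> 's set" and J :: "nat set"
  assume J: "finite J"
  define D where "D = prod_emb UNIV (\<lambda>_. count_space UNIV) J (Pi\<^sub>E J A)"
  have Dm: "D \<in> sets path_space"
    unfolding D_def by (rule sets_PiM_I) (use J in auto)
  obtain n where n: "J \<subseteq> {..n}"
    using J finite_nat_set_iff_bounded_le by auto
  have D: "X \<in> D \<longleftrightarrow> (\<forall>j\<in>J. X j \<in> A j)" for X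
    by (auto simp: D_def prod_emb_def space_PiM PiE_iff)
  define L where "L = {l :: 's list. length l = Suc n \<and> (\<forall>j\<in>J. l ! j \<in> A j)}"
  have "X \<in> D \<longleftrightarrow> X \<in> (\<Union>l\<in>L. cyl n (\<lambda>k. l ! k))" for X
  proof
    assume "X \<in> D"
    then have "map X [0..<Suc n] \<in> L"
      using n by (auto simp: L_def D nth_append simp del: upt_Suc)
    moreover have "X \<in> cyl n (\<lambda>k. map X [0..<Suc n] ! k)"
      by (auto simp: cyl_def simp del: upt_Suc)
    ultimately show "X \<in> (\<Union>l\<in>L. cyl n (\<lambda>k. l ! k))" by blast
  next
    assume "X \<in> (\<Union>l\<in>L. cyl n (\<lambda>k. l ! k))"
    then show "X \<in> D" using n by (auto simp: L_def cyl_def D subset_eq)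
  qed
  then have DU: "D = (\<Union>l\<in>L. cyl n (\<lambda>k. l ! k))" by blast
  have disj: "disjoint_family_on (\<lambda>l. cyl n (\<lambda>k. l ! k)) L"
    unfolding disjoint_family_on_def
  proof (intro ballI impI)
    fix l m assume lm: "l \<in> L" "m \<in> L" "l \<noteq> m"
    then obtain k where "k \<le> n" "l ! k \<noteq> m ! k"
      by (auto simp: L_def list_eq_iff_nth_eq less_Suc_eq_le)
    then show "cyl n (\<lambda>k. l ! k) \<inter> cyl n (\<lambda>k. m ! k) = {}"
      by (auto simp: cyl_def)
  qed
  have "emeasure P D = (\<integral>\<^sup>+l. emeasure P (cyl n (\<lambda>k. l ! k)) \<partial>count_space L)"
    unfolding DU by (rule emeasure_UN_countable) (auto simp: P disj)
  also have "\<dots> = (\<integral>\<^sup>+l. emeasure Q (cyl n (\<lambda>k. l ! k)) \<partial>count_space L)"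
    by (simp add: eq)
  also have "\<dots> = emeasure Q D"
    unfolding DU by (rule emeasure_UN_countable[symmetric]) (auto simp: Q disj)
  finally show "emeasure P (prod_emb UNIV (\<lambda>_. count_space UNIV) J (Pi\<^sub>E J A)) =
      emeasure Q (prod_emb UNIV (\<lambda>_. count_space UNIV) J (Pi\<^sub>E J A))"
    by (simp add: D_def)
qed

lemma emeasure_path_law_cyl:
  "emeasure (path_law K x) (cyl n xs) =
    (if xs 0 = x then ennreal (\<Prod>k<n. pmf (K (xs k)) (xs (Suc k))) else 0)"
  unfolding cyl_def by (rule emeasure_path_law_cylinder)

lemma measurable_case_nat_path [measurable]:
  "case_nat x \<in> measurable path_space path_space"
proof (rule measurable_PiM_single')
  fix i :: nat
  show "(\<lambda>\<omega>. case_nat x \<omega> i) \<in> measurable path_space (count_space UNIV)"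
    by (cases i) auto
qed auto

lemma case_nat_vimage_cyl:
  "case_nat x -` cyl n xs =
    (if xs 0 = x then (case n of 0 \<Rightarrow> UNIV | Suc m \<Rightarrow> cyl m (\<lambda>k. xs (Suc k))) else {})"
proof (cases n)
  case 0
  then show ?thesis by (auto simp: cyl_def)
next
  case (Suc m)
  have "(\<forall>k\<le>Suc m. case_nat x X k = xs k) \<longleftrightarrow> xs 0 = x \<and> (\<forall>k\<le>m. X k = xs (Suc k))" for X
  proof -
    have "(\<forall>k\<le>Suc m. case_nat x X k = xs k) \<longleftrightarrow> x = xs 0 \<and> (\<forall>k\<le>m. X k = xs (Suc k))"
      using All_less_Suc2[of "Suc m" "\<lambda>k. case_nat x X k = xs k"] by (simp only: less_Suc_eq_le nat.case)
    then show ?thesis by metis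
  qed
  then show ?thesis by (auto simp: cyl_def Suc)
qed

text \<open>Markov property at time 1: the mixture of the laws started from the next state, each
  prefixed with \<open>x\<close>, gives every cylinder the same mass as the path law.\<close>

lemma path_law_first_step:
  fixes K :: "'s::countable \<Rightarrow> 's pmf"
  assumes A: "A \<in> sets path_space"
  shows "emeasure (path_law K x) A =
    (\<integral>\<^sup>+y. emeasure (path_law K y) (case_nat x -` A) \<partial>measure_pmf (K x))"
proof -
  define N where
    "N = measure_pmf (K x) \<bind> (\<lambda>y. distr (path_law K y) path_space (case_nat x))"
  have m [measurable]: "case_nat x \<in> measurable (path_law K y) path_space" for y
    by (subst measurable_cong_sets[OF sets_path_law refl]) (rule measurable_case_nat_path)
  have k: "(\<lambda>y. distr (path_law K y) path_space (case_nat x))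
      \<in> measurable (measure_pmf (K x)) (subprob_algebra path_space)"
  proof -
    have "prob_space (distr (path_law K y) path_space (case_nat x))" for y
      by (rule prob_space.prob_space_distr[OF prob_space_path_law m])
    then show ?thesis
      by (auto simp: space_subprob_algebra prob_space_imp_subprob_space)
  qed
  have N: "emeasure N B = (\<integral>\<^sup>+y. emeasure (path_law K y) (case_nat x -` B) \<partial>measure_pmf (K x))"
    if "B \<in> sets path_space" for B
  proof -
    have "emeasure N B =
        (\<integral>\<^sup>+y. emeasure (distr (path_law K y) path_space (case_nat x)) B \<partial>measure_pmf (K x))"
      unfolding N_def by (rule emeasure_bind[OF _ k that]) simp
    then show ?thesis
      using that by (simp add: emeasure_distr space_path_law)
  qed
  have "path_law K x = N"
  proof (rule measure_eq_if_cyl_eq)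
    show "sets N = sets path_space"
      unfolding N_def by (rule sets_bind) auto
    show "finite_measure (path_law K x)"
      using prob_space_path_law[of K x] by (simp add: prob_space.axioms(1) prob_space_def)
    fix n and xs :: "nat \<Rightarrow> 's"
    show "emeasure (path_law K x) (cyl n xs) = emeasure N (cyl n xs)"
    proof (cases "xs 0 = x")
      case False
      then show ?thesis
        by (simp add: N sets_cyl case_nat_vimage_cyl emeasure_path_law_cyl)
    next
      case True
      show ?thesis
      proof (cases n)
        case 0
        have "emeasure (path_law K y) UNIV = 1" for y
          using prob_space.emeasure_space_1[OF prob_space_path_law[of K y]]
          by (simp add: space_path_law)
        then show ?thesis
          using True 0
          by (simp add: N sets_cyl case_nat_vimage_cyl emeasure_path_law_cyl
              measure_pmf.emeasure_space_1[simplified])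
      next
        case (Suc m)
        let ?c = "ennreal (\<Prod>k<m. pmf (K (xs (Suc k))) (xs (Suc (Suc k))))"
        have "emeasure N (cyl n xs) =
            (\<integral>\<^sup>+y. emeasure (path_law K y) (cyl m (\<lambda>k. xs (Suc k))) \<partial>measure_pmf (K x))"
          using True Suc by (simp add: N sets_cyl case_nat_vimage_cyl)
        also have "\<dots> = (\<integral>\<^sup>+y. ?c * indicator {xs (Suc 0)} y \<partial>measure_pmf (K x))"
          by (intro nn_integral_cong) (auto simp: emeasure_path_law_cyl indicator_def)
        also have "\<dots> = ?c * emeasure (measure_pmf (K x)) {xs (Suc 0)}"
          by (rule nn_integral_cmult_indicator) simp
        also have "\<dots> = emeasure (path_law K x) (cyl n xs)"
          using True Suc
          by (simp add: emeasure_path_law_cyl emeasure_pmf_single ennreal_mult[symmetric]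
              prod_nonneg prod.lessThan_Suc_shift mult.commute del: prod.lessThan_Suc)
        finally show ?thesis by simp
      qed
    qed
  qed (rule sets_path_law)
  then show ?thesis using N[OF A] by simp
qed

text \<open>Visits count at times 1 to \<open>n\<close> only, so at \<open>y = x\<close> this is a
  return probability. The first-step equation as a recursion turns later arguments into inductions
  on \<open>n\<close> free of measures on paths.\<close>

primrec hit_prob :: "('s \<Rightarrow> 's pmf) \<Rightarrow> 's \<Rightarrow> nat \<Rightarrow> 's \<Rightarrow> ennreal" where
  "hit_prob K x 0 y = 0"
| "hit_prob K x (Suc n) y = (\<integral>\<^sup>+z. (if z = x then 1 else hit_prob K x n z) \<partial>measure_pmf (K y))"

definition hit_ever :: "('s \<Rightarrow> 's pmf) \<Rightarrow> 's \<Rightarrow> 's \<Rightarrow> ennreal" where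
  "hit_ever K x y = (SUP n. hit_prob K x n y)"

lemma sets_hit [measurable]: "{X. \<exists>k\<in>{1..n}. X k = x} \<in> sets path_space"
proof -
  have "Measurable.pred path_space (\<lambda>X. \<exists>k\<in>{1..n}. X k = x)"
    by measurable
  then show ?thesis by (simp add: pred_def)
qed

lemma emeasure_path_law_start: "emeasure (path_law K x) {X. X 0 = x} = 1"
  using emeasure_path_law_cyl[of K x 0 "\<lambda>_. x"] by (simp add: cyl_def)

lemma AE_path_law_start: "AE X in path_law K x. X 0 = x"
proof -
  interpret prob_space "path_law K x" by (rule prob_space_path_law)
  have "{X. X 0 = x} \<in> sets (path_law K x)"
    using sets_cyl[of 0 "\<lambda>_. x"] by (simp add: sets_path_law cyl_def)
  then show ?thesis
    using emeasure_path_law_start[of K x] AE_in_set_eq_1[of "{X. X 0 = x}"]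
    by (simp add: measure_def)
qed

lemma emeasure_hit:
  fixes K :: "'s::countable \<Rightarrow> 's pmf"
  shows "emeasure (path_law K y) {X. \<exists>k\<in>{1..n}. X k = x} = hit_prob K x n y"
proof (induction n arbitrary: y)
  case 0
  then show ?case by simp
next
  case (Suc n)
  have vim: "case_nat y -` {X. \<exists>k\<in>{1..Suc n}. X k = x} = {X. X 0 = x \<or> (\<exists>k\<in>{1..n}. X k = x)}"
  proof -
    have "(\<exists>k\<in>{1..Suc n}. case_nat y X k = x) \<longleftrightarrow> X 0 = x \<or> (\<exists>k\<in>{1..n}. X k = x)" for X
    proof -
      have 1: "{1..Suc n} = Suc ` {..n}" by (simp add: image_Suc_atMost)
      have 2: "{..n} = insert 0 {1..n}" by auto
      have "(\<exists>k\<in>{1..Suc n}. case_nat y X k = x) \<longleftrightarrow> (\<exists>j\<in>{..n}. X j = x)"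
        unfolding 1 by simp
      also have "\<dots> \<longleftrightarrow> X 0 = x \<or> (\<exists>k\<in>{1..n}. X k = x)"
        unfolding 2 by simp
      finally show ?thesis .
    qed
    then show ?thesis by auto
  qed
  have s: "{X. X 0 = x \<or> (\<exists>k\<in>{1..n}. X k = x)} \<in> sets path_space"
  proof -
    have "{X. X 0 = x} \<in> sets path_space"
      using sets_path_component[of 0 x] by (simp add: pred_def)
    moreover have "{X. X 0 = x \<or> (\<exists>k\<in>{1..n}. X k = x)} = {X. X 0 = x} \<union> {X. \<exists>k\<in>{1..n}. X k = x}"
      by auto
    ultimately show ?thesis using sets_hit[of n x] by simp
  qed
  have *: "emeasure (path_law K z) {X. X 0 = x \<or> (\<exists>k\<in>{1..n}. X k = x)} =
      (if z = x then 1 else hit_prob K x n z)" for z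
  proof -
    interpret prob_space "path_law K z" by (rule prob_space_path_law)
    show ?thesis
    proof (cases "z = x")
      case True
      have "emeasure (path_law K z) {X. X 0 = x \<or> (\<exists>k\<in>{1..n}. X k = x)} =
          emeasure (path_law K z) (space (path_law K z))"
        using AE_path_law_start[where K=K and x=z] True s
        by (intro emeasure_eq_AE sets.top) (auto simp: sets_path_law)
      then show ?thesis using True emeasure_space_1 by simp
    next
      case False
      have "emeasure (path_law K z) {X. X 0 = x \<or> (\<exists>k\<in>{1..n}. X k = x)} =
          emeasure (path_law K z) {X. \<exists>k\<in>{1..n}. X k = x}"
        using AE_path_law_start[where K=K and x=z] False s sets_hit
        by (intro emeasure_eq_AE) (auto simp: sets_path_law)
      then show ?thesis using False Suc.IH by simp
    qed
  qed
  show ?case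
    using path_law_first_step[OF sets_hit, of K y "Suc n" x] unfolding vim * hit_prob.simps .
qed

lemma hit_prob_le_1: "hit_prob K x n y \<le> 1"
proof (induction n arbitrary: y)
  case (Suc n)
  have "hit_prob K x (Suc n) y \<le> (\<integral>\<^sup>+z. 1 \<partial>measure_pmf (K y))"
    unfolding hit_prob.simps by (intro nn_integral_mono) (auto simp: Suc)
  then show ?case by (simp add: measure_pmf.emeasure_space_1[simplified])
qed simp

lemma hit_prob_Suc_mono: "hit_prob K x n y \<le> hit_prob K x (Suc n) y"
proof (induction n arbitrary: y)
  case (Suc n)
  show ?case
    unfolding hit_prob.simps(2)[of K x n] hit_prob.simps(2)[of K x "Suc n"]
    using Suc by (intro nn_integral_mono) auto
qed simp

lemma incseq_hit_prob: "incseq (\<lambda>n. hit_prob K x n y)"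
  by (intro incseq_SucI hit_prob_Suc_mono)

lemma hit_ever_le_1: "hit_ever K x y \<le> 1"
  unfolding hit_ever_def by (intro SUP_least hit_prob_le_1)

lemma emeasure_hit_ever:
  fixes K :: "'s::countable \<Rightarrow> 's pmf"
  shows "emeasure (path_law K y) {X. \<exists>n\<ge>1. X n = x} = hit_ever K x y"
proof -
  have "{X :: nat \<Rightarrow> 's. \<exists>n\<ge>1. X n = x} = (\<Union>n. {X. \<exists>k\<in>{1..n}. X k = x})"
  proof (intro set_eqI iffI)
    fix X :: "nat \<Rightarrow> 's" assume "X \<in> {X. \<exists>n\<ge>1. X n = x}"
    then obtain n where "n \<ge> 1" "X n = x" by blast
    then have "\<exists>k\<in>{1..n}. X k = x" by (intro bexI[of _ n]) auto
    then show "X \<in> (\<Union>n. {X. \<exists>k\<in>{1..n}. X k = x})" by blast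
  qed auto
  then have "emeasure (path_law K y) {X. \<exists>n\<ge>1. X n = x} =
      (SUP n. emeasure (path_law K y) {X. \<exists>k\<in>{1..n}. X k = x})"
    by (simp only:) (rule SUP_emeasure_incseq[symmetric],
      auto simp: sets_path_law incseq_def intro: sets_hit, (meson atLeastAtMost_iff order_trans)?)
  then show ?thesis by (simp add: emeasure_hit hit_ever_def)
qed

lemma
  fixes K :: "'s::countable \<Rightarrow> 's pmf"
  shows recurrent_state_iff: "recurrent_state K x \<longleftrightarrow> hit_ever K x x = 1"
    and transient_state_iff: "transient_state K x \<longleftrightarrow> hit_ever K x x < 1"
proof -
  interpret prob_space "path_law K x" by (rule prob_space_path_law)
  have h: "hit_ever K x x = ennreal (measure (path_law K x) {X. \<exists>n\<ge>1. X n = x})"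
    by (simp only: emeasure_eq_measure[symmetric] emeasure_hit_ever)
  show "recurrent_state K x \<longleftrightarrow> hit_ever K x x = 1"
    "transient_state K x \<longleftrightarrow> hit_ever K x x < 1"
    unfolding recurrent_state_def transient_state_def h by simp_all
qed

lemma hit_ever_step:
  "hit_ever K x y = (\<integral>\<^sup>+z. (if z = x then 1 else hit_ever K x z) \<partial>measure_pmf (K y))"
proof -
  have "hit_ever K x y = (SUP n. hit_prob K x (Suc n) y)"
    unfolding hit_ever_def
  proof (rule antisym)
    show "(SUP n. hit_prob K x n y) \<le> (SUP n. hit_prob K x (Suc n) y)"
      by (rule SUP_mono) (metis hit_prob_Suc_mono UNIV_I)
    show "(SUP n. hit_prob K x (Suc n) y) \<le> (SUP n. hit_prob K x n y)"
      by (rule SUP_mono) blast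
  qed
  also have "\<dots> = (\<integral>\<^sup>+z. (SUP n. if z = x then 1 else hit_prob K x n z) \<partial>measure_pmf (K y))"
    unfolding hit_prob.simps
    by (rule nn_integral_monotone_convergence_SUP[symmetric])
      (auto simp: incseq_def le_fun_def intro: incseqD[OF incseq_hit_prob])
  also have "\<dots> = (\<integral>\<^sup>+z. (if z = x then 1 else hit_ever K x z) \<partial>measure_pmf (K y))"
    by (intro nn_integral_cong) (auto simp: hit_ever_def)
  finally show ?thesis .
qed

text \<open>Hitting probabilities are the least solution of the first-step equation. The bound is
  the one-step average of \<open>F\<close> instead of \<open>F y\<close>, so that it also controls
  the return probability at \<open>y = x\<close>, where \<open>F\<close> is not assumed
  superharmonic.\<close>

lemma hit_ever_le_superharmonic:
  fixes F :: "'s \<Rightarrow> ennreal"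
  assumes F1: "F x \<ge> 1" and sup: "\<And>y. y \<noteq> x \<Longrightarrow> (\<integral>\<^sup>+z. F z \<partial>measure_pmf (K y)) \<le> F y"
  shows "hit_ever K x y \<le> (\<integral>\<^sup>+z. F z \<partial>measure_pmf (K y))"
proof -
  have "hit_prob K x n y \<le> (\<integral>\<^sup>+z. F z \<partial>measure_pmf (K y))" for n y
  proof (induction n arbitrary: y)
    case (Suc n)
    show ?case
      unfolding hit_prob.simps
      using F1 by (intro nn_integral_mono) (auto intro: order_trans[OF Suc sup])
  qed simp
  then show ?thesis unfolding hit_ever_def by (intro SUP_least)
qed

text \<open>Tail formula for the return time. Without a return the infimum over the empty set is
  infinite, and so is the series of ones.\<close>

lemma return_time_eq:
  "return_time x X = (\<Sum>n. indicator {X. \<not> (\<exists>k\<in>{1..n}. X k = x)} X)"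
proof (cases "\<exists>n\<ge>1. X n = x")
  case False
  then have "{n. n \<ge> 1 \<and> X n = x} = {}" by auto
  moreover have "(\<lambda>n. indicator {X. \<not> (\<exists>k\<in>{1..n}. X k = x)} X) = (\<lambda>n. 1::ennreal)"
    using False by (auto simp: fun_eq_iff)
  moreover have "(\<Sum>n::nat. 1::ennreal) = \<infinity>"
  proof -
    have "(\<Sum>n::nat. 1::ennreal) = (SUP n::nat. \<Sum>i<n. 1)" by (rule suminf_eq_SUP)
    then show ?thesis by (simp add: ennreal_SUP_of_nat_eq_top)
  qed
  ultimately show ?thesis by (simp add: return_time_def)
next
  case True
  define m where "m = (LEAST n. n \<ge> 1 \<and> X n = x)"
  have m: "m \<ge> 1" "X m = x" using LeastI_ex[of "\<lambda>n. n \<ge> 1 \<and> X n = x"] True by (auto simp: m_def)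
  have least: "m \<le> n" if "n \<ge> 1" "X n = x" for n
    unfolding m_def by (rule Least_le) (use that in auto)
  have ret: "return_time x X = of_nat m"
    unfolding return_time_def
    by (intro antisym INF_lower INF_greatest) (auto simp: m least)
  have ind: "(\<exists>k\<in>{1..n}. X k = x) \<longleftrightarrow> m \<le> n" for n
    using m least by (metis One_nat_def atLeastAtMost_iff leD leI order_trans)
  have "(\<Sum>n. indicator {X. \<not> (\<exists>k\<in>{1..n}. X k = x)} X :: ennreal) =
      (\<Sum>n<m. indicator {X. \<not> (\<exists>k\<in>{1..n}. X k = x)} X)"
    by (rule suminf_finite) (simp_all only: ind indicator_def mem_Collect_eq, auto)
  also have "\<dots> = (\<Sum>n<m. 1)" by (rule sum.cong) (simp_all only: ind indicator_def mem_Collect_eq, auto)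
  finally show ?thesis using ret by simp
qed

lemma mean_return_time_eq:
  fixes K :: "'s::countable \<Rightarrow> 's pmf"
  shows "mean_return_time K x = (\<Sum>n. 1 - hit_prob K x n x)"
proof -
  interpret prob_space "path_law K x" by (rule prob_space_path_law)
  have c: "{X. \<not> (\<exists>k\<in>{1..n}. X k = x)} = space (path_law K x) - {X. \<exists>k\<in>{1..n}. X k = x}" for n
    by (auto simp: space_path_law)
  have m: "{X. \<not> (\<exists>k\<in>{1..n}. X k = x)} \<in> sets (path_law K x)" for n
    unfolding c using sets_hit[of n x] by (intro sets.Diff sets.top) (simp add: sets_path_law)
  have e: "emeasure (path_law K x) {X. \<not> (\<exists>k\<in>{1..n}. X k = x)} = 1 - hit_prob K x n x" for n
    unfolding c using sets_hit[of n x]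
    by (subst emeasure_compl)
      (use le_less_trans[OF hit_prob_le_1[of K x n x] ennreal_one_less_top] in
        \<open>auto simp: sets_path_law emeasure_hit emeasure_space_1\<close>)
  have "mean_return_time K x = (\<Sum>n. \<integral>\<^sup>+X. indicator {X. \<not> (\<exists>k\<in>{1..n}. X k = x)} X \<partial>path_law K x)"
    unfolding mean_return_time_def return_time_eq
    by (rule nn_integral_suminf) (rule borel_measurable_indicator[OF m])
  then show ?thesis
    by (simp only: nn_integral_indicator[OF m] e)
qed

text \<open>Invariance relates the paths that first reach \<open>x\<close> at a given time to those
  that do so one step earlier. Summed over all times, their masses give hitting probabilities on one
  side and the tail of the return time on the other.\<close>

lemma kac_identity:
  fixes K :: "'s::countable \<Rightarrow> 's pmf" and \<pi> :: "'s \<Rightarrow> ennreal"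
  assumes fin: "\<And>y. \<pi> y < \<infinity>"
    and inv: "\<And>z. (\<integral>\<^sup>+y. \<pi> y * ennreal (pmf (K y) z) \<partial>count_space UNIV) = \<pi> z"
  shows "\<pi> x * mean_return_time K x = (\<integral>\<^sup>+y. \<pi> y * hit_ever K x y \<partial>count_space UNIV)"
proof -
  \<comment> \<open>The probability, from \<open>y\<close>, that the first visit to \<open>x\<close>
    after time 0 occurs at time \<open>n + 1\<close>.\<close>
  define f where "f n y = hit_prob K x (Suc n) y - hit_prob K x n y" for n y
  have lt: "hit_prob K x n y < \<infinity>" for n y
    using hit_prob_le_1[of K x n y] by (simp add: le_less_trans)
  have sumf: "(\<Sum>i<n. f i y) = hit_prob K x n y" for n y
  proof (induction n)
    case (Suc n)
    then show ?case
      using hit_prob_Suc_mono[of K x n y] by (simp add: f_def add_diff_inverse_ennreal)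
  qed simp
  have f0: "f 0 y = ennreal (pmf (K y) x)" for y
  proof -
    have "(\<integral>\<^sup>+z. (if z = x then 1 else 0) \<partial>measure_pmf (K y)) = (\<integral>\<^sup>+z. indicator {x} z \<partial>measure_pmf (K y))"
      by (intro nn_integral_cong) auto
    then show ?thesis by (simp add: f_def emeasure_pmf_single cong: if_cong)
  qed
  have fSuc: "f (Suc n) y = (\<integral>\<^sup>+z. (if z = x then 0 else f n z) \<partial>measure_pmf (K y))" for n y
  proof -
    have "f (Suc n) y = (\<integral>\<^sup>+z. (if z = x then 1 else hit_prob K x (Suc n) z) -
        (if z = x then 1 else hit_prob K x n z) \<partial>measure_pmf (K y))"
      unfolding f_def hit_prob.simps(2)[of K x "Suc n" y] hit_prob.simps(2)[of K x n y]
    proof (rule nn_integral_diff[symmetric])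
      show "(\<integral>\<^sup>+z. (if z = x then 1 else hit_prob K x n z) \<partial>measure_pmf (K y)) \<noteq> \<infinity>"
        using lt[of "Suc n" y] by simp
    qed (auto intro: hit_prob_Suc_mono simp del: hit_prob.simps)
    also have "\<dots> = (\<integral>\<^sup>+z. (if z = x then 0 else f n z) \<partial>measure_pmf (K y))"
      by (intro nn_integral_cong) (auto simp: f_def)
    finally show ?thesis .
  qed
  have step: "(\<integral>\<^sup>+y. \<pi> y * (\<integral>\<^sup>+z. g z \<partial>measure_pmf (K y)) \<partial>count_space UNIV) =
      (\<integral>\<^sup>+z. \<pi> z * g z \<partial>count_space UNIV)" for g :: "'s \<Rightarrow> ennreal"
  proof -
    have "(\<integral>\<^sup>+y. \<pi> y * (\<integral>\<^sup>+z. g z \<partial>measure_pmf (K y)) \<partial>count_space UNIV) =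
        (\<integral>\<^sup>+y. (\<integral>\<^sup>+z. \<pi> y * ennreal (pmf (K y) z) * g z \<partial>count_space UNIV) \<partial>count_space UNIV)"
      by (simp add: nn_integral_measure_pmf nn_integral_cmult mult.assoc)
    also have "\<dots> = (\<integral>\<^sup>+z. (\<integral>\<^sup>+y. \<pi> y * ennreal (pmf (K y) z) * g z \<partial>count_space UNIV) \<partial>count_space UNIV)"
      by (rule nn_integral_count_space_nn_integral) simp_all
    also have "\<dots> = (\<integral>\<^sup>+z. \<pi> z * g z \<partial>count_space UNIV)"
      by (simp add: nn_integral_multc inv)
    finally show ?thesis .
  qed
  \<comment> \<open>One use of invariance leads from \<open>n + 1\<close> to \<open>n\<close> but
    skips the state \<open>x\<close>; removing \<open>\<pi> x * f n x\<close> each time leaves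
    \<open>\<pi> x\<close> times the probability of no return by time \<open>n\<close>.\<close>
  have key: "(\<integral>\<^sup>+y. \<pi> y * f n y \<partial>count_space UNIV) = \<pi> x * (1 - hit_prob K x n x)" for n
  proof (induction n)
    case 0
    then show ?case by (simp add: f0 inv)
  next
    case (Suc n)
    have split: "(\<integral>\<^sup>+y. \<pi> y * f n y \<partial>count_space UNIV) =
        \<pi> x * f n x + (\<integral>\<^sup>+z. \<pi> z * (if z = x then 0 else f n z) \<partial>count_space UNIV)"
    proof -
      have "(\<integral>\<^sup>+y. \<pi> y * f n y \<partial>count_space UNIV) =
          (\<integral>\<^sup>+y. \<pi> x * f n x * indicator {x} y + \<pi> y * (if y = x then 0 else f n y) \<partial>count_space UNIV)"
        by (intro nn_integral_cong) auto
      then show ?thesis by (simp add: nn_integral_add nn_integral_cmult)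
    qed
    have fl: "\<pi> x * f n x < \<infinity>"
      using fin[of x] lt[of "Suc n" x] by (simp add: f_def ennreal_mult_less_top) 
        (metis diff_le_self_ennreal le_less_trans)
    have "(\<integral>\<^sup>+y. \<pi> y * f (Suc n) y \<partial>count_space UNIV) =
        (\<integral>\<^sup>+z. \<pi> z * (if z = x then 0 else f n z) \<partial>count_space UNIV)"
      by (simp only: fSuc step)
    also have "\<dots> = \<pi> x * (1 - hit_prob K x n x) - \<pi> x * f n x"
      using Suc split fl by (metis ennreal_add_diff_cancel_left less_irrefl infinity_ennreal_def)
    also have "\<dots> = \<pi> x * (1 - hit_prob K x n x - f n x)"
      by (rule ennreal_right_diff_distrib[symmetric]) (use fin[of x] in auto)
    also have "1 - hit_prob K x n x - f n x = 1 - (\<Sum>i<Suc n. f i x)"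
      by (subst sum.lessThan_Suc) (simp only: sumf diff_add_eq_diff_diff_swap_ennreal)
    also have "\<dots> = 1 - hit_prob K x (Suc n) x"
      by (simp only: sumf)
    finally show ?case .
  qed
  have "hit_ever K x y = (\<Sum>n. f n y)" for y
    unfolding hit_ever_def suminf_eq_SUP sumf ..
  then have "(\<integral>\<^sup>+y. \<pi> y * hit_ever K x y \<partial>count_space UNIV) =
      (\<integral>\<^sup>+y. (\<Sum>n. \<pi> y * f n y) \<partial>count_space UNIV)"
    by simp
  also have "\<dots> = (\<Sum>n. \<integral>\<^sup>+y. \<pi> y * f n y \<partial>count_space UNIV)"
    by (rule nn_integral_suminf) simp
  also have "\<dots> = \<pi> x * mean_return_time K x"
    by (simp add: key mean_return_time_eq)
  finally show ?thesis by simp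
qed

lemma nn_integral_pmf_eq_const:
  fixes g :: "'s \<Rightarrow> ennreal"
  assumes c: "c \<noteq> \<infinity>" and ge: "\<And>z. c \<le> g z" and le: "(\<integral>\<^sup>+z. g z \<partial>measure_pmf p) \<le> c"
  assumes z: "z \<in> set_pmf p"
  shows "g z = c"
proof -
  have 1: "(\<integral>\<^sup>+z. c \<partial>measure_pmf p) = c"
    by (simp add: measure_pmf.emeasure_space_1[simplified])
  have "(\<integral>\<^sup>+z. g z - c \<partial>measure_pmf p) = (\<integral>\<^sup>+z. g z \<partial>measure_pmf p) - (\<integral>\<^sup>+z. c \<partial>measure_pmf p)"
    by (rule nn_integral_diff) (use c ge in \<open>auto simp: 1 measure_pmf.emeasure_space_1[simplified]\<close>)
  also have "\<dots> = 0"
    unfolding 1 using le c by (simp add: diff_eq_0_iff_ennreal less_top)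
  finally have "AE z in measure_pmf p. g z - c = 0"
    by (subst (asm) nn_integral_0_iff_AE) auto
  then have "g z - c = 0" using z by (auto simp: AE_measure_pmf_iff)
  then show ?thesis using ge[of z] c
    by (metis antisym diff_eq_0_iff_ennreal)
qed

lemma nn_integral_pmf_eq_1:
  fixes g :: "'s \<Rightarrow> ennreal"
  assumes le: "\<And>z. g z \<le> 1" and eq: "(\<integral>\<^sup>+z. g z \<partial>measure_pmf p) = 1"
  assumes z: "z \<in> set_pmf p"
  shows "g z = 1"
proof -
  have 1: "(\<integral>\<^sup>+z. 1 \<partial>measure_pmf p) = 1"
    by (simp add: measure_pmf.emeasure_space_1[simplified])
  have "(\<integral>\<^sup>+z. 1 - g z \<partial>measure_pmf p) = (\<integral>\<^sup>+z. 1 \<partial>measure_pmf p) - (\<integral>\<^sup>+z. g z \<partial>measure_pmf p)"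
    by (rule nn_integral_diff) (use le eq in auto)
  also have "\<dots> = 0" unfolding 1 eq by simp
  finally have "AE z in measure_pmf p. 1 - g z = 0"
    by (subst (asm) nn_integral_0_iff_AE) auto
  then have "1 - g z = 0" using z by (auto simp: AE_measure_pmf_iff)
  then show ?thesis using le[of z] by (metis antisym diff_eq_0_iff_ennreal)
qed

section \<open>Irreducible chains: superharmonic functions and recurrence criteria\<close>

definition step_rel :: "('s \<Rightarrow> 's pmf) \<Rightarrow> ('s \<times> 's) set" where
  "step_rel K = {(y, z). z \<in> set_pmf (K y)}"

text \<open>Maximum principle: the hitting probability, set to 1 at \<open>x\<close>, has its
  maximum at \<open>x\<close>, and a mean equal to the maximum forces the same value at every
  possible next state.\<close>

lemma recurrent_hits_from_everywhere:
  assumes irr: "\<And>a b. (a, b) \<in> (step_rel K)\<^sup>*" and rec: "hit_ever K x x = 1"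
  shows "hit_ever K x y = 1"
proof -
  define g where "g y = (if y = x then 1 else hit_ever K x y)" for y
  have g1: "g y \<le> 1" for y by (simp add: g_def hit_ever_le_1)
  have "(x, y) \<in> (step_rel K)\<^sup>*" by (rule irr)
  then have "g y = 1 \<and> hit_ever K x y = 1"
  proof (induction rule: rtrancl_induct)
    case base
    then show ?case by (simp add: g_def rec)
  next
    case (step y z)
    have "(\<integral>\<^sup>+z. g z \<partial>measure_pmf (K y)) = 1"
      using hit_ever_step[of K x y] step by (simp add: g_def cong: if_cong)
    then have "g z = 1"
      using nn_integral_pmf_eq_1[OF g1] step(2) by (auto simp: step_rel_def)
    then show ?case by (auto simp: g_def rec split: if_splits)
  qed
  then show ?thesis by simp
qed

text \<open>A superharmonic function dominates its value at \<open>x\<close> times the probability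
  of hitting \<open>x\<close>, hence is minimal at \<open>x\<close>; the minimum then spreads along
  the steps.\<close>

lemma superharmonic_constant:
  fixes h :: "'s \<Rightarrow> ennreal"
  assumes irr: "\<And>a b. (a, b) \<in> (step_rel K)\<^sup>*" and rec: "hit_ever K x x = 1"
    and sup: "\<And>y. (\<integral>\<^sup>+z. h z \<partial>measure_pmf (K y)) \<le> h y" and fin: "h x \<noteq> \<infinity>"
  shows "h y = h x"
proof -
  have "h x * hit_prob K x n y \<le> h y" for n y
  proof (induction n arbitrary: y)
    case (Suc n)
    have "h x * hit_prob K x (Suc n) y =
        (\<integral>\<^sup>+z. h x * (if z = x then 1 else hit_prob K x n z) \<partial>measure_pmf (K y))"
      by (simp add: nn_integral_cmult)
    also have "\<dots> \<le> (\<integral>\<^sup>+z. h z \<partial>measure_pmf (K y))"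
      by (intro nn_integral_mono) (auto simp: Suc)
    finally show ?case using sup[of y] by (rule order_trans)
  qed simp
  then have "h x * hit_ever K x y \<le> h y" for y
    unfolding hit_ever_def SUP_mult_left_ennreal by (intro SUP_least)
  then have ge: "h x \<le> h y" for y
    using recurrent_hits_from_everywhere[OF irr rec] by (metis mult.right_neutral)
  have "(x, y) \<in> (step_rel K)\<^sup>*" by (rule irr)
  then show ?thesis
  proof (induction rule: rtrancl_induct)
    case (step y z)
    show ?case
      by (rule nn_integral_pmf_eq_const[OF fin ge, of "K y"])
        (use sup[of y] step in \<open>auto simp: step_rel_def\<close>)
  qed simp
qed

text \<open>The probability of hitting \<open>z\<close>, set to 1 at \<open>z\<close>, is
  superharmonic and therefore constant.\<close>

lemma hit_ever_eq_1:
  assumes irr: "\<And>a b. (a, b) \<in> (step_rel K)\<^sup>*" and rec: "hit_ever K x x = 1"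
  shows "hit_ever K z y = 1"
proof -
  define h where "h y = (if y = z then 1 else hit_ever K z y)" for y
  have Kh: "(\<integral>\<^sup>+v. h v \<partial>measure_pmf (K y)) = hit_ever K z y" for y
    using hit_ever_step[of K z y] by (simp add: h_def cong: if_cong)
  have "h v = h x" for v
  proof (rule superharmonic_constant[OF irr rec])
    show "(\<integral>\<^sup>+z. h z \<partial>measure_pmf (K y)) \<le> h y" for y
      unfolding Kh by (simp add: h_def hit_ever_le_1)
    have "h x \<le> 1" by (simp add: h_def hit_ever_le_1)
    then show "h x \<noteq> \<infinity>" using le_less_trans[OF _ ennreal_one_less_top] by fastforce
  qed
  then have "h v = 1" for v
    using h_def[of z] by metis
  then have "(\<integral>\<^sup>+v. h v \<partial>measure_pmf (K y)) = 1"
    by (simp add: measure_pmf.emeasure_space_1[simplified])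
  then show ?thesis using Kh by simp
qed

text \<open>Kac's identity bounds the mean return time by the total mass. Recurrence follows, since
  a positive probability of no return would bound every tail from below and make their sum
  diverge.\<close>

lemma ergodic_if_finite_invariant:
  fixes K :: "'s::countable \<Rightarrow> 's pmf" and \<pi> :: "'s \<Rightarrow> ennreal"
  assumes fin: "\<And>y. \<pi> y < \<infinity>" and pos: "\<And>y. 0 < \<pi> y"
    and inv: "\<And>z. (\<integral>\<^sup>+y. \<pi> y * ennreal (pmf (K y) z) \<partial>count_space UNIV) = \<pi> z"
    and tot: "(\<integral>\<^sup>+y. \<pi> y \<partial>count_space UNIV) < \<infinity>"
  shows "ergodic K"
proof -
  have mean: "mean_return_time K x < \<infinity>" for x
  proof -
    have "\<pi> x * mean_return_time K x \<le> (\<integral>\<^sup>+y. \<pi> y \<partial>count_space UNIV)"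
      unfolding kac_identity[OF fin inv]
      by (intro nn_integral_mono) (metis hit_ever_le_1 mult_left_mono mult.right_neutral zero_le)
    then have "\<pi> x * mean_return_time K x < \<infinity>" using tot by (rule le_less_trans)
    then show ?thesis using pos[of x] by (auto simp: ennreal_mult_less_top)
  qed
  have rec: "hit_ever K x x = 1" for x
  proof -
    define c where "c = 1 - hit_ever K x x"
    have "of_nat n * c \<le> mean_return_time K x" for n :: nat
    proof -
      have "of_nat n * c = (\<Sum>k<n. c)" by simp
      also have "\<dots> \<le> (\<Sum>k<n. 1 - hit_prob K x k x)"
        unfolding c_def hit_ever_def by (intro sum_mono ennreal_mono_minus SUP_upper) simp
      also have "\<dots> \<le> mean_return_time K x"
        unfolding mean_return_time_eq by (rule sum_le_suminf) auto
      finally show ?thesis .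
    qed
    moreover obtain m where m: "mean_return_time K x = ennreal m" "m \<ge> 0"
      using mean[of x] by (cases "mean_return_time K x") auto
    moreover obtain c' where c': "c = ennreal c'" "c' \<ge> 0"
      unfolding c_def by (metis diff_le_self_ennreal ennreal_cases ennreal_one_neq_top neq_top_trans)
    ultimately have "real n * c' \<le> m" for n :: nat
      by (metis ennreal_le_iff ennreal_mult' ennreal_of_nat_eq_real_of_nat of_nat_0_le_iff)
    then have "c' \<le> 0" using reals_Archimedean3[of c'] by (meson not_le)
    then have "c = 0" using c' by simp
    then show ?thesis
      unfolding c_def using hit_ever_le_1[of K x x] by (metis antisym diff_eq_0_iff_ennreal)
  qed
  define Z where "Z = (\<integral>\<^sup>+y. \<pi> y \<partial>count_space UNIV)"
  obtain x0 :: 's where True by blast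
  have "\<pi> x0 \<le> Z"
  proof -
    have "\<pi> x0 = (\<integral>\<^sup>+y. \<pi> x0 * indicator {x0} y \<partial>count_space UNIV)"
      by (simp add: nn_integral_cmult)
    also have "\<dots> \<le> Z"
      unfolding Z_def by (intro nn_integral_mono) (auto simp: indicator_def)
    finally show ?thesis .
  qed
  then have Z: "0 < Z" "Z < \<infinity>"
    using pos[of x0] tot by (auto simp: Z_def)
  define q where "q y = enn2real (\<pi> y / Z)" for y
  have eq: "ennreal (q y) = \<pi> y / Z" for y
    unfolding q_def using fin[of y] Z
    by (intro ennreal_enn2real) (auto simp: ennreal_divide_eq_top_iff less_top[symmetric])
  have tot1: "(\<integral>\<^sup>+y. ennreal (q y) \<partial>count_space UNIV) = 1"
    unfolding eq using Z by (simp add: nn_integral_divide Z_def[symmetric] ennreal_divide_self)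
  define \<mu> where "\<mu> = embed_pmf q"
  have \<mu>: "pmf \<mu> y = q y" for y
    unfolding \<mu>_def by (rule pmf_embed_pmf[OF _ tot1]) (simp add: q_def)
  have "stationary K \<mu>"
    unfolding stationary_def
  proof (rule pmf_eqI)
    fix z
    have "ennreal (pmf (bind_pmf \<mu> K) z) =
        (\<integral>\<^sup>+y. (\<pi> y * ennreal (pmf (K y) z)) / Z \<partial>count_space UNIV)"
      unfolding ennreal_pmf_bind nn_integral_measure_pmf \<mu> eq
      by (intro nn_integral_cong) (simp add: divide_ennreal_def mult_ac)
    also have "\<dots> = \<pi> z / Z" by (simp add: nn_integral_divide inv)
    also have "\<dots> = ennreal (pmf \<mu> z)" by (simp add: \<mu> eq)
    finally show "pmf (bind_pmf \<mu> K) z = pmf \<mu> z" by simp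
  qed
  then show ?thesis
    unfolding ergodic_def recurrent_state_iff using mean rec by auto
qed

text \<open>All hitting probabilities are 1, so Kac's identity equates the mass of a state times its
  mean return time with the infinite total mass.\<close>

lemma null_recurrent_if_infinite_invariant:
  fixes K :: "'s::countable \<Rightarrow> 's pmf" and \<pi> :: "'s \<Rightarrow> ennreal"
  assumes fin: "\<And>y. \<pi> y < \<infinity>"
    and inv: "\<And>z. (\<integral>\<^sup>+y. \<pi> y * ennreal (pmf (K y) z) \<partial>count_space UNIV) = \<pi> z"
    and tot: "(\<integral>\<^sup>+y. \<pi> y \<partial>count_space UNIV) = \<infinity>"
    and irr: "\<And>a b. (a, b) \<in> (step_rel K)\<^sup>*" and rec: "hit_ever K x x = 1"
  shows "null_recurrent K"
proof -
  have h: "hit_ever K z y = 1" for z y by (rule hit_ever_eq_1[OF irr rec])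
  have "\<pi> z * mean_return_time K z = \<infinity>" for z
    unfolding kac_identity[OF fin inv] by (simp add: h tot)
  then have "mean_return_time K z = \<infinity>" for z
    using fin[of z] by (metis ennreal_mult_less_top infinity_ennreal_def less_top)
  then show ?thesis
    unfolding null_recurrent_def recurrent_state_iff by (simp add: h)
qed

lemma transient_if_transient_state:
  fixes K :: "'s::countable \<Rightarrow> 's pmf"
  assumes irr: "\<And>a b. (a, b) \<in> (step_rel K)\<^sup>*" and tr: "hit_ever K x x < 1"
  shows "transient K"
  unfolding transient_def transient_state_iff
proof
  fix y
  show "hit_ever K y y < 1"
    using hit_ever_eq_1[OF irr, of y x x] tr hit_ever_le_1[of K y y]
    by (metis less_irrefl order_le_less)
qed

section \<open>The walk on the tree in a fixed environment\<close>

text \<open>The almost sure properties of the environment, collected so that the analysis of the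
  walk concerns one fixed weight family.\<close>

definition env_ok :: "('d::finite list \<Rightarrow> 'd option \<Rightarrow> real) \<Rightarrow> bool" where
  "env_ok w \<longleftrightarrow> (\<forall>v. (\<forall>i\<in>moves v. w v i > 0) \<and> (\<Sum>i\<in>moves v. w v i) = 1)"

lemma sum_option: "(\<Sum>i\<in>UNIV. f i) = f None + (\<Sum>j\<in>(UNIV::'d::finite set). f (Some j))"
  by (simp add: UNIV_option_conv sum.reindex)

lemma env_ok_Some: "env_ok w \<Longrightarrow> w v (Some j) > 0"
  by (auto simp: env_ok_def moves_def)

lemma env_ok_None: "env_ok w \<Longrightarrow> v \<noteq> [] \<Longrightarrow> w v None > 0"
  by (auto simp: env_ok_def moves_def)

lemma env_ok_root: "env_ok w \<Longrightarrow> (\<Sum>j\<in>UNIV. w [] (Some j)) = 1"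
  using sum.reindex[of Some UNIV "w []"] by (auto simp: env_ok_def moves_def dest!: spec[of _ "[]"])

lemma env_ok_sum: "env_ok w \<Longrightarrow> v \<noteq> [] \<Longrightarrow> w v None + (\<Sum>j\<in>UNIV. w v (Some j)) = 1"
  using sum_option[of "w v"] by (auto simp: env_ok_def moves_def dest!: spec[of _ v])

lemma pmf_tree_kernel_env_ok:
  "env_ok w \<Longrightarrow> pmf (tree_kernel w u) v = transition_prob w u v"
  by (rule pmf_tree_kernel) (auto simp: env_ok_def)

lemma butlast_neq_snoc: "butlast u \<noteq> u @ [j]"
proof
  assume "butlast u = u @ [j]"
  then have "length (butlast u) = length (u @ [j])" by simp
  then show False by simp
qed

lemma snoc_neq_butlast: "u \<noteq> [] \<Longrightarrow> u \<noteq> butlast (butlast u)"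
proof
  assume "u \<noteq> []" "u = butlast (butlast u)"
  then have "length u = length u - 1 - 1" by (metis length_butlast)
  with \<open>u \<noteq> []\<close> show False by (cases u) auto
qed

lemma transition_prob_child: "transition_prob w u (u @ [j]) = w u (Some j)"
  by (simp add: transition_prob_def)

lemma transition_prob_parent: "u \<noteq> [] \<Longrightarrow> transition_prob w u (butlast u) = w u None"
  using snoc_neq_butlast[of u] by (auto simp: transition_prob_def)

lemma transition_prob_other:
  "(\<And>j. v \<noteq> u @ [j]) \<Longrightarrow> (u \<noteq> [] \<Longrightarrow> v \<noteq> butlast u) \<Longrightarrow> transition_prob w u v = 0"
  unfolding transition_prob_def by (metis append_butlast_last_id)

lemma nn_integral_tree_kernel:
  assumes w: "env_ok w"
  shows "(\<integral>\<^sup>+v. F v \<partial>measure_pmf (tree_kernel w u)) =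
    (if u = [] then 0 else ennreal (w u None) * F (butlast u)) +
    (\<Sum>j\<in>UNIV. ennreal (w u (Some j)) * F (u @ [j]))"
proof -
  define C where "C = range (\<lambda>j. u @ [j])"
  define B where "B = (if u = [] then {} else {butlast u})"
  have disj: "B \<inter> C = {}" using butlast_neq_snoc[of u] by (auto simp: B_def C_def)
  have fin: "finite B" "finite C" by (auto simp: B_def C_def)
  have "(\<integral>\<^sup>+v. F v \<partial>measure_pmf (tree_kernel w u)) =
      (\<integral>\<^sup>+v. ennreal (transition_prob w u v) * F v \<partial>count_space UNIV)"
    by (simp add: nn_integral_measure_pmf pmf_tree_kernel_env_ok[OF w])
  also have "\<dots> = (\<Sum>v\<in>B \<union> C. ennreal (transition_prob w u v) * F v)"
  proof (rule nn_integral_count_space')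
    fix v assume "v \<notin> B \<union> C"
    then have "transition_prob w u v = 0"
      by (intro transition_prob_other) (auto simp: B_def C_def)
    then show "ennreal (transition_prob w u v) * F v = 0" by simp
  qed (auto simp: fin)
  also have "\<dots> = (\<Sum>v\<in>B. ennreal (transition_prob w u v) * F v) +
      (\<Sum>v\<in>C. ennreal (transition_prob w u v) * F v)"
    by (rule sum.union_disjoint[OF fin disj])
  also have "(\<Sum>v\<in>C. ennreal (transition_prob w u v) * F v) =
      (\<Sum>j\<in>UNIV. ennreal (w u (Some j)) * F (u @ [j]))"
    unfolding C_def by (subst sum.reindex) (auto simp: inj_on_def transition_prob_child)
  also have "(\<Sum>v\<in>B. ennreal (transition_prob w u v) * F v) =
      (if u = [] then 0 else ennreal (w u None) * F (butlast u))"
    by (simp add: B_def transition_prob_parent)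
  finally show ?thesis .
qed

lemma tree_kernel_irreducible:
  assumes w: "env_ok w"
  shows "(a, b) \<in> (step_rel (tree_kernel w))\<^sup>*"
proof -
  let ?R = "step_rel (tree_kernel w)"
  have child: "(u, u @ [j]) \<in> ?R" for u j
    using env_ok_Some[OF w, of u j]
    by (simp add: step_rel_def set_pmf_iff pmf_tree_kernel_env_ok[OF w] transition_prob_child)
  have parent: "(u @ [j], u) \<in> ?R" for u j
    using env_ok_None[OF w, of "u @ [j]"] transition_prob_parent[of "u @ [j]" w]
    by (simp add: step_rel_def set_pmf_iff pmf_tree_kernel_env_ok[OF w])
  have "(a, []) \<in> ?R\<^sup>*"
    by (induction a rule: rev_induct) (auto intro: converse_rtrancl_into_rtrancl[OF parent])
  moreover have "([], b) \<in> ?R\<^sup>*"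
    by (induction b rule: rev_induct) (auto intro: rtrancl_into_rtrancl[OF _ child])
  ultimately show ?thesis by (rule rtrancl_trans)
qed

section \<open>Path weights, level sums and the reversible measure\<close>

lemma edge_weight_snoc:
  "edge_weight w (v @ [j]) =
    (if v = [] then w [] (Some j) else w v (Some j) / w v None)"
  by (simp add: edge_weight_def)

lemma path_weight_Nil [simp]: "path_weight w [] = 1"
  by (simp add: path_weight_def)

lemma path_weight_snoc: "path_weight w (v @ [j]) = path_weight w v * edge_weight w (v @ [j])"
proof -
  have "(\<Prod>k=1..length v. edge_weight w (take k (v @ [j]))) =
      (\<Prod>k=1..length v. edge_weight w (take k v))"
    by (rule prod.cong) auto
  then show ?thesis by (simp add: path_weight_def)
qed

lemma edge_weight_pos: "env_ok w \<Longrightarrow> v \<noteq> [] \<Longrightarrow> edge_weight w v > 0"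
  using edge_weight_snoc[of w "butlast v" "last v"]
  by (simp add: env_ok_Some env_ok_None)

lemma path_weight_pos: "env_ok w \<Longrightarrow> path_weight w v > 0"
  by (induction v rule: rev_induct) (simp_all add: path_weight_snoc edge_weight_pos)

lemma finite_level [simp]: "finite {v :: 'd::finite list. length v = n}"
  using finite_lists_length_eq[of "UNIV :: 'd set" n] by simp

lemma sum_level_Suc_snoc:
  "(\<Sum>v\<in>{v :: 'd::finite list. length v = Suc n}. F v) =
    (\<Sum>v\<in>{v. length v = n}. \<Sum>j\<in>UNIV. F (v @ [j]))"
proof -
  have "{v :: 'd list. length v = Suc n} = (\<lambda>(v, j). v @ [j]) ` ({v. length v = n} \<times> UNIV)"
    by (auto simp: length_Suc_conv_rev image_iff)
  moreover have "inj_on (\<lambda>(v, j). v @ [j]) ({v :: 'd list. length v = n} \<times> UNIV)"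
    by (auto simp: inj_on_def)
  ultimately show ?thesis by (simp add: sum.reindex sum.cartesian_product case_prod_unfold)
qed

lemma sum_level_Suc_Cons:
  "(\<Sum>v\<in>{v :: 'd::finite list. length v = Suc n}. F v) =
    (\<Sum>j\<in>UNIV. \<Sum>v\<in>{v. length v = n}. F (j # v))"
proof -
  have "{v :: 'd list. length v = Suc n} = (\<lambda>(j, v). j # v) ` (UNIV \<times> {v. length v = n})"
    by (auto simp: length_Suc_conv image_iff)
  moreover have "inj_on (\<lambda>(j, v). j # v) (UNIV \<times> {v :: 'd list. length v = n})"
    by (auto simp: inj_on_def)
  ultimately show ?thesis by (simp add: sum.reindex sum.cartesian_product case_prod_unfold)
qed

lemma nn_integral_levels:
  fixes F :: "'d::finite list \<Rightarrow> ennreal"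
  shows "(\<integral>\<^sup>+v. F v \<partial>count_space UNIV) = (\<Sum>n. \<Sum>v\<in>{v. length v = n}. F v)"
proof -
  have "F v = (\<Sum>n. F v * indicator {v. length v = n} v)" for v
  proof -
    have "(\<Sum>n. F v * indicator {v. length v = n} v) =
        (\<Sum>n\<in>{length v}. F v * indicator {v. length v = n} v)"
      by (rule suminf_finite) auto
    then show ?thesis by simp
  qed
  then have "(\<integral>\<^sup>+v. F v \<partial>count_space UNIV) =
      (\<integral>\<^sup>+v. (\<Sum>n. F v * indicator {v. length v = n} v) \<partial>count_space UNIV)"
    by simp
  also have "\<dots> = (\<Sum>n. \<integral>\<^sup>+v. F v * indicator {v. length v = n} v \<partial>count_space UNIV)"
    by (rule nn_integral_suminf) simp
  also have "(\<lambda>n. \<integral>\<^sup>+v. F v * indicator {v. length v = n} v \<partial>count_space UNIV) =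
      (\<lambda>n. \<Sum>v\<in>{v. length v = n}. F v)"
  proof
    fix n
    have "(\<integral>\<^sup>+v. F v * indicator {v. length v = n} v \<partial>count_space UNIV) =
        (\<Sum>v\<in>{v. length v = n}. F v * indicator {v. length v = n} v)"
      by (rule nn_integral_count_space') auto
    then show "(\<integral>\<^sup>+v. F v * indicator {v. length v = n} v \<partial>count_space UNIV) =
        (\<Sum>v\<in>{v. length v = n}. F v)"
      by simp
  qed
  finally show ?thesis .
qed

text \<open>The root has no weight \<open>None\<close>; the value 1 is the one that balances the
  edges at the root, where the edge variable is the transition probability itself.\<close>

definition rev_measure :: "('d::finite list \<Rightarrow> 'd option \<Rightarrow> real) \<Rightarrow> 'd list \<Rightarrow> real" where
  "rev_measure w v = (if v = [] then 1 else path_weight w v / w v None)"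

lemma rev_measure_pos: "env_ok w \<Longrightarrow> rev_measure w v > 0"
  by (simp add: rev_measure_def path_weight_pos env_ok_None)

lemma rev_measure_edge:
  assumes w: "env_ok w"
  shows "rev_measure w u * w u (Some j) = rev_measure w (u @ [j]) * w (u @ [j]) None"
  using env_ok_None[OF w, of "u @ [j]"] env_ok_None[OF w, of u]
  by (auto simp: rev_measure_def path_weight_snoc edge_weight_snoc)

lemma detailed_balance:
  assumes w: "env_ok w"
  shows "rev_measure w u * transition_prob w u v = rev_measure w v * transition_prob w v u"
proof -
  consider (c) j where "v = u @ [j]" | (p) j where "u = v @ [j]"
    | (o) "\<And>j. v \<noteq> u @ [j]" "\<And>j. u \<noteq> v @ [j]" by blast
  then show ?thesis
  proof cases
    case c
    then show ?thesis
      using rev_measure_edge[OF w, of u j] transition_prob_parent[of v w]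
      by (simp add: transition_prob_child)
  next
    case p
    then show ?thesis
      using rev_measure_edge[OF w, of v j] transition_prob_parent[of u w]
      by (simp add: transition_prob_child)
  next
    case o
    have "transition_prob w u v = 0" "transition_prob w v u = 0"
      by (intro transition_prob_other; metis o append_butlast_last_id)+
    then show ?thesis by simp
  qed
qed

lemma rev_measure_invariant:
  assumes w: "env_ok w"
  shows "(\<integral>\<^sup>+y. ennreal (rev_measure w y) * ennreal (pmf (tree_kernel w y) z) \<partial>count_space UNIV) =
    ennreal (rev_measure w z)"
proof -
  have "(\<integral>\<^sup>+y. ennreal (rev_measure w y) * ennreal (pmf (tree_kernel w y) z) \<partial>count_space UNIV) =
      (\<integral>\<^sup>+y. ennreal (rev_measure w z) * ennreal (pmf (tree_kernel w z) y) \<partial>count_space UNIV)"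
    using detailed_balance[OF w] rev_measure_pos[OF w]
    by (intro nn_integral_cong)
      (simp add: pmf_tree_kernel_env_ok[OF w, symmetric] ennreal_mult[symmetric] less_imp_le)
  also have "\<dots> = ennreal (rev_measure w z) *
      (\<integral>\<^sup>+y. ennreal (pmf (tree_kernel w z) y) * 1 \<partial>count_space UNIV)"
    by (simp add: nn_integral_cmult)
  also have "(\<integral>\<^sup>+y. ennreal (pmf (tree_kernel w z) y) * 1 \<partial>count_space UNIV) = 1"
    unfolding nn_integral_measure_pmf[symmetric]
    by (simp add: measure_pmf.emeasure_space_1[simplified])
  finally show ?thesis by simp
qed

lemma chaos_pos: "env_ok w \<Longrightarrow> chaos w n > 0"
  unfolding chaos_def
proof (rule sum_pos)
  show "{v :: 'd::finite list. length v = n} \<noteq> {}"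
    using length_replicate[of n "undefined :: 'd"] by blast
qed (auto simp: path_weight_pos)

lemma rev_measure_eq:
  assumes w: "env_ok w" and v: "v \<noteq> []"
  shows "rev_measure w v = path_weight w v + (\<Sum>j\<in>UNIV. path_weight w (v @ [j]))"
proof -
  have "(\<Sum>j\<in>UNIV. path_weight w (v @ [j])) =
      path_weight w v * ((\<Sum>j\<in>UNIV. w v (Some j)) / w v None)"
    using v by (simp add: path_weight_snoc edge_weight_snoc sum_distrib_left sum_divide_distrib)
  also have "(\<Sum>j\<in>UNIV. w v (Some j)) = 1 - w v None"
    using env_ok_sum[OF w v] by simp
  finally show ?thesis
    using env_ok_None[OF w v] v by (simp add: rev_measure_def field_simps)
qed

lemma sum_rev_measure_level:
  assumes w: "env_ok w"
  shows "(\<Sum>v\<in>{v. length v = n}. rev_measure w v) =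
    (if n = 0 then 1 else chaos w n + chaos w (Suc n))"
proof (cases n)
  case (Suc m)
  have "(\<Sum>v\<in>{v. length v = n}. rev_measure w v) =
      (\<Sum>v\<in>{v. length v = n}. path_weight w v + (\<Sum>j\<in>UNIV. path_weight w (v @ [j])))"
    by (rule sum.cong) (auto simp: Suc intro!: rev_measure_eq[OF w])
  also have "\<dots> = chaos w n + chaos w (Suc n)"
    by (simp only: sum.distrib chaos_def sum_level_Suc_snoc[of _ n])
  finally show ?thesis using Suc by simp
qed (simp add: rev_measure_def)

lemma rev_measure_total:
  assumes w: "env_ok w"
  shows "(\<integral>\<^sup>+v. ennreal (rev_measure w v) \<partial>count_space UNIV) =
    (\<Sum>n. ennreal (if n = 0 then 1 else chaos w n + chaos w (Suc n)))"
  unfolding nn_integral_levels sum_rev_measure_level[OF w, symmetric]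
  using rev_measure_pos[OF w] by (simp add: less_imp_le)

lemma rev_measure_finite:
  assumes w: "env_ok w" and s: "summable (chaos w)"
  shows "(\<integral>\<^sup>+v. ennreal (rev_measure w v) \<partial>count_space UNIV) < \<infinity>"
proof -
  have "summable (\<lambda>n. chaos w n + chaos w (Suc n))"
    using s by (intro summable_add) (simp_all add: summable_Suc_iff)
  then have "summable (\<lambda>n. if n = 0 then 1 else chaos w n + chaos w (Suc n))"
    by (rule summable_comparison_test'[where N = 1]) (auto simp: chaos_pos[OF w] less_imp_le add_nonneg_nonneg)
  then show ?thesis
    unfolding rev_measure_total[OF w]
    by (subst suminf_ennreal2) (auto simp: chaos_pos[OF w] less_imp_le add_nonneg_nonneg)
qed

lemma rev_measure_infinite:
  assumes w: "env_ok w" and s: "\<not> summable (chaos w)"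
  shows "(\<integral>\<^sup>+v. ennreal (rev_measure w v) \<partial>count_space UNIV) = \<infinity>"
proof (rule ccontr)
  let ?g = "\<lambda>n. if n = 0 then 1 else chaos w n + chaos w (Suc n)"
  assume "\<not> ?thesis"
  then have "summable ?g"
    unfolding rev_measure_total[OF w]
    by (intro summable_suminf_not_top) (auto simp: chaos_pos[OF w] less_imp_le add_nonneg_nonneg)
  moreover have "norm (chaos w n) \<le> ?g n" for n
    using chaos_pos[OF w, of n] chaos_pos[OF w, of "Suc n"] by (auto simp: chaos_def)
  ultimately show False using s summable_comparison_test' by blast
qed

section \<open>Escape probabilities and cutsets\<close>

text \<open>In a tree of ratios \<open>t\<close>, the number \<open>t u j\<close> compares the
  weight towards the child \<open>j\<close> with the weight towards the parent. The base of such a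
  tree has a parent as well, so these trees describe what lies above a vertex other than the
  root.\<close>

definition subtree :: "'d \<Rightarrow> ('d list \<Rightarrow> 'd \<Rightarrow> real) \<Rightarrow> 'd list \<Rightarrow> 'd \<Rightarrow> real" where
  "subtree j t = (\<lambda>u. t (j # u))"

primrec mass :: "nat \<Rightarrow> ('d::finite list \<Rightarrow> 'd \<Rightarrow> real) \<Rightarrow> real" where
  "mass 0 t = 1"
| "mass (Suc n) t = (\<Sum>j\<in>UNIV. t [] j * mass n (subtree j t))"

text \<open>The probability that the walk on the subtree above a vertex \<open>v\<close> with ratios \<open>t\<close>,
  started at \<open>v\<close>, climbs \<open>n\<close> levels before it visits the parent of \<open>v\<close>.\<close>

primrec escape :: "nat \<Rightarrow> ('d::finite list \<Rightarrow> 'd \<Rightarrow> real) \<Rightarrow> real" where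
  "escape 0 t = 1"
| "escape (Suc n) t =
    (let S = \<Sum>j\<in>UNIV. t [] j * escape n (subtree j t) in S / (1 + S))"

definition tree_pos :: "('d list \<Rightarrow> 'd \<Rightarrow> real) \<Rightarrow> bool" where
  "tree_pos t \<longleftrightarrow> (\<forall>u j. t u j > 0)"

lemma tree_pos_subtree: "tree_pos t \<Longrightarrow> tree_pos (subtree j t)"
  by (simp add: tree_pos_def subtree_def)

lemma frac_mono: "0 \<le> (x::real) \<Longrightarrow> x \<le> y \<Longrightarrow> x / (1 + x) \<le> y / (1 + y)"
  by (simp add: field_simps)

lemma escape_bounds:
  "tree_pos t \<Longrightarrow> 0 < escape n t \<and> escape n t \<le> 1"
proof (induction n arbitrary: t)
  case (Suc n)
  define S where "S = (\<Sum>j\<in>UNIV. t [] j * escape n (subtree j t))"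
  have "S > 0"
    unfolding S_def using Suc tree_pos_subtree[OF Suc.prems]
    by (intro sum_pos) (auto simp: tree_pos_def)
  then show ?case by (simp add: Let_def S_def[symmetric])
qed simp

lemma escape_decreasing: "tree_pos t \<Longrightarrow> escape (Suc n) t \<le> escape n t"
proof (induction n arbitrary: t)
  case 0
  then show ?case using escape_bounds[OF 0, of "Suc 0"] by simp
next
  case (Suc n)
  note b = escape_bounds[OF tree_pos_subtree[OF Suc.prems]]
  have "(\<Sum>j\<in>UNIV. t [] j * escape (Suc n) (subtree j t)) \<le> (\<Sum>j\<in>UNIV. t [] j * escape n (subtree j t))"
    using Suc.IH[OF tree_pos_subtree[OF Suc.prems]] Suc.prems
    by (intro sum_mono mult_left_mono) (auto simp: tree_pos_def less_imp_le)
  moreover have "0 \<le> (\<Sum>j\<in>UNIV. t [] j * escape (Suc n) (subtree j t))"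
    using Suc.prems b by (intro sum_nonneg mult_nonneg_nonneg)
      (auto simp: tree_pos_def less_imp_le simp del: escape.simps)
  ultimately show ?case
    unfolding escape.simps(2)[of "Suc n" t] escape.simps(2)[of n t] Let_def by (intro frac_mono)
qed

text \<open>For positive ratios the sequence decreases, and its limit is the probability of never
  visiting the parent.\<close>

definition escape_inf :: "('d::finite list \<Rightarrow> 'd \<Rightarrow> real) \<Rightarrow> real" where
  "escape_inf t = lim (\<lambda>n. escape n t)"

lemma escape_tendsto:
  assumes t: "tree_pos t"
  shows "(\<lambda>n. escape n t) \<longlonglongrightarrow> escape_inf t"
proof -
  have "decseq (\<lambda>n. escape n t)"
    using escape_decreasing[OF t] by (intro decseq_SucI) auto
  moreover have "0 \<le> escape n t" for n using escape_bounds[OF t, of n] by simp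
  ultimately have "convergent (\<lambda>n. escape n t)"
    by (metis convergentI decseq_convergent)
  then show ?thesis by (simp add: escape_inf_def convergent_LIMSEQ_iff)
qed

lemma escape_inf_bounds:
  assumes t: "tree_pos t"
  shows "0 \<le> escape_inf t" "escape_inf t \<le> 1"
proof -
  show "0 \<le> escape_inf t"
    by (rule LIMSEQ_le_const[OF escape_tendsto[OF t]])
      (use escape_bounds[OF t] less_imp_le in blast)
  show "escape_inf t \<le> 1"
    by (rule LIMSEQ_le_const2[OF escape_tendsto[OF t]]) (use escape_bounds[OF t] in blast)
qed

lemma escape_inf_eq:
  assumes t: "tree_pos t"
  defines "S \<equiv> \<Sum>j\<in>UNIV. t [] j * escape_inf (subtree j t)"
  shows "escape_inf t = S / (1 + S)" "S \<ge> 0"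
proof -
  show S: "S \<ge> 0"
    unfolding S_def using t escape_inf_bounds(1)[OF tree_pos_subtree[OF t]]
    by (intro sum_nonneg mult_nonneg_nonneg) (auto simp: tree_pos_def less_imp_le)
  have "(\<lambda>n. escape (Suc n) t) \<longlonglongrightarrow> S / (1 + S)"
    unfolding escape.simps Let_def S_def
    by (intro tendsto_intros escape_tendsto tree_pos_subtree t) (use S in \<open>auto simp: S_def\<close>)
  then show "escape_inf t = S / (1 + S)"
    using LIMSEQ_Suc[OF escape_tendsto[OF t]] LIMSEQ_unique by blast
qed

text \<open>With positive ratios the sum in the recursion vanishes only term by term. This is the
  inheritance required by the zero-one law.\<close>

lemma escape_inf_eq_0_iff:
  assumes t: "tree_pos t"
  shows "escape_inf t = 0 \<longleftrightarrow> (\<forall>j. escape_inf (subtree j t) = 0)"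
proof -
  define S where "S = (\<Sum>j\<in>UNIV. t [] j * escape_inf (subtree j t))"
  have "S \<ge> 0" "escape_inf t = S / (1 + S)"
    using escape_inf_eq[OF t] by (simp_all add: S_def)
  then have "escape_inf t = 0 \<longleftrightarrow> S = 0" by auto
  also have "\<dots> \<longleftrightarrow> (\<forall>j. escape_inf (subtree j t) = 0)"
  proof -
    have "S = 0 \<longleftrightarrow> (\<forall>j\<in>UNIV. t [] j * escape_inf (subtree j t) = 0)"
      unfolding S_def using t escape_inf_bounds(1)[OF tree_pos_subtree[OF t]]
      by (intro sum_nonneg_eq_0_iff) (auto simp: tree_pos_def less_imp_le)
    then show ?thesis using t by (auto simp: tree_pos_def) (metis less_irrefl)
  qed
  finally show ?thesis .
qed

section \<open>Escape probabilities and the current in a given environment\<close>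

definition ratio_tree :: "('d list \<Rightarrow> 'd option \<Rightarrow> real) \<Rightarrow> 'd list \<Rightarrow> 'd list \<Rightarrow> 'd \<Rightarrow> real" where
  "ratio_tree w v = (\<lambda>u k. w (v @ u) (Some k) / w (v @ u) None)"

lemma subtree_ratio_tree [simp]: "subtree j (ratio_tree w v) = ratio_tree w (v @ [j])"
  by (simp add: subtree_def ratio_tree_def)

lemma ratio_tree_root: "ratio_tree w v [] j = w v (Some j) / w v None"
  by (simp add: ratio_tree_def)

lemma tree_pos_ratio_tree: "env_ok w \<Longrightarrow> v \<noteq> [] \<Longrightarrow> tree_pos (ratio_tree w v)"
  by (auto simp: tree_pos_def ratio_tree_def env_ok_Some env_ok_None)

lemma sum_path_weight_above:
  assumes v: "v \<noteq> []"
  shows "(\<Sum>u\<in>{u. length u = n}. path_weight w (v @ u)) = path_weight w v * mass n (ratio_tree w v)"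
  using v
proof (induction n arbitrary: v)
  case (Suc n)
  have "(\<Sum>u\<in>{u. length u = Suc n}. path_weight w (v @ u)) =
      (\<Sum>j\<in>UNIV. \<Sum>u\<in>{u. length u = n}. path_weight w ((v @ [j]) @ u))"
    unfolding sum_level_Suc_Cons by simp
  also have "\<dots> = (\<Sum>j\<in>UNIV. path_weight w (v @ [j]) * mass n (ratio_tree w (v @ [j])))"
    by (intro sum.cong refl Suc.IH) simp
  also have "\<dots> = path_weight w v * mass (Suc n) (ratio_tree w v)"
    using Suc.prems
    by (simp add: sum_distrib_left path_weight_snoc edge_weight_snoc ratio_tree_root mult.assoc)
  finally show ?case .
qed simp

lemma chaos_Suc_eq: "chaos w (Suc n) = (\<Sum>j\<in>UNIV. w [] (Some j) * mass n (ratio_tree w [j]))"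
proof -
  have "chaos w (Suc n) = (\<Sum>j\<in>UNIV. \<Sum>u\<in>{u. length u = n}. path_weight w ([j] @ u))"
    unfolding chaos_def sum_level_Suc_Cons by simp
  also have "\<dots> = (\<Sum>j\<in>UNIV. path_weight w [j] * mass n (ratio_tree w [j]))"
    by (intro sum.cong refl sum_path_weight_above) simp
  also have "\<dots> = (\<Sum>j\<in>UNIV. w [] (Some j) * mass n (ratio_tree w [j]))"
    using path_weight_snoc[of w "[]"] edge_weight_snoc[of w "[]"] by simp
  finally show ?thesis .
qed

definition esc :: "('d::finite list \<Rightarrow> 'd option \<Rightarrow> real) \<Rightarrow> 'd list \<Rightarrow> real" where
  "esc w v = escape_inf (ratio_tree w v)"

lemma esc_bounds: "env_ok w \<Longrightarrow> v \<noteq> [] \<Longrightarrow> 0 \<le> esc w v \<and> esc w v \<le> 1"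
  unfolding esc_def by (simp add: escape_inf_bounds tree_pos_ratio_tree)

text \<open>The recursion cleared of denominators. Apart from excursions to a child and back, the
  walk at \<open>v\<close> either moves to the parent or escapes through a child, in proportion to
  the two summands in the bracket.\<close>

lemma esc_eq:
  assumes w: "env_ok w" and v: "v \<noteq> []"
  shows "esc w v * (w v None + (\<Sum>j\<in>UNIV. w v (Some j) * esc w (v @ [j]))) =
    (\<Sum>j\<in>UNIV. w v (Some j) * esc w (v @ [j]))"
proof -
  define T where "T = (\<Sum>j\<in>UNIV. w v (Some j) * esc w (v @ [j]))"
  define S where "S = (\<Sum>j\<in>UNIV. ratio_tree w v [] j * escape_inf (subtree j (ratio_tree w v)))"
  have S: "S = T / w v None"
    unfolding S_def T_def by (simp add: ratio_tree_root esc_def sum_divide_distrib)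
  have "esc w v = S / (1 + S)" "S \<ge> 0"
    using escape_inf_eq[OF tree_pos_ratio_tree[OF w v]] by (simp_all add: S_def esc_def)
  then have "esc w v * (1 + S) = S" by simp
  then show ?thesis
    unfolding T_def[symmetric] S using env_ok_None[OF w v] by (simp add: field_simps)
qed

text \<open>On a tree the walk reaches the root only through all intermediate vertices, so the
  probability of doing so is the product of the probabilities of ever visiting the respective
  parent.\<close>

definition hit_root :: "('d::finite list \<Rightarrow> 'd option \<Rightarrow> real) \<Rightarrow> 'd list \<Rightarrow> real" where
  "hit_root w v = (\<Prod>k=1..length v. 1 - esc w (take k v))"

lemma hit_root_Nil [simp]: "hit_root w [] = 1"
  by (simp add: hit_root_def)

lemma hit_root_snoc: "hit_root w (v @ [j]) = hit_root w v * (1 - esc w (v @ [j]))"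
proof -
  have "(\<Prod>k=1..length v. 1 - esc w (take k (v @ [j]))) = hit_root w v"
    unfolding hit_root_def by (rule prod.cong) auto
  then show ?thesis by (simp add: hit_root_def)
qed

lemma hit_root_bounds: "env_ok w \<Longrightarrow> 0 \<le> hit_root w v \<and> hit_root w v \<le> 1"
proof (induction v rule: rev_induct)
  case (snoc j v)
  then show ?case
    using esc_bounds[OF snoc.prems, of "v @ [j]"] by (simp add: hit_root_snoc mult_le_one)
qed simp

lemma hit_root_harmonic:
  assumes w: "env_ok w" and v: "v \<noteq> []"
  shows "w v None * hit_root w (butlast v) + (\<Sum>j\<in>UNIV. w v (Some j) * hit_root w (v @ [j])) = hit_root w v"
proof -
  define T where "T = (\<Sum>j\<in>UNIV. w v (Some j) * esc w (v @ [j]))"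
  have Hv: "hit_root w v = hit_root w (butlast v) * (1 - esc w v)"
    using hit_root_snoc[of w "butlast v" "last v"] v by simp
  have "(\<Sum>j\<in>UNIV. w v (Some j) * hit_root w (v @ [j])) =
      hit_root w v * ((\<Sum>j\<in>UNIV. w v (Some j)) - T)"
    unfolding T_def hit_root_snoc sum_subtractf[symmetric] sum_distrib_left
    by (intro sum.cong) (auto simp: algebra_simps)
  also have "(\<Sum>j\<in>UNIV. w v (Some j)) = 1 - w v None"
    using env_ok_sum[OF w v] by simp
  finally have "w v None * hit_root w (butlast v) + (\<Sum>j\<in>UNIV. w v (Some j) * hit_root w (v @ [j])) =
      hit_root w v + hit_root w (butlast v) * (w v None - (1 - esc w v) * (w v None + T))"
    unfolding Hv by (simp add: algebra_simps)
  also have "(1 - esc w v) * (w v None + T) = w v None"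
    using esc_eq[OF w v] by (simp add: T_def algebra_simps)
  finally show ?thesis by simp
qed

text \<open>\<open>hit_root\<close> is harmonic off the root and equals 1 there, so its mean over
  the first step bounds the return probability; one child with positive escape probability brings
  this mean below 1.\<close>

lemma root_transient:
  assumes w: "env_ok w" and pos: "esc w [i] > 0"
  shows "hit_ever (tree_kernel w) [] [] < 1"
proof -
  have "hit_ever (tree_kernel w) [] [] \<le> (\<integral>\<^sup>+z. ennreal (hit_root w z) \<partial>measure_pmf (tree_kernel w []))"
  proof (rule hit_ever_le_superharmonic)
    fix v :: "'a list" assume v: "v \<noteq> []"
    have "(\<integral>\<^sup>+z. ennreal (hit_root w z) \<partial>measure_pmf (tree_kernel w v)) =
        ennreal (w v None * hit_root w (butlast v) + (\<Sum>j\<in>UNIV. w v (Some j) * hit_root w (v @ [j])))"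
      unfolding nn_integral_tree_kernel[OF w] using v hit_root_bounds[OF w]
      by (simp add: ennreal_mult[symmetric] env_ok_None[OF w] env_ok_Some[OF w] less_imp_le
          sum_nonneg ennreal_plus[symmetric] del: ennreal_plus)
    then show "(\<integral>\<^sup>+z. ennreal (hit_root w z) \<partial>measure_pmf (tree_kernel w v)) \<le> ennreal (hit_root w v)"
      using hit_root_harmonic[OF w v] by simp
  qed simp
  also have "\<dots> = ennreal (\<Sum>j\<in>UNIV. w [] (Some j) * (1 - esc w [j]))"
    unfolding nn_integral_tree_kernel[OF w] using esc_bounds[OF w] hit_root_snoc[of w "[]"]
    by (simp add: ennreal_mult[symmetric] env_ok_Some[OF w] less_imp_le)
  finally have le: "hit_ever (tree_kernel w) [] [] \<le> ennreal (\<Sum>j\<in>UNIV. w [] (Some j) * (1 - esc w [j]))" .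
  have "(\<Sum>j\<in>UNIV. w [] (Some j) * (1 - esc w [j])) < (\<Sum>j\<in>UNIV. w [] (Some j))"
  proof (rule sum_strict_mono_ex1)
    show "\<forall>j\<in>UNIV. w [] (Some j) * (1 - esc w [j]) \<le> w [] (Some j)"
      using esc_bounds[OF w] env_ok_Some[OF w, of "[]"] by (simp add: mult_left_le less_imp_le)
    show "\<exists>j\<in>UNIV. w [] (Some j) * (1 - esc w [j]) < w [] (Some j)"
      using pos env_ok_Some[OF w, of "[]" i] by (intro bexI[of _ i]) (auto simp: algebra_simps)
  qed simp
  then have "ennreal (\<Sum>j\<in>UNIV. w [] (Some j) * (1 - esc w [j])) < 1"
    using env_ok_root[OF w] by simp
  with le show ?thesis by (rule le_less_trans)
qed

text \<open>The unit-potential current: by Cauchy--Schwarz on each level its energy is at least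
  \<open>\<gamma>\<^sup>2 / chaos w n\<close> on level \<open>n\<close>, and the total energy is at most \<open>\<gamma>\<close>.\<close>

definition flow :: "('d::finite list \<Rightarrow> 'd option \<Rightarrow> real) \<Rightarrow> 'd list \<Rightarrow> real" where
  "flow w v = path_weight w v * hit_root w (butlast v) * esc w v"

text \<open>Kirchhoff's law: \<open>flow w v\<close> is the conductance of the edge below
  \<open>v\<close> times the drop of the potential \<open>hit_root\<close> across it, and the
  potential is harmonic at \<open>v\<close>.\<close>

lemma flow_conserved:
  assumes w: "env_ok w" and v: "v \<noteq> []"
  shows "(\<Sum>j\<in>UNIV. flow w (v @ [j])) = flow w v"
proof -
  define T where "T = (\<Sum>j\<in>UNIV. w v (Some j) * esc w (v @ [j]))"
  have Hv: "hit_root w v = hit_root w (butlast v) * (1 - esc w v)"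
    using hit_root_snoc[of w "butlast v" "last v"] v by simp
  have "(\<Sum>j\<in>UNIV. flow w (v @ [j])) = path_weight w v * hit_root w v * (T / w v None)"
    unfolding flow_def T_def sum_divide_distrib sum_distrib_left
    by (intro sum.cong) (auto simp: path_weight_snoc edge_weight_snoc v)
  also have "\<dots> = path_weight w v * hit_root w (butlast v) * (((1 - esc w v) * T) / w v None)"
    unfolding Hv by simp
  also have "(1 - esc w v) * T = esc w v * w v None"
    using esc_eq[OF w v] by (simp add: T_def algebra_simps)
  finally show ?thesis using env_ok_None[OF w v] by (simp add: flow_def)
qed

lemma nash_williams:
  assumes w: "env_ok w"
  defines "\<gamma> \<equiv> \<Sum>j\<in>UNIV. w [] (Some j) * esc w [j]"
  shows "(\<Sum>k=1..n. \<gamma>\<^sup>2 / chaos w k) \<le> \<gamma>"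
proof -
  let ?L = "\<lambda>n. {v :: 'a list. length v = n}"
  have level: "(\<Sum>v\<in>?L (Suc n). flow w v) = \<gamma>" for n
  proof (induction n)
    case 0
    have "(\<Sum>v\<in>?L (Suc 0). flow w v) = (\<Sum>j\<in>UNIV. flow w [j])"
      unfolding sum_level_Suc_snoc[of _ 0] by simp
    then show ?case
      using path_weight_snoc[of w "[]"] edge_weight_snoc[of w "[]"] by (simp add: flow_def \<gamma>_def)
  next
    case (Suc n)
    have "(\<Sum>v\<in>?L (Suc (Suc n)). flow w v) = (\<Sum>v\<in>?L (Suc n). \<Sum>j\<in>UNIV. flow w (v @ [j]))"
      by (rule sum_level_Suc_snoc)
    also have "\<dots> = (\<Sum>v\<in>?L (Suc n). flow w v)"
      by (intro sum.cong refl flow_conserved[OF w]) auto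
    finally show ?case using Suc by simp
  qed
  have fnn: "flow w v \<ge> 0" if "v \<noteq> []" for v
    unfolding flow_def using that esc_bounds[OF w that] hit_root_bounds[OF w] path_weight_pos[OF w]
    by (intro mult_nonneg_nonneg) (auto simp: less_imp_le)
  \<comment> \<open>What is left of the energy bound after level \<open>n + 1\<close>. Conservation
    rewrites the sum of flow times the parent's potential on the next level as \<open>E n\<close>,
    so the levels telescope.\<close>
  define E where "E n = (\<Sum>v\<in>?L (Suc n). flow w v * hit_root w v)" for n
  have E_nonneg: "E n \<ge> 0" for n
    unfolding E_def using hit_root_bounds[OF w] by (intro sum_nonneg mult_nonneg_nonneg fnn) auto
  have cs: "\<gamma>\<^sup>2 / chaos w (Suc n) \<le>
      (\<Sum>v\<in>?L (Suc n). flow w v * (hit_root w (butlast v) - hit_root w v))" for n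
  proof -
    \<comment> \<open>Cauchy--Schwarz is applied to the square root of the conductance and the flow
      divided by it; the squares add up to \<open>chaos\<close> and to the energy of the
      level.\<close>
    define x where "x v = sqrt (path_weight w v)" for v
    have x: "x v > 0" "x v * x v = path_weight w v" for v
      using path_weight_pos[OF w, of v] by (auto simp: x_def)
    have sq: "flow w v / x v * (flow w v / x v) =
        flow w v * (hit_root w (butlast v) - hit_root w v)" if "v \<in> ?L (Suc n)" for v
    proof -
      have "v \<noteq> []" using that by auto
      then have eq: "hit_root w v = hit_root w (butlast v) * (1 - esc w v)"
        using hit_root_snoc[of w "butlast v" "last v"] by simp
      have "flow w v = x v * x v * (hit_root w (butlast v) - hit_root w v)"
        unfolding flow_def x(2) by (simp only: eq) (simp add: algebra_simps)
      then have "flow w v / (x v * x v) = hit_root w (butlast v) - hit_root w v"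
        using x(1)[of v] by simp
      moreover have "flow w v / x v * (flow w v / x v) = flow w v * (flow w v / (x v * x v))"
        by simp
      ultimately show ?thesis by simp
    qed
    have "\<gamma> = (\<Sum>v\<in>?L (Suc n). x v * (flow w v / x v))"
      unfolding level[of n, symmetric] using x(1) by (intro sum.cong) (auto simp: less_imp_neq[symmetric])
    then have "\<gamma>\<^sup>2 \<le> (\<Sum>v\<in>?L (Suc n). (x v)\<^sup>2) * (\<Sum>v\<in>?L (Suc n). (flow w v / x v)\<^sup>2)"
      using Cauchy_Schwarz_ineq_sum[of x "\<lambda>v. flow w v / x v" "?L (Suc n)"] by simp
    also have "(\<Sum>v\<in>?L (Suc n). (x v)\<^sup>2) = chaos w (Suc n)"
      by (simp add: chaos_def power2_eq_square x)
    also have "(\<Sum>v\<in>?L (Suc n). (flow w v / x v)\<^sup>2) =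
        (\<Sum>v\<in>?L (Suc n). flow w v * (hit_root w (butlast v) - hit_root w v))"
      by (intro sum.cong refl) (simp only: power2_eq_square sq)
    finally show ?thesis
      using chaos_pos[OF w, of "Suc n"] by (simp add: pos_divide_le_eq mult.commute)
  qed
  have e0: "(\<Sum>v\<in>?L (Suc 0). flow w v * hit_root w (butlast v)) = \<gamma>"
    unfolding level[of 0, symmetric] by (intro sum.cong) (auto simp: length_Suc_conv)
  have eS: "(\<Sum>v\<in>?L (Suc (Suc n)). flow w v * hit_root w (butlast v)) = E n" for n
  proof -
    have "(\<Sum>v\<in>?L (Suc (Suc n)). flow w v * hit_root w (butlast v)) =
        (\<Sum>v\<in>?L (Suc n). (\<Sum>j\<in>UNIV. flow w (v @ [j])) * hit_root w v)"
      unfolding sum_level_Suc_snoc[of _ "Suc n"] sum_distrib_right by simp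
    also have "\<dots> = E n"
      unfolding E_def by (intro sum.cong refl arg_cong2[of _ _ _ _ "(*)"] flow_conserved[OF w]) auto
    finally show ?thesis .
  qed
  have main: "(\<Sum>k=1..Suc m. \<gamma>\<^sup>2 / chaos w k) \<le> \<gamma> - E m" for m
  proof (induction m)
    case 0
    have "\<gamma>\<^sup>2 / chaos w (Suc 0) \<le> \<gamma> - E 0"
      using cs[of 0] e0 by (simp add: right_diff_distrib sum_subtractf E_def)
    then show ?case by simp
  next
    case (Suc m)
    have "\<gamma>\<^sup>2 / chaos w (Suc (Suc m)) \<le> E m - E (Suc m)"
      using cs[of "Suc m"] eS[of m] by (simp add: right_diff_distrib sum_subtractf E_def)
    then show ?case using Suc by simp
  qed
  have "\<gamma> \<ge> 0"
    unfolding \<gamma>_def using esc_bounds[OF w] env_ok_Some[OF w]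
    by (intro sum_nonneg mult_nonneg_nonneg) (auto simp: less_imp_le)
  then show ?thesis
  proof (cases n)
    case (Suc m)
    show ?thesis unfolding Suc using main[of m] E_nonneg[of m] by linarith
  qed simp
qed

lemma chaos_to_infinity:
  assumes w: "env_ok w" and pos: "esc w [i] > 0"
  shows "filterlim (chaos w) at_top sequentially"
proof -
  define \<gamma> where "\<gamma> = (\<Sum>j\<in>UNIV. w [] (Some j) * esc w [j])"
  have "\<gamma> > 0"
    unfolding \<gamma>_def using pos esc_bounds[OF w] env_ok_Some[OF w]
    by (intro sum_pos2[of _ i]) (auto simp: less_imp_le)
  have nn: "0 \<le> \<gamma>\<^sup>2 / chaos w k" for k
    using chaos_pos[OF w, of k] by simp
  have "summable (\<lambda>k. \<gamma>\<^sup>2 / chaos w (Suc k))"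
  proof (rule bounded_imp_summable[of _ \<gamma>])
    fix n
    have "(\<Sum>k\<le>n. \<gamma>\<^sup>2 / chaos w (Suc k)) = (\<Sum>k=1..Suc n. \<gamma>\<^sup>2 / chaos w k)"
      by (rule sum.reindex_bij_witness[of _ "\<lambda>k. k - 1" Suc]) auto
    then show "(\<Sum>k\<le>n. \<gamma>\<^sup>2 / chaos w (Suc k)) \<le> \<gamma>"
      using nash_williams[OF w, of "Suc n"] by (simp add: \<gamma>_def)
  qed (rule nn)
  then have "(\<lambda>k. \<gamma>\<^sup>2 / chaos w k) \<longlonglongrightarrow> 0"
    using summable_LIMSEQ_zero filterlim_sequentially_Suc[of "\<lambda>k. \<gamma>\<^sup>2 / chaos w k"] by blast
  then have "(\<lambda>k. inverse (\<gamma>\<^sup>2) * (\<gamma>\<^sup>2 / chaos w k)) \<longlonglongrightarrow> 0"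
    using tendsto_mult_right_zero by blast
  moreover have "inverse (\<gamma>\<^sup>2) * (\<gamma>\<^sup>2 / chaos w k) = inverse (chaos w k)" for k
    using \<open>\<gamma> > 0\<close> by (simp add: divide_inverse)
  ultimately have "(\<lambda>k. inverse (chaos w k)) \<longlonglongrightarrow> 0"
    by simp
  then have "filterlim (\<lambda>k. inverse (inverse (chaos w k))) at_top sequentially"
    by (rule filterlim_inverse_at_top) (simp add: chaos_pos[OF w])
  then show ?thesis by simp
qed

lemma esc_eq_0_if_chaos_bounded:
  assumes w: "env_ok w" and b: "Bseq (chaos w)"
  shows "esc w [i] = 0"
proof (rule ccontr)
  assume "esc w [i] \<noteq> 0"
  then have "esc w [i] > 0" using esc_bounds[OF w, of "[i]"] by simp
  then have lim: "filterlim (chaos w) at_top sequentially" by (rule chaos_to_infinity[OF w])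
  obtain K where K: "\<And>n. norm (chaos w n) \<le> K" using b by (auto simp: Bseq_def)
  have "eventually (\<lambda>n. chaos w n > K) sequentially"
    using lim by (rule filterlim_at_top_dense[THEN iffD1, rule_format])
  then obtain n where "chaos w n > K" by (auto simp: eventually_sequentially)
  then show False using K[of n] by simp
qed

text \<open>The relative drop \<open>b v = 1 - H v / H (butlast v)\<close> of the true hitting
  probability satisfies the recursion of \<open>escape\<close> and is at most 1. Monotone iteration
  puts it below every \<open>escape n\<close>, so vanishing escape probabilities on the first level
  force the hitting probability 1 there.\<close>

lemma root_recurrent:
  assumes w: "env_ok w" and zero: "\<And>j. esc w [j] = 0"
  shows "hit_ever (tree_kernel w) [] [] = 1"
proof -
  define h where "h v = (if v = [] then 1 else hit_ever (tree_kernel w) [] v)" for v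
  have h1: "h v \<le> 1" for v by (simp add: h_def hit_ever_le_1)
  define H where "H v = enn2real (h v)" for v
  have hH: "h v = ennreal (H v)" for v
    unfolding H_def using le_less_trans[OF h1 ennreal_one_less_top, of v] by simp
  have H: "0 \<le> H v" "H v \<le> 1" for v
    using h1[of v] unfolding hH by (auto simp: H_def)
  have H0: "H [] = 1" by (simp add: H_def h_def)
  have step: "hit_ever (tree_kernel w) [] v = (\<integral>\<^sup>+z. h z \<partial>measure_pmf (tree_kernel w v))" for v
    using hit_ever_step[of "tree_kernel w" "[]" v] by (simp add: h_def cong: if_cong)
  have harm: "H v = w v None * H (butlast v) + (\<Sum>j\<in>UNIV. w v (Some j) * H (v @ [j]))"
    if v: "v \<noteq> []" for v
  proof -
    have "ennreal (H v) = (\<integral>\<^sup>+z. h z \<partial>measure_pmf (tree_kernel w v))"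
      using step[of v] v by (simp add: hH[symmetric] h_def cong: if_cong)
    also have "\<dots> = ennreal (w v None * H (butlast v) + (\<Sum>j\<in>UNIV. w v (Some j) * H (v @ [j])))"
      unfolding nn_integral_tree_kernel[OF w] hH using v H
      by (simp add: ennreal_mult[symmetric] env_ok_None[OF w] env_ok_Some[OF w] less_imp_le
          sum_nonneg ennreal_plus[symmetric] del: ennreal_plus)
    finally show ?thesis
      using v H by (subst (asm) ennreal_inj)
        (auto intro!: add_nonneg_nonneg sum_nonneg mult_nonneg_nonneg simp: env_ok_None[OF w] env_ok_Some[OF w] less_imp_le)
  qed
  \<comment> \<open>The walk can go straight down to the root with positive probability, so the
    quotients below make sense.\<close>
  have Hpos: "H v > 0" for v
  proof (induction v rule: rev_induct)
    case (snoc j v)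
    have "0 < w (v @ [j]) None * H v"
      using snoc env_ok_None[OF w, of "v @ [j]"] by simp
    also have "\<dots> \<le> H (v @ [j])"
      using harm[of "v @ [j]"] H env_ok_Some[OF w] by (simp add: sum_nonneg less_imp_le)
    finally show ?case .
  qed (simp add: H0)
  define b where "b v = 1 - H v / H (butlast v)" for v
  have key: "b v \<le> escape n (ratio_tree w v)" if "v \<noteq> []" for n v
    using that
  proof (induction n arbitrary: v)
    case 0
    then show ?case using Hpos[of v] Hpos[of "butlast v"] by (simp add: b_def)
  next
    case (Suc n)
    define x where "x = H v / H (butlast v)"
    define T where "T = (\<Sum>j\<in>UNIV. ratio_tree w v [] j * b (v @ [j]))"
    define S where "S = (\<Sum>j\<in>UNIV. ratio_tree w v [] j * escape n (ratio_tree w (v @ [j])))"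
    have x: "x > 0" using Hpos by (simp add: x_def)
    have p0: "w v None > 0" using env_ok_None[OF w Suc.prems] .
    have rt: "ratio_tree w v [] j > 0" for j
      using tree_pos_ratio_tree[OF w Suc.prems] by (simp add: tree_pos_def)
    have "T \<le> S"
      unfolding T_def S_def using rt by (intro sum_mono mult_left_mono Suc.IH) (auto simp: less_imp_le)
    have Hc: "H (v @ [j]) = H v * (1 - b (v @ [j]))" for j
      using Hpos[of v] by (simp add: b_def)
    have wT: "w v None * T = (\<Sum>j\<in>UNIV. w v (Some j) * b (v @ [j]))"
      unfolding T_def sum_distrib_left using p0 by (intro sum.cong) (auto simp: ratio_tree_def)
    have "H v = w v None * H (butlast v) + (\<Sum>j\<in>UNIV. w v (Some j) * (H v * (1 - b (v @ [j]))))"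
      using harm[OF Suc.prems] by (simp add: Hc)
    also have "(\<Sum>j\<in>UNIV. w v (Some j) * (H v * (1 - b (v @ [j])))) =
        H v * ((\<Sum>j\<in>UNIV. w v (Some j)) - w v None * T)"
      unfolding wT sum_subtractf[symmetric] sum_distrib_left
      by (intro sum.cong) (auto simp: algebra_simps)
    also have "(\<Sum>j\<in>UNIV. w v (Some j)) = 1 - w v None"
      using env_ok_sum[OF w Suc.prems] by simp
    finally have "w v None * (H v * (1 + T)) = w v None * H (butlast v)"
      by (simp add: algebra_simps)
    \<comment> \<open>Harmonicity at \<open>v\<close>, divided by the weight of the parent.
      Positivity of \<open>1 + T\<close> comes from this identity, since the signs of the terms
      \<open>b\<close> are unknown.\<close>
    then have "H v * (1 + T) = H (butlast v)" using p0 by simp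
    then have xT: "x * (1 + T) = 1"
      using Hpos[of "butlast v"] by (simp add: x_def)
    then have T1: "1 + T > 0" using x by (metis zero_less_mult_pos zero_less_one)
    have "b v = 1 - 1 / (1 + T)"
      using xT T1 by (simp add: b_def x_def[symmetric] field_simps)
    also have "\<dots> \<le> 1 - 1 / (1 + S)"
      using T1 \<open>T \<le> S\<close> by (simp add: frac_le)
    also have "\<dots> = escape (Suc n) (ratio_tree w v)"
      using T1 \<open>T \<le> S\<close> by (simp add: Let_def S_def[symmetric] field_simps)
    finally show ?case .
  qed
  have "b [j] \<le> esc w [j]" for j
    unfolding esc_def using LIMSEQ_le_const[OF escape_tendsto[OF tree_pos_ratio_tree[OF w]]] key
    by blast
  then have "H [j] = 1" for j
    using zero H(2)[of "[j]"] by (simp add: b_def H0) (metis antisym)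
  then have "(\<integral>\<^sup>+z. h z \<partial>measure_pmf (tree_kernel w [])) = (\<Sum>j\<in>UNIV. ennreal (w [] (Some j)))"
    unfolding nn_integral_tree_kernel[OF w] hH by simp
  also have "\<dots> = 1"
    using env_ok_root[OF w] env_ok_Some[OF w] by (simp add: sum_ennreal less_imp_le)
  finally show ?thesis using step by simp
qed

section \<open>Trees with independent and identically distributed weights\<close>

text \<open>\<open>\<nu>\<close> is the law of the whole ratio vector of one vertex, so dependence
  inside a vector is kept; independence holds between vertices.\<close>

locale iid_tree = prob_space \<nu> for \<nu> :: "('d::finite \<Rightarrow> real) measure" +
  assumes sets_nu: "sets \<nu> = sets (PiM UNIV (\<lambda>_. borel))"
    and nu_pos: "AE x in \<nu>. \<forall>j. x j > 0"
begin

definition TP :: "('d list \<Rightarrow> 'd \<Rightarrow> real) measure" where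
  "TP = PiM UNIV (\<lambda>_. \<nu>)"

lemma space_nu [simp]: "space \<nu> = UNIV"
  using sets_eq_imp_space_eq[OF sets_nu] by (simp add: space_PiM)

lemma space_TP [simp]: "space TP = UNIV"
  by (simp add: TP_def space_PiM)

sublocale TP: prob_space TP
  unfolding TP_def by (rule prob_space_PiM) (rule prob_space_axioms)

lemma measurable_nu_component [measurable]: "(\<lambda>x. x j) \<in> borel_measurable \<nu>"
  by (subst measurable_cong_sets[OF sets_nu refl]) (rule measurable_component_singleton, simp)

lemma measurable_TP_vertex [measurable]: "(\<lambda>t. t u) \<in> measurable TP \<nu>"
  unfolding TP_def by (rule measurable_component_singleton) simp

lemma measurable_TP_component [measurable]: "(\<lambda>t. t u j) \<in> borel_measurable TP"
  by (rule measurable_compose[OF measurable_TP_vertex measurable_nu_component])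

lemma measurable_subtree [measurable]: "subtree j \<in> measurable TP TP"
proof -
  have "subtree j \<in> measurable TP (PiM UNIV (\<lambda>_. \<nu>))"
    by (rule measurable_PiM_single') (auto simp: subtree_def)
  then show ?thesis by (simp add: TP_def)
qed

lemma distr_subtree: "distr TP TP (subtree j) = TP"
proof -
  have "distr (PiM UNIV (\<lambda>_. \<nu>)) (PiM UNIV (\<lambda>i. \<nu>)) (\<lambda>\<omega>. \<lambda>n\<in>UNIV. \<omega> (j # n)) =
      PiM UNIV (\<lambda>i. \<nu>)"
    by (rule distr_PiM_reindex) (auto intro: prob_space_axioms inj_onI)
  then show ?thesis by (simp add: TP_def subtree_def[abs_def] restrict_UNIV)
qed

lemma nn_integral_subtree:
  "G \<in> borel_measurable TP \<Longrightarrow> (\<integral>\<^sup>+t. G (subtree j t) \<partial>TP) = (\<integral>\<^sup>+t. G t \<partial>TP)"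
  using nn_integral_distr[OF measurable_subtree, of G j] by (simp add: distr_subtree)

lemma distr_TP_vertex: "distr TP \<nu> (\<lambda>t. t u) = \<nu>"
  unfolding TP_def by (rule distr_PiM_component) (auto intro: prob_space_axioms)

lemma nn_integral_vertex:
  "F \<in> borel_measurable \<nu> \<Longrightarrow> (\<integral>\<^sup>+t. F (t u) \<partial>TP) = (\<integral>\<^sup>+x. F x \<partial>\<nu>)"
  using nn_integral_distr[OF measurable_TP_vertex, of F u] by (simp add: distr_TP_vertex)

lemma AE_tree_pos: "AE t in TP. tree_pos t"
proof -
  have "AE t in TP. \<forall>j. t u j > 0" for u
    unfolding TP_def
    by (rule AE_PiM_component[where P = "\<lambda>x. \<forall>j. x j > 0"]) (auto intro: prob_space_axioms nu_pos)
  then have "AE t in TP. \<forall>u j. t u j > 0"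
    by (simp add: AE_all_countable)
  then show ?thesis by (simp add: tree_pos_def)
qed

lemma nn_integral_mono_tree_pos:
  assumes "\<And>t. tree_pos t \<Longrightarrow> F t \<le> G t"
  shows "(\<integral>\<^sup>+t. F t \<partial>TP) \<le> (\<integral>\<^sup>+t. G t \<partial>TP)"
  using AE_tree_pos by (intro nn_integral_mono_AE) (auto elim!: eventually_mono intro: assms)

lemma nn_integral_cong_tree_pos:
  assumes "\<And>t. tree_pos t \<Longrightarrow> F t = G t"
  shows "(\<integral>\<^sup>+t. F t \<partial>TP) = (\<integral>\<^sup>+t. G t \<partial>TP)"
  using AE_tree_pos by (intro nn_integral_cong_AE) (auto elim!: eventually_mono intro: assms)

lemma indep_vertices: "TP.indep_vars (\<lambda>_. \<nu>) (\<lambda>u t. t u) UNIV"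
proof (subst TP.indep_vars_iff_distr_eq_PiM)
  have "distr TP TP (\<lambda>x. x) = TP" by (rule distr_id)
  then show "distr TP (PiM UNIV (\<lambda>_. \<nu>)) (\<lambda>x. \<lambda>i\<in>UNIV. x i) =
      PiM UNIV (\<lambda>i. distr TP \<nu> (\<lambda>t. t i))"
    unfolding distr_TP_vertex by (simp add: TP_def[symmetric] restrict_UNIV)
qed auto

text \<open>The root and the subtrees above its children occupy disjoint blocks of vertices.\<close>

lemma nn_integral_root_subtrees:
  assumes F [measurable]: "F \<in> borel_measurable \<nu>"
    and G [measurable]: "\<And>j. j \<in> J \<Longrightarrow> G j \<in> borel_measurable TP"
  shows "(\<integral>\<^sup>+t. F (t []) * (\<Prod>j\<in>J. G j (subtree j t)) \<partial>TP) =
    (\<integral>\<^sup>+x. F x \<partial>\<nu>) * (\<Prod>j\<in>J. \<integral>\<^sup>+t. G j t \<partial>TP)"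
proof -
  \<comment> \<open>\<open>None\<close> indexes the block of the root alone and
    \<open>Some j\<close> the vertices above the child \<open>j\<close>, so that one independent
    family carries both kinds of factor.\<close>
  define K :: "'d option \<Rightarrow> 'd list set" where
    "K l = (case l of None \<Rightarrow> {[]} | Some j \<Rightarrow> range ((#) j))" for l
  define I where "I = insert None (Some ` J)"
  define Y :: "'d option \<Rightarrow> ('d list \<Rightarrow> 'd \<Rightarrow> real) \<Rightarrow> ennreal" where
    "Y l r = (case l of None \<Rightarrow> F (r []) | Some j \<Rightarrow> G j (\<lambda>u. r (j # u)))" for l r
  have "TP.indep_vars (\<lambda>l. PiM (K l) (\<lambda>_. \<nu>)) (\<lambda>l t. restrict (\<lambda>u. t u) (K l)) I"
    by (rule TP.indep_vars_restrict[OF indep_vertices])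
      (auto simp: K_def disjoint_family_on_def split: option.splits)
  then have "TP.indep_vars (\<lambda>_. borel) (\<lambda>l t. Y l (restrict (\<lambda>u. t u) (K l))) I"
  proof (rule TP.indep_vars_compose2)
    fix l assume l: "l \<in> I"
    show "Y l \<in> borel_measurable (PiM (K l) (\<lambda>_. \<nu>))"
    proof (cases l)
      case None
      have "(\<lambda>r. r []) \<in> measurable (PiM (K l) (\<lambda>_. \<nu>)) \<nu>"
        by (rule measurable_component_singleton) (simp add: K_def None)
      then have "(\<lambda>r. F (r [])) \<in> borel_measurable (PiM (K l) (\<lambda>_. \<nu>))"
        by (rule measurable_compose) (rule F)
      then show ?thesis by (simp add: Y_def[abs_def] None)
    next
      case (Some j)
      have j: "j \<in> J" using l by (auto simp: I_def Some)
      have "(\<lambda>r u. r (j # u)) \<in> measurable (PiM (K l) (\<lambda>_. \<nu>)) (PiM UNIV (\<lambda>_. \<nu>))"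
      proof (rule measurable_PiM_single')
        show "(\<lambda>r. r (j # u)) \<in> measurable (PiM (K l) (\<lambda>_. \<nu>)) \<nu>" for u
          by (rule measurable_component_singleton) (simp add: K_def Some)
      qed auto
      then have "(\<lambda>r u. r (j # u)) \<in> measurable (PiM (K l) (\<lambda>_. \<nu>)) TP"
        by (simp add: TP_def)
      then have "(\<lambda>r. G j (\<lambda>u. r (j # u))) \<in> borel_measurable (PiM (K l) (\<lambda>_. \<nu>))"
        by (rule measurable_compose) (rule G[OF j])
      then show ?thesis by (simp add: Y_def[abs_def] Some)
    qed
  qed
  moreover have "Y l (restrict (\<lambda>u. t u) (K l)) =
      (case l of None \<Rightarrow> F (t []) | Some j \<Rightarrow> G j (subtree j t))" for l t
    by (auto simp: Y_def K_def subtree_def split: option.splits)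
  ultimately have ind: "TP.indep_vars (\<lambda>_. borel)
      (\<lambda>l t. case l of None \<Rightarrow> F (t []) | Some j \<Rightarrow> G j (subtree j t)) I"
    by simp
  have "(\<integral>\<^sup>+t. (\<Prod>l\<in>I. case l of None \<Rightarrow> F (t []) | Some j \<Rightarrow> G j (subtree j t)) \<partial>TP) =
      (\<Prod>l\<in>I. \<integral>\<^sup>+t. (case l of None \<Rightarrow> F (t []) | Some j \<Rightarrow> G j (subtree j t)) \<partial>TP)"
    by (rule TP.indep_vars_nn_integral[OF _ ind]) (auto simp: I_def)
  moreover have "(\<Prod>l\<in>I. case l of None \<Rightarrow> F (t []) | Some j \<Rightarrow> G j (subtree j t)) =
      F (t []) * (\<Prod>j\<in>J. G j (subtree j t))" for t
    unfolding I_def by (subst prod.insert) (auto simp: prod.reindex)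
  moreover have "(\<Prod>l\<in>I. \<integral>\<^sup>+t. (case l of None \<Rightarrow> F (t []) | Some j \<Rightarrow> G j (subtree j t)) \<partial>TP) =
      (\<integral>\<^sup>+t. F (t []) \<partial>TP) * (\<Prod>j\<in>J. \<integral>\<^sup>+t. G j (subtree j t) \<partial>TP)"
    unfolding I_def by (subst prod.insert) (auto simp: prod.reindex)
  ultimately show ?thesis
    by (simp add: nn_integral_vertex nn_integral_subtree G)
qed

lemma nn_integral_root_subtree:
  assumes "F \<in> borel_measurable \<nu>" "G \<in> borel_measurable TP"
  shows "(\<integral>\<^sup>+t. F (t []) * G (subtree j t) \<partial>TP) = (\<integral>\<^sup>+x. F x \<partial>\<nu>) * (\<integral>\<^sup>+t. G t \<partial>TP)"
  using nn_integral_root_subtrees[of F "{j}" "\<lambda>_. G"] assms by simp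

lemma nn_integral_root_subtree_pair:
  assumes "i \<noteq> j" "F \<in> borel_measurable \<nu>" "G \<in> borel_measurable TP"
  shows "(\<integral>\<^sup>+t. F (t []) * (G (subtree i t) * G (subtree j t)) \<partial>TP) =
    (\<integral>\<^sup>+x. F x \<partial>\<nu>) * (\<integral>\<^sup>+t. G t \<partial>TP)\<^sup>2"
  using nn_integral_root_subtrees[of F "{i, j}" "\<lambda>_. G"] assms by (simp add: power2_eq_square)

text \<open>A nonlinear function of a ratio times a subtree variable does not factor, so the full
  joint law of the root vector and one subtree is needed.\<close>

lemma nn_integral_root_subtree_joint:
  assumes \<Phi> [measurable]: "(\<lambda>(x, s). \<Phi> x s) \<in> borel_measurable (\<nu> \<Otimes>\<^sub>M TP)"
  shows "(\<integral>\<^sup>+t. \<Phi> (t []) (subtree j t) \<partial>TP) = (\<integral>\<^sup>+s. \<integral>\<^sup>+x. \<Phi> x s \<partial>\<nu> \<partial>TP)"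
proof -
  note S = sigma_finite_measure_axioms
  interpret pair_prob_space \<nu> TP ..
  have m: "(\<lambda>t. (t [], subtree j t)) \<in> measurable TP (\<nu> \<Otimes>\<^sub>M TP)" by measurable
  have eq: "\<nu> \<Otimes>\<^sub>M TP = distr TP (\<nu> \<Otimes>\<^sub>M TP) (\<lambda>t. (t [], subtree j t))"
  proof (rule pair_measure_eqI)
    fix A B assume AB: "A \<in> sets \<nu>" "B \<in> sets TP"
    have "emeasure (distr TP (\<nu> \<Otimes>\<^sub>M TP) (\<lambda>t. (t [], subtree j t))) (A \<times> B) =
        (\<integral>\<^sup>+t. indicator (A \<times> B) (t [], subtree j t) \<partial>TP)"
      using AB m by (subst nn_integral_distr[OF m, symmetric]) auto
    also have "\<dots> = (\<integral>\<^sup>+t. indicator A (t []) * indicator B (subtree j t) \<partial>TP)"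
      by (intro nn_integral_cong) (simp add: indicator_times)
    also have "\<dots> = emeasure \<nu> A * emeasure TP B"
      using AB by (subst nn_integral_root_subtree) auto
    finally show "emeasure \<nu> A * emeasure TP B =
        emeasure (distr TP (\<nu> \<Otimes>\<^sub>M TP) (\<lambda>t. (t [], subtree j t))) (A \<times> B)" ..
  qed (auto intro: S TP.sigma_finite_measure_axioms)
  have "(\<integral>\<^sup>+t. \<Phi> (t []) (subtree j t) \<partial>TP) =
      (\<integral>\<^sup>+z. (\<lambda>(x, s). \<Phi> x s) z \<partial>distr TP (\<nu> \<Otimes>\<^sub>M TP) (\<lambda>t. (t [], subtree j t)))"
    by (subst nn_integral_distr[OF m]) auto
  also have "\<dots> = (\<integral>\<^sup>+z. (\<lambda>(x, s). \<Phi> x s) z \<partial>(\<nu> \<Otimes>\<^sub>M TP))"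
    using eq by simp
  also have "\<dots> = (\<integral>\<^sup>+s. \<integral>\<^sup>+x. \<Phi> x s \<partial>\<nu> \<partial>TP)"
    using nn_integral_snd[of "\<lambda>(x, s). \<Phi> x s"] by simp
  finally show ?thesis .
qed

text \<open>Replacing the vector at \<open>v\<close> by an independent copy preserves the product
  measure, and \<open>H\<close> does not see the replacement.\<close>

lemma nn_integral_resample:
  assumes H [measurable]: "H \<in> borel_measurable TP" and g [measurable]: "g \<in> borel_measurable \<nu>"
    and indep: "\<And>t x. H (t(v := x)) = H t"
  shows "(\<integral>\<^sup>+t. H t * g (t v) \<partial>TP) = (\<integral>\<^sup>+t. H t \<partial>TP) * (\<integral>\<^sup>+x. g x \<partial>\<nu>)"
proof -
  note P = prob_space_axioms
  interpret pair_prob_space \<nu> TP ..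
  have d: "distr (\<nu> \<Otimes>\<^sub>M TP) TP (\<lambda>(x, X). X(v := x)) = TP"
    using distr_pair_PiM_eq_PiM[of "UNIV :: 'd list set" "\<lambda>_. \<nu>" v] P
    by (simp add: TP_def)
  have m: "(\<lambda>(x, X). X(v := x)) \<in> measurable (\<nu> \<Otimes>\<^sub>M TP) TP"
    using measurable_add_dim[of v UNIV "\<lambda>_. \<nu>"]
    unfolding TP_def
    by (intro measurable_PiM_single') (auto simp: case_prod_unfold fun_upd_def)
  have "(\<integral>\<^sup>+t. H t * g (t v) \<partial>TP) =
      (\<integral>\<^sup>+z. H ((\<lambda>(x, X). X(v := x)) z) * g (((\<lambda>(x, X). X(v := x)) z) v) \<partial>(\<nu> \<Otimes>\<^sub>M TP))"
    by (subst d[symmetric], subst nn_integral_distr[OF m]) auto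
  also have "\<dots> = (\<integral>\<^sup>+z. (\<lambda>(x, X). H X * g x) z \<partial>(\<nu> \<Otimes>\<^sub>M TP))"
    by (intro nn_integral_cong) (auto simp: indep)
  also have "\<dots> = (\<integral>\<^sup>+X. \<integral>\<^sup>+x. H X * g x \<partial>\<nu> \<partial>TP)"
    using nn_integral_snd[of "\<lambda>(x, X). H X * g x"] by simp
  also have "\<dots> = (\<integral>\<^sup>+t. H t \<partial>TP) * (\<integral>\<^sup>+x. g x \<partial>\<nu>)"
    by (simp add: nn_integral_cmult nn_integral_multc)
  finally show ?thesis .
qed

lemma zero_one_law:
  assumes Z: "Z \<in> sets TP" and ij: "i \<noteq> j"
    and inher: "AE t in TP. t \<in> Z \<longrightarrow> subtree i t \<in> Z \<and> subtree j t \<in> Z"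
    and lt1: "emeasure TP Z < 1"
  shows "AE t in TP. t \<notin> Z"
proof -
  have "emeasure TP Z = (\<integral>\<^sup>+t. indicator Z t \<partial>TP)" using Z by simp
  also have "\<dots> \<le> (\<integral>\<^sup>+t. 1 * (indicator Z (subtree i t) * indicator Z (subtree j t)) \<partial>TP)"
    using inher by (intro nn_integral_mono_AE) (auto simp: indicator_def)
  also have "\<dots> = (emeasure TP Z)\<^sup>2"
    using nn_integral_root_subtree_pair[OF ij, of "\<lambda>_. 1" "indicator Z"] Z
    by (simp add: emeasure_space_1[simplified])
  finally have "measure TP Z \<le> (measure TP Z)\<^sup>2"
    by (simp add: TP.emeasure_eq_measure ennreal_power)
  moreover have "measure TP Z < 1" using lt1 by (simp add: TP.emeasure_eq_measure)
  ultimately have "\<not> measure TP Z > 0"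
    using mult_strict_left_mono[of "measure TP Z" 1 "measure TP Z"] by (auto simp: power2_eq_square)
  then have "measure TP Z = 0"
    using measure_nonneg[of TP Z] by linarith
  then have "Z \<in> null_sets TP" using Z by (auto simp: null_sets_def TP.emeasure_eq_measure)
  then show ?thesis by (rule AE_not_in)
qed

lemma measurable_mass [measurable]: "mass n \<in> borel_measurable TP"
proof (induction n)
  case (Suc n)
  have "(\<lambda>t. mass n (subtree j t)) \<in> borel_measurable TP" for j
    by (rule measurable_compose[OF measurable_subtree Suc])
  then have "(\<lambda>t. \<Sum>j\<in>UNIV. t [] j * mass n (subtree j t)) \<in> borel_measurable TP"
    by (intro borel_measurable_sum borel_measurable_times measurable_TP_component)
  then show ?case by (subst measurable_cong[OF mass.simps(2)])
qed (simp add: mass.simps(1)[abs_def])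

lemma measurable_escape [measurable]: "escape n \<in> borel_measurable TP"
proof (induction n)
  case (Suc n)
  have "(\<lambda>t. escape n (subtree j t)) \<in> borel_measurable TP" for j
    by (rule measurable_compose[OF measurable_subtree Suc])
  then have "(\<lambda>t. \<Sum>j\<in>UNIV. t [] j * escape n (subtree j t)) \<in> borel_measurable TP"
    by (intro borel_measurable_sum borel_measurable_times measurable_TP_component)
  then have "(\<lambda>t. let S = \<Sum>j\<in>UNIV. t [] j * escape n (subtree j t) in S / (1 + S)) \<in> borel_measurable TP"
    unfolding Let_def by measurable
  then show ?case by (subst measurable_cong[OF escape.simps(2)])
qed (simp add: escape.simps(1)[abs_def])

section \<open>Fractional powers and summability of the level masses\<close>

primrec power_mass :: "real \<Rightarrow> nat \<Rightarrow> ('d list \<Rightarrow> 'd \<Rightarrow> real) \<Rightarrow> real" where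
  "power_mass p 0 t = 1"
| "power_mass p (Suc n) t = (\<Sum>j\<in>UNIV. t [] j powr p * power_mass p n (subtree j t))"

lemma measurable_power_mass [measurable]: "power_mass p n \<in> borel_measurable TP"
proof (induction n)
  case (Suc n)
  have "(\<lambda>t. power_mass p n (subtree j t)) \<in> borel_measurable TP" for j
    by (rule measurable_compose[OF measurable_subtree Suc])
  moreover have "(\<lambda>t. t [] j powr p) \<in> borel_measurable TP" for j
    by measurable
  ultimately have "(\<lambda>t. \<Sum>j\<in>UNIV. t [] j powr p * power_mass p n (subtree j t)) \<in> borel_measurable TP"
    by (intro borel_measurable_sum borel_measurable_times)
  then show ?case by (subst measurable_cong[OF power_mass.simps(2)])
qed (simp add: power_mass.simps(1)[abs_def])

lemma power_mass_nonneg: "power_mass p n t \<ge> 0"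
  by (induction n arbitrary: t) (auto intro: sum_nonneg)

lemma mass_pos: "tree_pos t \<Longrightarrow> mass n t > 0"
proof (induction n arbitrary: t)
  case (Suc n)
  then show ?case using tree_pos_subtree[OF Suc.prems]
    by (auto intro!: sum_pos simp: tree_pos_def)
qed simp

lemma mass_le_power_mass:
  assumes "tree_pos t" "0 < p" "p \<le> 1"
  shows "mass n t powr p \<le> power_mass p n t"
  using assms(1)
proof (induction n arbitrary: t)
  case (Suc n)
  have t: "tree_pos (subtree j t)" "t [] j > 0" for j
    using Suc.prems by (auto simp: tree_pos_def subtree_def)
  have "mass (Suc n) t powr p \<le> (\<Sum>j\<in>UNIV. (t [] j * mass n (subtree j t)) powr p)"
    unfolding mass.simps using assms t mass_pos[OF t(1)]
    by (intro powr_subadditive) (auto simp: less_imp_le)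
  also have "\<dots> \<le> power_mass p (Suc n) t"
    unfolding power_mass.simps using t mass_pos[OF t(1)] Suc.IH
    by (intro sum_mono) (auto simp: powr_mult less_imp_le intro!: mult_left_mono)
  finally show ?case .
qed simp

lemma nn_integral_power_mass:
  "(\<integral>\<^sup>+t. ennreal (power_mass p n t) \<partial>TP) = (\<Sum>j\<in>UNIV. \<integral>\<^sup>+x. ennreal (x j powr p) \<partial>\<nu>) ^ n"
proof (induction n)
  case (Suc n)
  have "(\<integral>\<^sup>+t. ennreal (power_mass p (Suc n) t) \<partial>TP) =
      (\<integral>\<^sup>+t. (\<Sum>j\<in>UNIV. ennreal (t [] j powr p) * ennreal (power_mass p n (subtree j t))) \<partial>TP)"
    by (simp add: power_mass_nonneg ennreal_mult[symmetric])
  also have "\<dots> = (\<Sum>j\<in>UNIV. \<integral>\<^sup>+t. ennreal (t [] j powr p) * ennreal (power_mass p n (subtree j t)) \<partial>TP)"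
    by (rule nn_integral_sum) measurable
  also have "\<dots> = (\<Sum>j\<in>UNIV. (\<integral>\<^sup>+x. ennreal (x j powr p) \<partial>\<nu>) * (\<integral>\<^sup>+t. ennreal (power_mass p n t) \<partial>TP))"
    by (intro sum.cong refl
        nn_integral_root_subtree[where F = "\<lambda>x. ennreal (x _ powr p)" and G = "\<lambda>t. ennreal (power_mass p n t)"])
      measurable
  finally show ?case by (simp add: Suc sum_distrib_right mult.commute)
qed (simp add: emeasure_space_1[simplified] TP.emeasure_space_1[simplified])

text \<open>The means of the sums of \<open>p\<close>-th powers form a geometric series, so these
  sums are summable almost surely and tend to 0. Once they are below 1 the mass is at most 1, hence
  at most its own \<open>p\<close>-th power.\<close>

lemma mass_summable:
  assumes p: "0 < p" "p \<le> 1" and lt1: "(\<Sum>j\<in>UNIV. \<integral>\<^sup>+x. ennreal (x j powr p) \<partial>\<nu>) < 1"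
  shows "AE t in TP. summable (\<lambda>n. mass n t)"
proof -
  obtain F where F: "(\<Sum>j\<in>UNIV. \<integral>\<^sup>+x. ennreal (x j powr p) \<partial>\<nu>) = ennreal F" "F \<ge> 0"
    using lt1 by (cases "\<Sum>j\<in>UNIV. \<integral>\<^sup>+x. ennreal (x j powr p) \<partial>\<nu>") auto
  have F1: "F < 1" using lt1 F by simp
  have "(\<integral>\<^sup>+t. (\<Sum>n. ennreal (power_mass p n t)) \<partial>TP) = (\<Sum>n. \<integral>\<^sup>+t. ennreal (power_mass p n t) \<partial>TP)"
    by (rule nn_integral_suminf) measurable
  also have "\<dots> = (\<Sum>n. ennreal (F ^ n))"
    using F by (simp add: nn_integral_power_mass ennreal_power)
  also have "\<dots> = ennreal (\<Sum>n. F ^ n)"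
    using F F1 by (intro suminf_ennreal2) (auto intro: summable_geometric)
  finally have "(\<integral>\<^sup>+t. (\<Sum>n. ennreal (power_mass p n t)) \<partial>TP) \<noteq> \<infinity>" by simp
  then have "AE t in TP. (\<Sum>n. ennreal (power_mass p n t)) \<noteq> \<infinity>"
    by (intro nn_integral_PInf_AE) measurable
  with AE_tree_pos show ?thesis
  proof eventually_elim
    case (elim t)
    have s: "summable (\<lambda>n. power_mass p n t)"
      using elim(2) by (intro summable_suminf_not_top) (auto simp: power_mass_nonneg)
    then have "eventually (\<lambda>n. power_mass p n t < 1) sequentially"
      using order_tendstoD(2)[OF summable_LIMSEQ_zero[OF s], of 1] by simp
    then obtain N where N: "\<And>n. n \<ge> N \<Longrightarrow> power_mass p n t < 1"
      by (auto simp: eventually_sequentially)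
    show ?case
    proof (rule summable_comparison_test'[OF s])
      fix n assume n: "N \<le> n"
      have m: "mass n t > 0" by (rule mass_pos[OF elim(1)])
      have le: "mass n t powr p \<le> power_mass p n t" by (rule mass_le_power_mass[OF elim(1) p])
      then have "mass n t powr p < 1 powr p" using N[OF n] by simp
      then have "mass n t \<le> 1" using p powr_mono2[of p 1 "mass n t"] by (cases "mass n t \<le> 1") auto
      then have "mass n t powr 1 \<le> mass n t powr p" using p m by (intro powr_mono') auto
      then show "norm (mass n t) \<le> power_mass p n t" using le m by simp
    qed
  qed
qed

end

section \<open>Positive escape probability when the moments exceed one\<close>

text \<open>Two cases for the sum \<open>S\<close> in the recursion. If
  \<open>S \<le> \<epsilon>\<close>, the denominator costs at most the factor \<open>r\<close>.
  Otherwise the escape probability is at least \<open>r * \<epsilon>\<close>, and the scale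
  \<open>\<kappa>\<close> is chosen so that this reaches the plateau of \<open>phi h\<close>.
  Superadditivity splits the sum over the children.\<close>

lemma escape_phi_step:
  fixes t :: "'d::finite list \<Rightarrow> 'd \<Rightarrow> real"
  assumes t: "tree_pos t" and h: "h > 0" and e: "\<epsilon> > 0"
  defines "r \<equiv> 1 / (1 + \<epsilon>)"
  defines "\<kappa> \<equiv> r * \<epsilon> * exp (- (1 / h))"
  assumes y: "\<And>j. 0 \<le> y j \<and> y j \<le> t [] j"
  shows "r * (\<Sum>j\<in>UNIV. phi h (y j * escape n (subtree j t) / \<kappa>)) \<le>
    phi h (escape (Suc n) t / \<kappa>) + real CARD('d) * (\<Sum>i\<in>UNIV. \<Sum>j\<in>UNIV - {i}.
      phi h (y i * escape n (subtree i t) / \<kappa>) * phi h (y j * escape n (subtree j t) / \<kappa>))"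
proof -
  have r: "0 < r" "r \<le> 1" using e by (auto simp: r_def)
  have k: "\<kappa> > 0" using r e by (simp add: \<kappa>_def)
  define B where "B j = escape n (subtree j t)" for j
  have B: "0 < B j" "B j \<le> 1" for j
    using escape_bounds[OF tree_pos_subtree[OF t]] by (auto simp: B_def)
  define S where "S = (\<Sum>j\<in>UNIV. t [] j * B j)"
  define T where "T = (\<Sum>j\<in>UNIV. y j * B j)"
  have T: "0 \<le> T" "T \<le> S"
    unfolding T_def S_def using y B
    by (auto intro!: sum_nonneg mult_nonneg_nonneg sum_mono mult_right_mono simp: less_imp_le)
  have S: "S \<ge> 0" using T by simp
  have esc: "escape (Suc n) t = S / (1 + S)" by (simp add: S_def B_def Let_def)
  have "r * phi h (T / \<kappa>) \<le> phi h (escape (Suc n) t / \<kappa>)"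
  proof (cases "S \<le> \<epsilon>")
    case True
    have "r * T \<le> S / (1 + S)"
    proof -
      have "r * T \<le> r * S" using r T by (intro mult_left_mono) auto
      also have "\<dots> \<le> S / (1 + S)" unfolding r_def using S True e by (simp add: frac_le)
      finally show ?thesis .
    qed
    then have "r * T / \<kappa> \<le> escape (Suc n) t / \<kappa>"
      unfolding esc using k by (intro divide_right_mono) auto
    then have "r * (T / \<kappa>) \<le> escape (Suc n) t / \<kappa>"
      by simp
    then have "phi h (r * (T / \<kappa>)) \<le> phi h (escape (Suc n) t / \<kappa>)" by (rule phi_mono[OF h])
    moreover have "r * phi h (T / \<kappa>) \<le> phi h (r * (T / \<kappa>))"
      using phi_shrink[OF h r, of "T / \<kappa>"] T k by (auto simp del: times_divide_eq_right)
    ultimately show ?thesis by linarith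
  next
    case False
    have "r * \<epsilon> \<le> escape (Suc n) t"
      unfolding esc r_def using frac_mono[of \<epsilon> S] False e by simp
    moreover have "r * \<epsilon> = \<kappa> * exp (1 / h)"
      by (simp add: \<kappa>_def exp_minus)
    ultimately have "exp (1 / h) \<le> escape (Suc n) t / \<kappa>"
      using k by (simp add: pos_le_divide_eq mult.commute)
    then have "phi h (escape (Suc n) t / \<kappa>) = exp (1 / (2 * h))" by (rule phi_const[OF h])
    moreover have "r * phi h (T / \<kappa>) \<le> 1 * exp (1 / (2 * h))"
      using r phi_bounded[OF h] phi_nonneg[OF h] by (intro mult_mono) auto
    ultimately show ?thesis by simp
  qed
  moreover have "(\<Sum>j\<in>UNIV. phi h (y j * B j / \<kappa>)) - real CARD('d) * (\<Sum>i\<in>UNIV. \<Sum>j\<in>UNIV - {i}.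
      phi h (y i * B i / \<kappa>) * phi h (y j * B j / \<kappa>)) \<le> phi h (T / \<kappa>)"
    using phi_superadditive[OF h, of UNIV "\<lambda>j. y j * B j / \<kappa>"] y B k
    by (simp add: T_def sum_divide_distrib less_imp_le)
  moreover define Q where "Q = real CARD('d) * (\<Sum>i\<in>UNIV. \<Sum>j\<in>UNIV - {i}.
      phi h (y i * B i / \<kappa>) * phi h (y j * B j / \<kappa>))"
  moreover have "0 \<le> Q"
    unfolding Q_def by (intro mult_nonneg_nonneg sum_nonneg phi_nonneg[OF h]) auto
  moreover have "r * (\<Sum>j\<in>UNIV. phi h (y j * B j / \<kappa>)) \<le> r * (phi h (T / \<kappa>) + Q)"
    using calculation r by (intro mult_left_mono) auto
  moreover have "r * (phi h (T / \<kappa>) + Q) \<le> r * phi h (T / \<kappa>) + Q"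
    using r \<open>0 \<le> Q\<close> by (simp add: distrib_left mult_left_le_one_le)
  ultimately show ?thesis by (simp add: B_def Q_def)
qed

text \<open>Extreme ratios are sent to 0 and not clipped, so that truncation never increases a
  positive ratio. On what remains the logarithm is bounded by \<open>A\<close>, as the quadratic
  error in \<open>phi_taylor\<close> requires.\<close>

definition trunc :: "real \<Rightarrow> real \<Rightarrow> real" where
  "trunc A z = (if exp (- A) \<le> z \<and> z \<le> exp A then z else 0)"

lemma trunc_measurable [measurable]: "trunc A \<in> borel_measurable borel"
  unfolding trunc_def by measurable

context iid_tree
begin

text \<open>One cut-off has to serve all exponents: \<open>1 + x j\<close> dominates
  \<open>x j powr p\<close> for every \<open>p\<close> in [0,1], so the discarded part tends to 0
  uniformly. Half of the excess of \<open>c\<close> over 1 is given up.\<close>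

lemma truncation:
  assumes int: "\<And>j. integrable \<nu> (\<lambda>x. x j)" and c: "c > 1"
    and f: "\<And>p. p \<in> {0..1} \<Longrightarrow> ennreal c \<le> (\<Sum>j\<in>UNIV. \<integral>\<^sup>+x. ennreal (x j powr p) \<partial>\<nu>)"
  obtains A where "A \<ge> 1" "\<And>p. p \<in> {0..1} \<Longrightarrow> ennreal ((1 + c) / 2) \<le>
    (\<Sum>j\<in>UNIV. \<integral>\<^sup>+x. ennreal (x j powr p) * indicator {exp (- A)..exp A} (x j) \<partial>\<nu>)"
proof -
  define T where "T n = (\<Sum>j\<in>UNIV. \<integral>\<^sup>+x. ennreal (1 + x j) *
      indicator (- {exp (- real n)..exp (real n)}) (x j) \<partial>\<nu>)" for n
  have lim: "(\<lambda>n. \<integral>\<^sup>+x. ennreal (1 + x j) * indicator (- {exp (- real n)..exp (real n)}) (x j) \<partial>\<nu>)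
      \<longlonglongrightarrow> (\<integral>\<^sup>+x. 0 \<partial>\<nu>)" for j
  proof (rule nn_integral_dominated_convergence[where w = "\<lambda>x. ennreal (1 + x j)"])
    have "integrable \<nu> (\<lambda>x. 1 + x j)" using int by simp
    then show "(\<integral>\<^sup>+x. ennreal (1 + x j) \<partial>\<nu>) < \<infinity>"
      by (metis (no_types) infinity_ennreal_def less_top real_integrable_def)
    show "AE x in \<nu>. (\<lambda>n. ennreal (1 + x j) * indicator (- {exp (- real n)..exp (real n)}) (x j)) \<longlonglongrightarrow> 0"
      using nu_pos
    proof eventually_elim
      case (elim x)
      obtain n0 :: nat where n0: "\<bar>ln (x j)\<bar> \<le> real n0" using real_arch_simple by blast
      have "ennreal (1 + x j) * indicator (- {exp (- real n)..exp (real n)}) (x j) = 0" if "n \<ge> n0" for n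
      proof -
        have "- real n \<le> ln (x j)" "ln (x j) \<le> real n" using n0 that by linarith+
        then have "exp (- real n) \<le> x j" "x j \<le> exp (real n)"
          using elim by (metis exp_le_cancel_iff exp_ln)+
        then show ?thesis by simp
      qed
      then show ?case
        by (intro tendsto_eventually) (auto simp: eventually_sequentially)
    qed
  qed (measurable, auto simp: indicator_def)
  have "T \<longlonglongrightarrow> (\<Sum>j\<in>(UNIV :: 'd set). \<integral>\<^sup>+x. 0 \<partial>\<nu>)"
    unfolding T_def[abs_def] by (intro tendsto_sum lim)
  then have "T \<longlonglongrightarrow> 0" by simp
  then have "eventually (\<lambda>n. T n < ennreal ((c - 1) / 2)) sequentially"
    using c by (intro order_tendstoD(2)) auto
  then obtain n0 where "\<And>n. n \<ge> n0 \<Longrightarrow> T n < ennreal ((c - 1) / 2)"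
    by (auto simp: eventually_sequentially)
  then have T: "T (max 1 n0) < ennreal ((c - 1) / 2)" by simp
  define n where "n = max 1 n0"
  show thesis
  proof (rule that[of "real n"])
    show "real n \<ge> 1" by (simp add: n_def)
    fix p :: real assume p: "p \<in> {0..1}"
    define FA where "FA = (\<Sum>j\<in>UNIV. \<integral>\<^sup>+x. ennreal (x j powr p) * indicator {exp (- real n)..exp (real n)} (x j) \<partial>\<nu>)"
    have "ennreal c \<le> (\<Sum>j\<in>UNIV. \<integral>\<^sup>+x. ennreal (x j powr p) \<partial>\<nu>)" by (rule f[OF p])
    also have "\<dots> \<le> (\<Sum>j\<in>UNIV. (\<integral>\<^sup>+x. ennreal (x j powr p) * indicator {exp (- real n)..exp (real n)} (x j) \<partial>\<nu>) +
        (\<integral>\<^sup>+x. ennreal (1 + x j) * indicator (- {exp (- real n)..exp (real n)}) (x j) \<partial>\<nu>))"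
    proof (rule sum_mono)
      fix j
      have "(\<integral>\<^sup>+x. ennreal (x j powr p) \<partial>\<nu>) \<le>
          (\<integral>\<^sup>+x. ennreal (x j powr p) * indicator {exp (- real n)..exp (real n)} (x j) +
            ennreal (1 + x j) * indicator (- {exp (- real n)..exp (real n)}) (x j) \<partial>\<nu>)"
        using nu_pos
        by (intro nn_integral_mono_AE, eventually_elim)
          (use p powr_le_one_plus in \<open>auto simp: indicator_def intro!: ennreal_leI\<close>)
      also have "\<dots> = (\<integral>\<^sup>+x. ennreal (x j powr p) * indicator {exp (- real n)..exp (real n)} (x j) \<partial>\<nu>) +
          (\<integral>\<^sup>+x. ennreal (1 + x j) * indicator (- {exp (- real n)..exp (real n)}) (x j) \<partial>\<nu>)"
        by (rule nn_integral_add) measurable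
      finally show "(\<integral>\<^sup>+x. ennreal (x j powr p) \<partial>\<nu>) \<le> \<dots>" .
    qed
    also have "\<dots> = FA + T n" by (simp add: sum.distrib FA_def T_def)
    also have "\<dots> \<le> FA + ennreal ((c - 1) / 2)"
      using T by (intro add_left_mono) (simp add: n_def less_imp_le)
    finally have le: "ennreal c \<le> FA + ennreal ((c - 1) / 2)" .
    show "ennreal ((1 + c) / 2) \<le> FA"
    proof (cases FA)
      case (real a)
      then have "ennreal c \<le> ennreal (a + (c - 1) / 2)" using le c by simp
      then have "c \<le> a + (c - 1) / 2" using real c by (subst (asm) ennreal_le_iff) auto
      then have "(1 + c) / 2 \<le> a" by (simp add: field_simps)
      then show ?thesis using real by (simp add: ennreal_leI)
    qed simp
  qed
qed

text \<open>The exponent supplied by \<open>phi_taylor\<close> depends on \<open>b\<close>, hence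
  the moment bound for all exponents. On the truncated range the logarithm is at most
  \<open>A\<close> in modulus, and the Taylor error becomes a constant factor.\<close>

lemma phi_expectation:
  assumes h: "h > 0" and A: "A \<ge> 0" and m: "m > 0" and b: "b > 0"
    and f: "\<And>p. p \<in> {0..1} \<Longrightarrow> ennreal m \<le>
      (\<Sum>j\<in>UNIV. \<integral>\<^sup>+x. ennreal (x j powr p) * indicator {exp (- A)..exp A} (x j) \<partial>\<nu>)"
  shows "ennreal (m * exp (- (h * A\<^sup>2 / 2)) * phi h b) \<le> (\<Sum>j\<in>UNIV. \<integral>\<^sup>+x. ennreal (phi h (trunc A (x j) * b)) \<partial>\<nu>)"
proof -
  obtain p where p: "p \<in> {0..1}" and tay: "\<And>T. phi h b * exp (p * T - h * T\<^sup>2 / 2) \<le> phi h (b * exp T)"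
    using phi_taylor[OF h b] by blast
  define C where "C = exp (- (h * A\<^sup>2 / 2)) * phi h b"
  have C: "C \<ge> 0" using phi_nonneg[OF h] by (simp add: C_def)
  have pt: "C * (z powr p * indicator {exp (- A)..exp A} z) \<le> phi h (trunc A z * b)" for z
  proof (cases "exp (- A) \<le> z \<and> z \<le> exp A")
    case True
    have z: "z > 0" using True exp_gt_zero[of "- A"] by linarith
    define T where "T = ln z"
    have "- A \<le> T" "T \<le> A" using True z ln_ge_iff[of z "- A"] ln_le_cancel_iff[of z "exp A"] by (auto simp: T_def)
    then have "T\<^sup>2 \<le> A\<^sup>2" using abs_le_square_iff[of T A] by linarith
    then have "h * T\<^sup>2 / 2 \<le> h * A\<^sup>2 / 2" using h by simp
    then have "phi h b * exp (p * T - h * A\<^sup>2 / 2) \<le> phi h b * exp (p * T - h * T\<^sup>2 / 2)"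
      using phi_nonneg[OF h, of b] by (intro mult_left_mono) auto
    moreover have "C * z powr p = phi h b * exp (p * T - h * A\<^sup>2 / 2)"
    proof -
      have "exp (p * T - h * A\<^sup>2 / 2) = exp (p * T) * exp (- (h * A\<^sup>2 / 2))"
        using exp_add[of "p * T" "- (h * A\<^sup>2 / 2)"] by simp
      moreover have "z powr p = exp (p * T)" using z by (simp add: powr_def T_def)
      ultimately show ?thesis by (simp only: C_def mult_ac)
    qed
    ultimately have "C * z powr p \<le> phi h b * exp (p * T - h * T\<^sup>2 / 2)"
      by simp
    also have "\<dots> \<le> phi h (b * exp T)" by (rule tay)
    also have "b * exp T = trunc A z * b" using True z by (simp add: trunc_def T_def)
    finally show ?thesis using True by simp
  qed (auto simp: trunc_def phi_def)
  have "ennreal (m * exp (- (h * A\<^sup>2 / 2)) * phi h b) = ennreal C * ennreal m"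
    using C m by (simp add: ennreal_mult[symmetric] C_def mult_ac)
  also have "\<dots> \<le> ennreal C * (\<Sum>j\<in>UNIV. \<integral>\<^sup>+x. ennreal (x j powr p) * indicator {exp (- A)..exp A} (x j) \<partial>\<nu>)"
    by (intro mult_left_mono f p) auto
  also have "\<dots> = (\<Sum>j\<in>UNIV. \<integral>\<^sup>+x. ennreal C * (ennreal (x j powr p) * indicator {exp (- A)..exp A} (x j)) \<partial>\<nu>)"
    by (simp add: sum_distrib_left nn_integral_cmult)
  also have "\<dots> \<le> (\<Sum>j\<in>UNIV. \<integral>\<^sup>+x. ennreal (phi h (trunc A (x j) * b)) \<partial>\<nu>)"
  proof (intro sum_mono nn_integral_mono)
    fix j and x :: "'d \<Rightarrow> real"
    have "ennreal C * (ennreal (x j powr p) * indicator {exp (- A)..exp A} (x j)) =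
        ennreal (C * (x j powr p * indicator {exp (- A)..exp A} (x j)))"
      using C by (simp add: ennreal_mult indicator_def)
    then show "ennreal C * (ennreal (x j powr p) * indicator {exp (- A)..exp A} (x j)) \<le>
        ennreal (phi h (trunc A (x j) * b))"
      using pt[of "x j"] by (simp add: ennreal_leI)
  qed
  finally show ?thesis .
qed

lemma escape_pos:
  assumes int: "\<And>j. integrable \<nu> (\<lambda>x. x j)" and c: "c > 1"
    and f: "\<And>p. p \<in> {0..1} \<Longrightarrow> ennreal c \<le> (\<Sum>j\<in>UNIV. \<integral>\<^sup>+x. ennreal (x j powr p) \<partial>\<nu>)"
    and d2: "CARD('d) \<ge> 2"
  shows "AE t in TP. escape_inf t > 0"
proof -
  define m where "m = (1 + c) / 2"
  have m: "m > 1" using c by (simp add: m_def)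
  obtain A where A: "A \<ge> 1" and fA: "\<And>p. p \<in> {0..1} \<Longrightarrow> ennreal m \<le>
      (\<Sum>j\<in>UNIV. \<integral>\<^sup>+x. ennreal (x j powr p) * indicator {exp (- A)..exp A} (x j) \<partial>\<nu>)"
    using truncation[OF int c f] unfolding m_def by blast
  define l where "l = ln m"
  have l: "l > 0" "exp l = m" using m by (auto simp: l_def)
  \<comment> \<open>The margin \<open>l = ln m\<close> is split: one quarter pays for the Taylor
    error, one quarter for the denominators through \<open>1 + \<epsilon> = exp (l / 4)\<close>, and
    the factor \<open>exp (l / 2)\<close> remains.\<close>
  define h where "h = l / (2 * A\<^sup>2)"
  have h: "h > 0" using l A by (simp add: h_def)
  have hA: "h * A\<^sup>2 / 2 = l / 4" using A by (simp add: h_def)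
  define \<epsilon> where "\<epsilon> = exp (l / 4) - 1"
  have e: "\<epsilon> > 0" using l by (simp add: \<epsilon>_def)
  define r where "r = 1 / (1 + \<epsilon>)"
  have r: "r = exp (- (l / 4))" by (simp add: r_def \<epsilon>_def exp_minus field_simps)
  define \<kappa> where "\<kappa> = r * \<epsilon> * exp (- (1 / h))"
  have k: "\<kappa> > 0" using e by (simp add: \<kappa>_def r)
  define \<psi> where "\<psi> b = phi h (b / \<kappa>)" for b
  have \<psi>0: "\<psi> b \<ge> 0" for b by (simp add: \<psi>_def phi_nonneg[OF h])
  have [measurable]: "\<psi> \<in> borel_measurable borel" unfolding \<psi>_def by measurable
  define d where "d = real CARD('d)"
  define E where "E n = (\<integral>\<^sup>+t. ennreal (\<psi> (escape n t)) \<partial>TP)" for n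
  \<comment> \<open>Growth by the factor \<open>exp (l / 2)\<close> up to pairs of different
    children, whose independent subtrees produce the square of \<open>E n\<close>. The constant
    collects \<open>d\<close> from superadditivity, \<open>d * d\<close> for the pairs and
    \<open>exp A\<close> for each truncated ratio.\<close>
  have main: "ennreal r * (ennreal (m * exp (- (h * A\<^sup>2 / 2))) * E n) \<le>
      E (Suc n) + ennreal (d * (d * d * (exp A * exp A))) * (E n)\<^sup>2" for n
  proof -
    define U where "U j t = \<psi> (trunc A (t [] j) * escape n (subtree j t))"
      for j and t :: "'d list \<Rightarrow> 'd \<Rightarrow> real"
    have U0: "U j t \<ge> 0" for j t by (simp add: U_def \<psi>0)
    have Um [measurable]: "U j \<in> borel_measurable TP" for j
    proof -
      have "(\<lambda>t. escape n (subtree j t)) \<in> borel_measurable TP"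
        by (rule measurable_compose[OF measurable_subtree measurable_escape])
      then show ?thesis unfolding U_def[abs_def] by measurable
    qed
    have first: "ennreal (m * exp (- (h * A\<^sup>2 / 2))) * E n \<le> (\<Sum>j\<in>UNIV. \<integral>\<^sup>+t. ennreal (U j t) \<partial>TP)"
    proof -
      have "(\<Sum>j\<in>UNIV. \<integral>\<^sup>+t. ennreal (U j t) \<partial>TP) =
          (\<Sum>j\<in>UNIV. \<integral>\<^sup>+s. \<integral>\<^sup>+x. ennreal (\<psi> (trunc A (x j) * escape n s)) \<partial>\<nu> \<partial>TP)"
        unfolding U_def
        by (intro sum.cong refl
            nn_integral_root_subtree_joint[where \<Phi> = "\<lambda>x s. ennreal (\<psi> (trunc A (x _) * escape n s))"])
          measurable
      also have "\<dots> = (\<integral>\<^sup>+s. (\<Sum>j\<in>UNIV. \<integral>\<^sup>+x. ennreal (\<psi> (trunc A (x j) * escape n s)) \<partial>\<nu>) \<partial>TP)"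
        by (rule nn_integral_sum[symmetric]) measurable
      also have "\<dots> \<ge> (\<integral>\<^sup>+s. ennreal (m * exp (- (h * A\<^sup>2 / 2))) * ennreal (\<psi> (escape n s)) \<partial>TP)"
      proof (rule nn_integral_mono_tree_pos, goal_cases)
        case elim: (1 s)
        have "escape n s / \<kappa> > 0" using escape_bounds[OF elim, of n] k by simp
        then show ?case
          using phi_expectation[OF h _ _ _ fA, of "escape n s / \<kappa>"] A m \<psi>0
          by (simp add: \<psi>_def ennreal_mult[symmetric])
      qed
      finally show ?thesis by (simp add: nn_integral_cmult E_def)
    qed
    have pair: "(\<integral>\<^sup>+t. ennreal (U i t * U j t) \<partial>TP) \<le> ennreal (exp A * exp A) * (E n)\<^sup>2" if "i \<noteq> j" for i j
    proof -
      \<comment> \<open>\<open>phi_scale\<close> with the bound \<open>exp A\<close> takes the root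
        vector out of the argument, so that the two subtrees separate.\<close>
      have trunc: "U j t \<le> exp A * \<psi> (escape n (subtree j t))" if "tree_pos t" for j t
      proof -
        have esc: "escape n (subtree j t) > 0"
          using escape_bounds[OF tree_pos_subtree[OF that]] by simp
        have "trunc A (t [] j) \<le> exp A" by (simp add: trunc_def)
        then have "trunc A (t [] j) * escape n (subtree j t) / \<kappa> \<le> exp A * (escape n (subtree j t) / \<kappa>)"
          using esc k by (simp add: divide_right_mono)
        then have "U j t \<le> phi h (exp A * (escape n (subtree j t) / \<kappa>))"
          unfolding U_def \<psi>_def by (rule phi_mono[OF h])
        also have "\<dots> \<le> exp A * phi h (escape n (subtree j t) / \<kappa>)"
          using esc k A by (intro phi_scale[OF h]) auto
        finally show ?thesis by (simp add: \<psi>_def)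
      qed
      have "(\<integral>\<^sup>+t. ennreal (U i t * U j t) \<partial>TP) \<le> (\<integral>\<^sup>+t. ennreal (exp A * exp A) *
          (ennreal (\<psi> (escape n (subtree i t))) * ennreal (\<psi> (escape n (subtree j t)))) \<partial>TP)"
      proof (rule nn_integral_mono_tree_pos, goal_cases)
        case elim: (1 t)
        have "U i t * U j t \<le> (exp A * \<psi> (escape n (subtree i t))) * (exp A * \<psi> (escape n (subtree j t)))"
          using trunc[OF elim] U0 \<psi>0 by (intro mult_mono) auto
        then show ?case
          using \<psi>0 by (simp add: ennreal_mult[symmetric] ennreal_leI mult_ac)
      qed
      also have "\<dots> = (\<integral>\<^sup>+x. ennreal (exp A * exp A) \<partial>\<nu>) * (E n)\<^sup>2"
        unfolding E_def
        by (rule nn_integral_root_subtree_pair[OF that, of "\<lambda>_. ennreal (exp A * exp A)" "\<lambda>t. ennreal (\<psi> (escape n t))"])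
          measurable
      finally show ?thesis by (simp add: emeasure_space_1[simplified])
    qed
    have "ennreal r * (ennreal (m * exp (- (h * A\<^sup>2 / 2))) * E n) \<le>
        ennreal r * (\<Sum>j\<in>UNIV. \<integral>\<^sup>+t. ennreal (U j t) \<partial>TP)"
      by (intro mult_left_mono first) simp
    also have "\<dots> = (\<integral>\<^sup>+t. ennreal (r * (\<Sum>j\<in>UNIV. U j t)) \<partial>TP)"
      using U0 by (simp add: r ennreal_mult sum_nonneg nn_integral_cmult nn_integral_sum[symmetric]
          del: sum_ennreal flip: sum_ennreal)
    also have "\<dots> \<le> (\<integral>\<^sup>+t. ennreal (\<psi> (escape (Suc n) t)) +
        ennreal d * (\<Sum>i\<in>UNIV. \<Sum>j\<in>UNIV - {i}. ennreal (U i t * U j t)) \<partial>TP)"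
    proof (rule nn_integral_mono_tree_pos, goal_cases)
      case elim: (1 t)
      have "r * (\<Sum>j\<in>UNIV. U j t) \<le> \<psi> (escape (Suc n) t) + d * (\<Sum>i\<in>UNIV. \<Sum>j\<in>UNIV - {i}. U i t * U j t)"
        using escape_phi_step[OF elim h e, of "\<lambda>j. trunc A (t [] j)" n] elim
        by (simp add: U_def \<psi>_def \<kappa>_def r_def d_def trunc_def tree_pos_def less_imp_le del: escape.simps)
      then show ?case
        using U0 \<psi>0 by (simp add: d_def ennreal_mult[symmetric] ennreal_plus[symmetric] sum_nonneg
            ennreal_leI del: ennreal_plus escape.simps)
    qed
    also have "\<dots> = E (Suc n) + ennreal d * (\<Sum>i\<in>UNIV. \<Sum>j\<in>UNIV - {i}. \<integral>\<^sup>+t. ennreal (U i t * U j t) \<partial>TP)"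
      by (simp add: nn_integral_add nn_integral_cmult nn_integral_sum E_def del: escape.simps)
    also have "\<dots> \<le> E (Suc n) + ennreal d *
        (\<Sum>i\<in>(UNIV :: 'd set). \<Sum>j\<in>(UNIV :: 'd set). ennreal (exp A * exp A) * (E n)\<^sup>2)"
    proof (intro add_left_mono mult_left_mono sum_mono)
      fix i :: 'd
      have "(\<Sum>j\<in>UNIV - {i}. \<integral>\<^sup>+t. ennreal (U i t * U j t) \<partial>TP) \<le>
          (\<Sum>j\<in>UNIV - {i}. ennreal (exp A * exp A) * (E n)\<^sup>2)"
        by (intro sum_mono pair) auto
      also have "\<dots> \<le> (\<Sum>j\<in>(UNIV :: 'd set). ennreal (exp A * exp A) * (E n)\<^sup>2)"
        by (intro sum_mono2) auto
      finally show "(\<Sum>j\<in>UNIV - {i}. \<integral>\<^sup>+t. ennreal (U i t * U j t) \<partial>TP) \<le> \<dots>" .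
    qed simp
    also have "\<dots> = E (Suc n) + ennreal (d * (d * d * (exp A * exp A))) * (E n)\<^sup>2"
      by (simp add: d_def ennreal_mult ennreal_of_nat_eq_real_of_nat mult_ac)
    finally show ?thesis .
  qed
  \<comment> \<open>The point where growth and quadratic loss balance: with \<open>C\<close> the
    constant of the recursion, monotonicity of \<open>E\<close> gives
    \<open>exp (l / 2) \<le> 1 + C * E n\<close>.\<close>
  define c0 where "c0 = (exp (l / 2) - 1) / (d * (d * d * (exp A * exp A)))"
  have d: "d > 0" by (simp add: d_def)
  have c0: "c0 > 0" using l d by (simp add: c0_def)
  have E_fin: "E n \<le> ennreal (exp (1 / (2 * h)))" for n
  proof -
    have "E n \<le> (\<integral>\<^sup>+t. ennreal (exp (1 / (2 * h))) \<partial>TP)"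
      unfolding E_def \<psi>_def by (intro nn_integral_mono ennreal_leI phi_bounded[OF h])
    then show ?thesis by (simp add: TP.emeasure_space_1[simplified])
  qed
  \<comment> \<open>Positivity for each single \<open>n\<close> allows division by
    \<open>E n\<close>; the bound that results is uniform in \<open>n\<close>.\<close>
  have E_pos: "E n \<noteq> 0" for n
  proof
    assume "E n = 0"
    then have "AE t in TP. ennreal (\<psi> (escape n t)) = 0"
      unfolding E_def by (subst (asm) nn_integral_0_iff_AE) auto
    with AE_tree_pos have "AE t in TP. False"
    proof eventually_elim
      case (elim t)
      have "\<psi> (escape n t) > 0"
        unfolding \<psi>_def using escape_bounds[OF elim(1), of n] k by (intro phi_pos[OF h]) auto
      then show ?case using elim(2) by simp
    qed
    then show False by simp
  qed
  have E_dec: "E (Suc n) \<le> E n" for n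
    unfolding E_def
  proof (rule nn_integral_mono_tree_pos, goal_cases)
    case elim: (1 t)
    then show ?case
      unfolding \<psi>_def using escape_decreasing[OF elim, of n] k
      by (intro ennreal_leI phi_mono[OF h] divide_right_mono) auto
  qed
  have E_ge: "ennreal c0 \<le> E n" for n
  proof -
    obtain x where x: "E n = ennreal x" "x \<ge> 0"
      using E_fin[of n] by (cases "E n") (auto simp: top_unique)
    have xp: "x > 0" using E_pos[of n] x by (cases "x = 0") auto
    have "ennreal r * (ennreal (m * exp (- (h * A\<^sup>2 / 2))) * E n) \<le>
        E n + ennreal (d * (d * d * (exp A * exp A))) * (E n)\<^sup>2"
      using main[of n] E_dec[of n] by (meson add_right_mono order_trans)
    then have "ennreal (r * (m * exp (- (h * A\<^sup>2 / 2)) * x)) \<le>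
        ennreal (x + d * (d * d * (exp A * exp A)) * x\<^sup>2)"
      using x m d by (simp add: ennreal_mult[symmetric] ennreal_power ennreal_plus[symmetric] r del: ennreal_plus)
    then have "r * (m * exp (- (h * A\<^sup>2 / 2)) * x) \<le> x + d * (d * d * (exp A * exp A)) * x\<^sup>2"
      using x d by (subst (asm) ennreal_le_iff) (auto intro!: add_nonneg_nonneg mult_nonneg_nonneg)
    moreover have "r * (m * exp (- (h * A\<^sup>2 / 2)) * x) = exp (l / 2) * x"
      unfolding r hA l(2)[symmetric] by (simp add: exp_add[symmetric] mult.assoc[symmetric])
    ultimately have "exp (l / 2) * x \<le> x + d * (d * d * (exp A * exp A)) * x\<^sup>2"
      by linarith
    then have "exp (l / 2) * x \<le> (1 + d * (d * d * (exp A * exp A)) * x) * x"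
      by (simp add: algebra_simps power2_eq_square)
    then have "exp (l / 2) \<le> 1 + d * (d * d * (exp A * exp A)) * x" using xp by simp
    then have "c0 \<le> x" unfolding c0_def using d by (simp add: pos_divide_le_eq algebra_simps)
    then show ?thesis using x by (simp add: ennreal_leI)
  qed
  \<comment> \<open>\<open>phi h\<close> lies below the identity, so the bound transfers to the mean
    escape probability at scale \<open>\<kappa>\<close> and then passes to the limit by
    domination.\<close>
  have esc_ge: "ennreal (\<kappa> * c0) \<le> (\<integral>\<^sup>+t. ennreal (escape n t) \<partial>TP)" for n
  proof -
    have "ennreal (\<kappa> * c0) \<le> ennreal \<kappa> * E n"
      using E_ge[of n] k c0 by (simp add: ennreal_mult mult_left_mono)
    also have "\<dots> = (\<integral>\<^sup>+t. ennreal \<kappa> * ennreal (\<psi> (escape n t)) \<partial>TP)"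
      unfolding E_def by (rule nn_integral_cmult[symmetric]) measurable
    also have "\<dots> \<le> (\<integral>\<^sup>+t. ennreal (escape n t) \<partial>TP)"
    proof (rule nn_integral_mono_tree_pos, goal_cases)
      case elim: (1 t)
      have "\<psi> (escape n t) \<le> escape n t / \<kappa>"
        unfolding \<psi>_def using escape_bounds[OF elim, of n] k by (intro phi_le_self[OF h]) auto
      then have "\<kappa> * \<psi> (escape n t) \<le> escape n t" using k by (simp add: field_simps)
      then show ?case using k \<psi>0 by (simp add: ennreal_mult[symmetric] ennreal_leI)
    qed
    finally show ?thesis .
  qed
  have inf_m [measurable]: "escape_inf \<in> borel_measurable TP"
    unfolding escape_inf_def[abs_def] by measurable
  have "(\<lambda>n. \<integral>\<^sup>+t. ennreal (escape n t) \<partial>TP) \<longlonglongrightarrow> (\<integral>\<^sup>+t. ennreal (escape_inf t) \<partial>TP)"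
  proof (rule nn_integral_dominated_convergence[where w = "\<lambda>_. 1"])
    show "AE t in TP. (\<lambda>n. ennreal (escape n t)) \<longlonglongrightarrow> ennreal (escape_inf t)"
      using AE_tree_pos by eventually_elim (intro tendsto_ennrealI escape_tendsto)
    show "AE t in TP. ennreal (escape n t) \<le> 1" for n
      using AE_tree_pos by eventually_elim (use escape_bounds in auto)
  qed (auto simp: TP.emeasure_space_1[simplified])
  then have inf_ge: "ennreal (\<kappa> * c0) \<le> (\<integral>\<^sup>+t. ennreal (escape_inf t) \<partial>TP)"
    by (rule LIMSEQ_le_const) (use esc_ge in blast)
  define Z where "Z = {t :: 'd list \<Rightarrow> 'd \<Rightarrow> real. escape_inf t = 0}"
  have Z: "Z \<in> sets TP"
  proof -
    have "{t \<in> space TP. escape_inf t = 0} \<in> sets TP" by measurable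
    then show ?thesis by (simp add: Z_def)
  qed
  obtain i j :: 'd where ij: "i \<noteq> j"
    using d2 by (metis One_nat_def card_le_Suc0_iff_eq finite numeral_2_eq_2 not_less_eq_eq UNIV_I)
  have "AE t in TP. t \<notin> Z"
  proof (rule zero_one_law[OF Z ij])
    show "AE t in TP. t \<in> Z \<longrightarrow> subtree i t \<in> Z \<and> subtree j t \<in> Z"
      using AE_tree_pos by eventually_elim (auto simp: Z_def escape_inf_eq_0_iff)
    show "emeasure TP Z < 1"
    proof (rule ccontr)
      assume "\<not> emeasure TP Z < 1"
      then have "emeasure TP Z = 1"
        using TP.measure_le_1 by (metis TP.emeasure_le_1 order_le_less)
      then have "AE t in TP. t \<in> Z"
        using Z TP.AE_in_set_eq_1[OF Z] by (simp add: TP.emeasure_eq_measure)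
      then have "(\<integral>\<^sup>+t. ennreal (escape_inf t) \<partial>TP) = (\<integral>\<^sup>+t. 0 \<partial>TP)"
        by (intro nn_integral_cong_AE) (auto simp: Z_def)
      then show False using inf_ge k c0 by simp
    qed
  qed
  with AE_tree_pos show ?thesis
  proof eventually_elim
    case (elim t)
    then show ?case using escape_inf_bounds(1)[OF elim(1)] by (auto simp: Z_def)
  qed
qed

end

section \<open>Positive limit mass in the critical case\<close>

text \<open>The recursion for \<open>mass\<close> splits at the base of the tree; products along
  paths allow splitting at the last level, where the fresh randomness enters.\<close>

primrec path_prod :: "('d list \<Rightarrow> 'd \<Rightarrow> real) \<Rightarrow> 'd list \<Rightarrow> real" where
  "path_prod t [] = 1"
| "path_prod t (j # u) = t [] j * path_prod (subtree j t) u"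

lemma mass_eq_sum_path_prod: "mass n t = (\<Sum>v\<in>{v. length v = n}. path_prod t v)"
proof (induction n arbitrary: t)
  case (Suc n)
  then show ?case unfolding sum_level_Suc_Cons by (simp add: sum_distrib_left)
qed simp

lemma path_prod_snoc: "path_prod t (v @ [j]) = path_prod t v * t v j"
  by (induction v arbitrary: t) (simp_all add: subtree_def)

lemma path_prod_pos: "tree_pos t \<Longrightarrow> path_prod t v > 0"
proof (induction v arbitrary: t)
  case (Cons j u)
  then show ?case using Cons.IH[OF tree_pos_subtree[OF Cons.prems]] by (simp add: tree_pos_def)
qed simp

lemma mass_Suc_snoc:
  "mass (Suc n) t = (\<Sum>v\<in>{v. length v = n}. path_prod t v * (\<Sum>j\<in>UNIV. t v j))"
  unfolding mass_eq_sum_path_prod sum_level_Suc_snoc by (simp add: path_prod_snoc sum_distrib_left)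

text \<open>Only the vectors at proper prefixes of \<open>v\<close> enter the product.\<close>

lemma path_prod_upd: "length v \<le> length u \<Longrightarrow> path_prod (t(u := x)) v = path_prod t v"
proof (induction v arbitrary: t u)
  case (Cons j v)
  then obtain i u' where u: "u = i # u'" by (cases u) auto
  have "subtree j (t(u := x)) = (if i = j then (subtree j t)(u' := x) else subtree j t)"
    by (auto simp: subtree_def u fun_eq_iff)
  then have "path_prod (subtree j (t(u := x))) v = path_prod (subtree j t) v"
    using Cons.IH[of u' "subtree j t"] Cons.prems u by (simp del: fun_upd_apply)
  moreover have "(t(u := x)) [] = t []" using u by simp
  ultimately show ?case by (simp only: path_prod.simps)
qed simp

lemma mass_upd: "n \<le> length u \<Longrightarrow> mass n (t(u := x)) = mass n t"
  unfolding mass_eq_sum_path_prod by (intro sum.cong) (auto intro!: path_prod_upd)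

text \<open>Concavity of the power, as the tangent at \<open>y\<close>. After scaling by
  \<open>y\<close> it is the weighted inequality of arithmetic and geometric means for
  \<open>z\<close> and 1.\<close>

lemma powr_le_tangent:
  fixes x y h :: real
  assumes "x > 0" "y > 0" "0 \<le> h" "h \<le> 1"
  shows "x powr h \<le> (1 - h) * y powr h + h * (y powr (h - 1) * x)"
proof -
  define z where "z = x / y"
  define w where "w = h * z + (1 - h)"
  have z: "z > 0" using assms by (simp add: z_def)
  have w: "w > 0"
    unfolding w_def using z assms by (cases "h = 1") (auto intro: add_nonneg_pos)
  have "h * ln (z / w) + (1 - h) * ln (1 / w) \<le> h * (z / w - 1) + (1 - h) * (1 / w - 1)"
    using z w assms by (intro add_mono mult_left_mono ln_le_minus_one) auto
  also have "\<dots> = (h * z + (1 - h)) / w - 1"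
    by (simp add: add_divide_distrib diff_divide_distrib algebra_simps)
  also have "\<dots> = 0" using w by (simp add: w_def[symmetric])
  finally have "h * ln z \<le> ln w"
    using z w by (simp add: ln_div algebra_simps)
  then have "z powr h \<le> w"
    using z w by (simp add: powr_def) (metis exp_le_cancel_iff exp_ln)
  then have "y powr h * z powr h \<le> y powr h * w" by (intro mult_left_mono) auto
  moreover have "y powr h * z powr h = x powr h"
    using assms by (simp add: z_def powr_mult[symmetric])
  moreover have "y powr h * z = y powr (h - 1) * x"
    using assms by (simp add: z_def powr_diff)
  ultimately show ?thesis by (simp add: w_def algebra_simps)
qed

context iid_tree
begin

lemma measurable_path_prod [measurable]: "(\<lambda>t. path_prod t v) \<in> borel_measurable TP"
proof (induction v)
  case (Cons j u)
  have "(\<lambda>t. path_prod (subtree j t) u) \<in> borel_measurable TP"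
    by (rule measurable_compose[OF measurable_subtree Cons])
  then show ?case by (simp add: borel_measurable_times)
qed simp

text \<open>The martingale property, tested against functions \<open>H\<close> of the vectors below
  level \<open>n\<close>: the vector at each vertex of level \<open>n\<close> is fresh, and its
  components have total mean 1.\<close>

lemma mass_martingale:
  assumes H [measurable]: "H \<in> borel_measurable TP"
    and mean1: "(\<Sum>j\<in>UNIV. \<integral>\<^sup>+x. ennreal (x j) \<partial>\<nu>) = 1"
    and indep: "\<And>u x t. n \<le> length u \<Longrightarrow> H (t(u := x)) = H t"
  shows "(\<integral>\<^sup>+t. H t * ennreal (mass (Suc n) t) \<partial>TP) = (\<integral>\<^sup>+t. H t * ennreal (mass n t) \<partial>TP)"
proof -
  have m1: "(\<integral>\<^sup>+x. (\<Sum>j\<in>UNIV. ennreal (x j)) \<partial>\<nu>) = 1"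
    using mean1 by (simp add: nn_integral_sum)
  have "(\<integral>\<^sup>+t. H t * ennreal (mass (Suc n) t) \<partial>TP) =
      (\<integral>\<^sup>+t. (\<Sum>v\<in>{v. length v = n}. (H t * ennreal (path_prod t v)) * (\<Sum>j\<in>UNIV. ennreal (t v j))) \<partial>TP)"
  proof (rule nn_integral_cong_tree_pos, goal_cases)
    case elim: (1 t)
    have "ennreal (mass (Suc n) t) =
        (\<Sum>v\<in>{v. length v = n}. ennreal (path_prod t v) * (\<Sum>j\<in>UNIV. ennreal (t v j)))"
      unfolding mass_Suc_snoc using elim path_prod_pos[OF elim]
      by (simp add: tree_pos_def less_imp_le ennreal_mult[symmetric] sum_nonneg)
    then show ?case by (simp add: sum_distrib_left mult.assoc)
  qed
  also have "\<dots> = (\<Sum>v\<in>{v. length v = n}. \<integral>\<^sup>+t. (H t * ennreal (path_prod t v)) * (\<Sum>j\<in>UNIV. ennreal (t v j)) \<partial>TP)"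
    by (rule nn_integral_sum) measurable
  also have "\<dots> = (\<Sum>v\<in>{v. length v = n}. \<integral>\<^sup>+t. H t * ennreal (path_prod t v) \<partial>TP)"
  proof (intro sum.cong refl)
    fix v :: "'d list" assume "v \<in> {v. length v = n}"
    then have v: "length v = n" by simp
    have "(\<integral>\<^sup>+t. (H t * ennreal (path_prod t v)) * (\<Sum>j\<in>UNIV. ennreal (t v j)) \<partial>TP) =
        (\<integral>\<^sup>+t. H t * ennreal (path_prod t v) \<partial>TP) * (\<integral>\<^sup>+x. (\<Sum>j\<in>UNIV. ennreal (x j)) \<partial>\<nu>)"
      by (rule nn_integral_resample) (measurable, simp add: indep v path_prod_upd)
    then show "(\<integral>\<^sup>+t. (H t * ennreal (path_prod t v)) * (\<Sum>j\<in>UNIV. ennreal (t v j)) \<partial>TP) =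
        (\<integral>\<^sup>+t. H t * ennreal (path_prod t v) \<partial>TP)"
      by (simp add: m1)
  qed
  also have "\<dots> = (\<integral>\<^sup>+t. (\<Sum>v\<in>{v. length v = n}. H t * ennreal (path_prod t v)) \<partial>TP)"
    by (rule nn_integral_sum[symmetric]) measurable
  also have "\<dots> = (\<integral>\<^sup>+t. H t * ennreal (mass n t) \<partial>TP)"
  proof (rule nn_integral_cong_tree_pos, goal_cases)
    case elim: (1 t)
    then show ?case
      unfolding mass_eq_sum_path_prod
      by (simp add: path_prod_pos less_imp_le sum_distrib_left[symmetric])
  qed
  finally show ?thesis .
qed

lemma nn_integral_mass:
  assumes mean1: "(\<Sum>j\<in>UNIV. \<integral>\<^sup>+x. ennreal (x j) \<partial>\<nu>) = 1"
  shows "(\<integral>\<^sup>+t. ennreal (mass n t) \<partial>TP) = 1"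
proof (induction n)
  case (Suc n)
  then show ?case using mass_martingale[OF _ mean1, of "\<lambda>_. 1" n] by simp
qed (simp add: TP.emeasure_space_1[simplified])

lemma mass_converges:
  assumes mean1: "(\<Sum>j\<in>UNIV. \<integral>\<^sup>+x. ennreal (x j) \<partial>\<nu>) = 1"
  shows "AE t in TP. \<exists>l. (\<lambda>n. mass n t) \<longlonglongrightarrow> l"
proof -
  \<comment> \<open>The convergence lemma asks for nonnegativity everywhere, while
    \<open>mass\<close> is known to be positive on trees with positive ratios.\<close>
  define X where "X n t = max 0 (mass n t)" for n and t :: "'d list \<Rightarrow> 'd \<Rightarrow> real"
  have eX: "ennreal (X n t) = ennreal (mass n t)" for n t
    by (simp add: X_def max_def ennreal_neg)
  have [measurable]: "X n \<in> borel_measurable TP" for n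
    unfolding X_def[abs_def] by measurable
  have int: "integrable TP (X n)" for n
    by (rule integrableI_nn_integral_finite[of _ _ 1])
      (auto simp: eX nn_integral_mass[OF mean1] X_def)
  have "AE t in TP. \<exists>l. (\<lambda>n. X n t) \<longlonglongrightarrow> l"
  proof (rule TP.integrable_supermartingale_converges[OF int])
    fix n A
    assume A [measurable]: "A \<in> sets TP"
      and det: "\<And>t t'. t \<in> space TP \<Longrightarrow> t' \<in> space TP \<Longrightarrow> (\<And>k. k \<le> n \<Longrightarrow> X k t = X k t') \<Longrightarrow> t \<in> A \<longleftrightarrow> t' \<in> A"
    \<comment> \<open>An event decided by the masses up to level \<open>n\<close> ignores the
      vectors at height \<open>n\<close> and above.\<close>
    have ind: "(indicator A (t(u := x)) :: ennreal) = indicator A t" if "n \<le> length u" for u x t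
    proof -
      have "X k (t(u := x)) = X k t" if "k \<le> n" for k
        using mass_upd[of k u t x] that \<open>n \<le> length u\<close> by (simp add: X_def)
      then have "t(u := x) \<in> A \<longleftrightarrow> t \<in> A" using det[of "t(u := x)" t] by simp
      then show ?thesis by (simp add: indicator_def)
    qed
    have conv: "(\<integral>t. indicator A t * X m t \<partial>TP) = enn2real (\<integral>\<^sup>+t. indicator A t * ennreal (mass m t) \<partial>TP)" for m
    proof -
      have "(\<integral>t. indicator A t * X m t \<partial>TP) = enn2real (\<integral>\<^sup>+t. ennreal (indicator A t * X m t) \<partial>TP)"
        by (rule integral_eq_nn_integral) (auto simp: X_def)
      also have "(\<integral>\<^sup>+t. ennreal (indicator A t * X m t) \<partial>TP) = (\<integral>\<^sup>+t. indicator A t * ennreal (mass m t) \<partial>TP)"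
        by (intro nn_integral_cong) (auto simp: indicator_def eX)
      finally show ?thesis .
    qed
    have "(\<integral>\<^sup>+t. indicator A t * ennreal (mass (Suc n) t) \<partial>TP) = (\<integral>\<^sup>+t. indicator A t * ennreal (mass n t) \<partial>TP)"
      by (rule mass_martingale[OF _ mean1 ind]) measurable
    then show "(\<integral>t. indicator A t * X (Suc n) t \<partial>TP) \<le> (\<integral>t. indicator A t * X n t \<partial>TP)"
      unfolding conv by simp
  qed (simp add: X_def)
  with AE_tree_pos show ?thesis
  proof eventually_elim
    case (elim t)
    have "X n t = mass n t" for n using mass_pos[OF elim(1), of n] by (simp add: X_def)
    then show ?case using elim(2) by simp
  qed
qed

text \<open>Jensen's inequality for the martingale: the tangent of the power at
  \<open>mass n\<close> is tested with the weight \<open>mass n powr (h - 1)\<close>, a function of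
  the earlier levels.\<close>

lemma nn_integral_mass_powr_decreasing:
  assumes mean1: "(\<Sum>j\<in>UNIV. \<integral>\<^sup>+x. ennreal (x j) \<partial>\<nu>) = 1" and h: "0 \<le> h" "h \<le> 1"
  shows "(\<integral>\<^sup>+t. ennreal (mass (Suc n) t powr h) \<partial>TP) \<le> (\<integral>\<^sup>+t. ennreal (mass n t powr h) \<partial>TP)"
proof -
  let ?M = "\<integral>\<^sup>+t. ennreal (mass n t powr h) \<partial>TP"
  have "(\<integral>\<^sup>+t. ennreal (mass (Suc n) t powr h) \<partial>TP) \<le>
      (\<integral>\<^sup>+t. ennreal (1 - h) * ennreal (mass n t powr h) +
        ennreal h * (ennreal (mass n t powr (h - 1)) * ennreal (mass (Suc n) t)) \<partial>TP)"
  proof (rule nn_integral_mono_tree_pos, goal_cases)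
    case elim: (1 t)
    note p = mass_pos[OF elim, of n] mass_pos[OF elim, of "Suc n"]
    show ?case
      using powr_le_tangent[OF p(2) p(1) h] h p
      by (simp add: ennreal_mult[symmetric] ennreal_plus[symmetric] ennreal_leI less_imp_le
          del: ennreal_plus mass.simps)
  qed
  also have "\<dots> = ennreal (1 - h) * ?M +
      ennreal h * (\<integral>\<^sup>+t. ennreal (mass n t powr (h - 1)) * ennreal (mass (Suc n) t) \<partial>TP)"
    by (simp add: nn_integral_add nn_integral_cmult del: mass.simps)
  also have "(\<integral>\<^sup>+t. ennreal (mass n t powr (h - 1)) * ennreal (mass (Suc n) t) \<partial>TP) =
      (\<integral>\<^sup>+t. ennreal (mass n t powr (h - 1)) * ennreal (mass n t) \<partial>TP)"
    by (rule mass_martingale[OF _ mean1]) (measurable, simp add: mass_upd)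
  also have "\<dots> = ?M"
  proof (rule nn_integral_cong_tree_pos, goal_cases)
    case elim: (1 t)
    have p: "mass n t > 0" by (rule mass_pos[OF elim])
    then show ?case
      using powr_mult_base[of "mass n t" "h - 1"] by (simp add: ennreal_mult[symmetric] mult.commute)
  qed
  also have "ennreal (1 - h) * ?M + ennreal h * ?M = ?M"
    using h by (simp add: distrib_right[symmetric] ennreal_plus[symmetric] del: ennreal_plus)
  finally show ?thesis .
qed

text \<open>The pointwise inequality is applied to the terms of the recursion. Independence of root
  and subtree produces the moment sum on the left, and monotonicity replaces the next level's moment
  by the present one. The constant 12 is 4 from the pointwise inequality times the bound 3 on mixed
  moments.\<close>

lemma kahane_peyriere_step:
  assumes mean1: "(\<Sum>j\<in>UNIV. \<integral>\<^sup>+x. ennreal (x j) \<partial>\<nu>) = 1" and h: "1/2 \<le> h" "h < 1"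
  shows "(\<Sum>j\<in>UNIV. \<integral>\<^sup>+x. ennreal (x j powr h) \<partial>\<nu>) * (\<integral>\<^sup>+t. ennreal (mass n t powr h) \<partial>TP) \<le>
    (\<integral>\<^sup>+t. ennreal (mass n t powr h) \<partial>TP) +
    ennreal (12 * (1 - h) * (real CARD('d))\<^sup>2) * (\<integral>\<^sup>+t. ennreal (mass n t powr (h/2)) \<partial>TP)\<^sup>2"
proof -
  define a where "a j t = t [] j * mass n (subtree j t)" for j and t :: "'d list \<Rightarrow> 'd \<Rightarrow> real"
  let ?M = "\<lambda>h. \<integral>\<^sup>+t. ennreal (mass n t powr h) \<partial>TP"
  have am [measurable]: "a j \<in> borel_measurable TP" for j
  proof -
    have "(\<lambda>t. mass n (subtree j t)) \<in> borel_measurable TP"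
      by (rule measurable_compose[OF measurable_subtree measurable_mass])
    then show ?thesis unfolding a_def[abs_def] by measurable
  qed
  have apos: "a j t > 0" if "tree_pos t" for j t
    using that mass_pos[OF tree_pos_subtree[OF that]] by (simp add: a_def tree_pos_def)
  have apowr: "a j t powr q = t [] j powr q * mass n (subtree j t) powr q" if "tree_pos t" for j t q
    using that mass_pos[OF tree_pos_subtree[OF that], of n j]
    by (simp add: a_def tree_pos_def powr_mult less_imp_le)
  have lhs: "(\<integral>\<^sup>+t. ennreal (a j t powr h) \<partial>TP) = (\<integral>\<^sup>+x. ennreal (x j powr h) \<partial>\<nu>) * ?M h" for j
  proof -
    have "(\<integral>\<^sup>+t. ennreal (a j t powr h) \<partial>TP) =
        (\<integral>\<^sup>+t. ennreal (t [] j powr h) * ennreal (mass n (subtree j t) powr h) \<partial>TP)"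
      using AE_tree_pos by (intro nn_integral_cong_AE, eventually_elim) (simp add: apowr ennreal_mult)
    also have "\<dots> = (\<integral>\<^sup>+x. ennreal (x j powr h) \<partial>\<nu>) * ?M h"
      by (rule nn_integral_root_subtree[where F = "\<lambda>x. ennreal (x j powr h)" and G = "\<lambda>t. ennreal (mass n t powr h)"])
        measurable
    finally show ?thesis .
  qed
  have mean_le: "(\<integral>\<^sup>+x. ennreal (x j) \<partial>\<nu>) \<le> 1" for j
    using member_le_sum[of j UNIV "\<lambda>j. \<integral>\<^sup>+x. ennreal (x j) \<partial>\<nu>"] mean1 by simp
  \<comment> \<open>Components of one vector may be dependent, so their product is bounded by
    \<open>1 + x i + x j\<close>, whose mean is at most 3.\<close>
  have three: "(\<integral>\<^sup>+x. ennreal (x i powr (h/2) * x j powr (h/2)) \<partial>\<nu>) \<le> 3" for i j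
  proof -
    have "(\<integral>\<^sup>+x. ennreal (x i powr (h/2) * x j powr (h/2)) \<partial>\<nu>) \<le> (\<integral>\<^sup>+x. 1 + (ennreal (x i) + ennreal (x j)) \<partial>\<nu>)"
    proof (rule nn_integral_mono_AE)
      show "AE x in \<nu>. ennreal (x i powr (h/2) * x j powr (h/2)) \<le> 1 + (ennreal (x i) + ennreal (x j))"
        using nu_pos
      proof eventually_elim
        case (elim x)
        define z where "z = max 1 (max (x i) (x j))"
        have z: "z \<ge> 1" "x i \<le> z" "x j \<le> z" by (auto simp: z_def)
        have "x i powr (h/2) * x j powr (h/2) \<le> z powr (h/2) * z powr (h/2)"
          using elim h z by (intro mult_mono powr_mono2) (auto simp: less_imp_le)
        also have "\<dots> = z powr h" by (simp add: powr_add[symmetric])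
        also have "\<dots> \<le> z powr 1" using z h by (intro powr_mono) auto
        also have "\<dots> \<le> 1 + (x i + x j)" using elim[rule_format, of i] elim[rule_format, of j] by (auto simp: z_def max_def)
        finally have "ennreal (x i powr (h/2) * x j powr (h/2)) \<le> ennreal (1 + (x i + x j))"
          by (rule ennreal_leI)
        also have "\<dots> = 1 + (ennreal (x i) + ennreal (x j))"
          using elim[rule_format, of i] elim[rule_format, of j] by (simp add: ennreal_plus less_imp_le)
        finally show ?case .
      qed
    qed
    also have "\<dots> = 1 + ((\<integral>\<^sup>+x. ennreal (x i) \<partial>\<nu>) + (\<integral>\<^sup>+x. ennreal (x j) \<partial>\<nu>))"
      by (simp add: nn_integral_add emeasure_space_1[simplified])
    also have "\<dots> \<le> 1 + (1 + 1)" by (intro add_mono mean_le order_refl)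
    finally show ?thesis by simp
  qed
  have pair: "(\<integral>\<^sup>+t. ennreal (a i t powr (h/2) * a j t powr (h/2)) \<partial>TP) \<le> 3 * (?M (h/2))\<^sup>2" if "i \<noteq> j" for i j
  proof -
    have "(\<integral>\<^sup>+t. ennreal (a i t powr (h/2) * a j t powr (h/2)) \<partial>TP) =
        (\<integral>\<^sup>+t. ennreal (t [] i powr (h/2) * t [] j powr (h/2)) *
          (ennreal (mass n (subtree i t) powr (h/2)) * ennreal (mass n (subtree j t) powr (h/2))) \<partial>TP)"
      using AE_tree_pos
      by (intro nn_integral_cong_AE, eventually_elim) (simp add: apowr ennreal_mult[symmetric] mult_ac)
    also have "\<dots> = (\<integral>\<^sup>+x. ennreal (x i powr (h/2) * x j powr (h/2)) \<partial>\<nu>) * (?M (h/2))\<^sup>2"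
      by (rule nn_integral_root_subtree_pair[OF that, where F = "\<lambda>x. ennreal (x i powr (h/2) * x j powr (h/2))"
          and G = "\<lambda>t. ennreal (mass n t powr (h/2))"]) measurable
    also have "\<dots> \<le> 3 * (?M (h/2))\<^sup>2" by (intro mult_right_mono three) simp
    finally show ?thesis .
  qed
  have "(\<Sum>j\<in>UNIV. \<integral>\<^sup>+x. ennreal (x j powr h) \<partial>\<nu>) * ?M h = (\<integral>\<^sup>+t. (\<Sum>j\<in>UNIV. ennreal (a j t powr h)) \<partial>TP)"
    by (simp add: nn_integral_sum lhs sum_distrib_right del: sum_ennreal)
  also have "\<dots> \<le> (\<integral>\<^sup>+t. ennreal (mass (Suc n) t powr h) + ennreal (4 * (1 - h)) *
      (\<Sum>i\<in>UNIV. \<Sum>j\<in>UNIV - {i}. ennreal (a i t powr (h/2) * a j t powr (h/2))) \<partial>TP)"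
  proof (rule nn_integral_mono_tree_pos, goal_cases)
    case elim: (1 t)
    have "(\<Sum>j\<in>UNIV. a j t powr h) \<le> mass (Suc n) t powr h +
        4 * (1 - h) * (\<Sum>i\<in>UNIV. \<Sum>j\<in>UNIV - {i}. a i t powr (h/2) * a j t powr (h/2))"
      using kahane_peyriere_inequality[of UNIV "\<lambda>j. a j t" h] apos[OF elim] h by (simp add: a_def)
    then show ?case
      using h by (simp add: ennreal_mult[symmetric] ennreal_plus[symmetric] sum_nonneg ennreal_leI
          del: ennreal_plus mass.simps)
  qed
  also have "\<dots> = (\<integral>\<^sup>+t. ennreal (mass (Suc n) t powr h) \<partial>TP) + ennreal (4 * (1 - h)) *
      (\<Sum>i\<in>UNIV. \<Sum>j\<in>UNIV - {i}. \<integral>\<^sup>+t. ennreal (a i t powr (h/2) * a j t powr (h/2)) \<partial>TP)"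
    by (simp add: nn_integral_add nn_integral_cmult nn_integral_sum del: mass.simps sum_ennreal)
  also have "\<dots> \<le> ?M h + ennreal (4 * (1 - h)) * (\<Sum>i\<in>(UNIV :: 'd set). \<Sum>j\<in>(UNIV :: 'd set). 3 * (?M (h/2))\<^sup>2)"
  proof (intro add_mono mult_left_mono sum_mono nn_integral_mass_powr_decreasing[OF mean1])
    fix i :: 'd
    have "(\<Sum>j\<in>UNIV - {i}. \<integral>\<^sup>+t. ennreal (a i t powr (h/2) * a j t powr (h/2)) \<partial>TP) \<le>
        (\<Sum>j\<in>UNIV - {i}. 3 * (?M (h/2))\<^sup>2)"
      by (intro sum_mono pair) auto
    also have "\<dots> \<le> (\<Sum>j\<in>(UNIV :: 'd set). 3 * (?M (h/2))\<^sup>2)"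
      by (intro sum_mono2) auto
    finally show "(\<Sum>j\<in>UNIV - {i}. \<integral>\<^sup>+t. ennreal (a i t powr (h/2) * a j t powr (h/2)) \<partial>TP) \<le> \<dots>" .
  qed (use h in auto)
  also have "ennreal (4 * (1 - h)) * (\<Sum>i\<in>(UNIV :: 'd set). \<Sum>j\<in>(UNIV :: 'd set). 3 * (?M (h/2))\<^sup>2) =
      ennreal (12 * (1 - h) * (real CARD('d))\<^sup>2) * (?M (h/2))\<^sup>2"
  proof -
    have "ennreal (12 * (1 - h) * (real CARD('d))\<^sup>2) =
        ennreal (4 * (1 - h)) * (of_nat CARD('d) * (of_nat CARD('d) * 3))"
    proof -
      have "12 * (1 - h) * (real CARD('d))\<^sup>2 = 4 * (1 - h) * (real CARD('d) * (real CARD('d) * 3))"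
        by (simp add: power2_eq_square)
      then show ?thesis using h by (simp add: ennreal_mult ennreal_of_nat_eq_real_of_nat)
    qed
    then show ?thesis by (simp add: mult.assoc)
  qed
  finally show ?thesis .
qed

text \<open>In the preceding inequality the moment of order \<open>h\<close> cancels up to its
  multiple by \<open>\<delta> * (1 - h)\<close>. Division by \<open>1 - h\<close> and the limit at
  \<open>h = 1\<close> leave the mean 1 of the mass against the square of its moment of order
  1/2.\<close>

lemma sqrt_mass_bounded_below:
  assumes mean1: "(\<Sum>j\<in>UNIV. \<integral>\<^sup>+x. ennreal (x j) \<partial>\<nu>) = 1"
    and \<delta>: "\<delta> > 0" and h0: "h0 < 1"
    and f: "\<And>h. h0 < h \<Longrightarrow> h < 1 \<Longrightarrow> ennreal (1 + \<delta> * (1 - h)) \<le> (\<Sum>j\<in>UNIV. \<integral>\<^sup>+x. ennreal (x j powr h) \<partial>\<nu>)"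
  shows "ennreal (\<delta> / (12 * (real CARD('d))\<^sup>2)) \<le> (\<integral>\<^sup>+t. ennreal (mass n t powr (1/2)) \<partial>TP)\<^sup>2"
proof -
  define C where "C = 12 * (real CARD('d))\<^sup>2"
  have C: "C > 0" by (simp add: C_def)
  \<comment> \<open>Exponents that increase to 1; the shift by 2 makes them start at 1/2, where the
    pointwise inequality begins to hold.\<close>
  define h where "h k = 1 - 1 / (real k + 2)" for k
  have hlim: "h \<longlonglongrightarrow> 1"
  proof -
    have "(\<lambda>k. 1 / (real k + 2)) \<longlonglongrightarrow> 0"
      using LIMSEQ_ignore_initial_segment[OF lim_1_over_n, of 2] by (simp add: add.commute)
    then have "(\<lambda>k. 1 - 1 / (real k + 2)) \<longlonglongrightarrow> 1 - 0" by (intro tendsto_intros)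
    then show ?thesis by (simp add: h_def[abs_def])
  qed
  have h: "1/2 \<le> h k" "h k < 1" for k by (auto simp: h_def field_simps)
  let ?M = "\<lambda>q. \<integral>\<^sup>+t. ennreal (mass n t powr q) \<partial>TP"
  have lim: "(\<lambda>k. ?M (q k)) \<longlonglongrightarrow> ?M l" if "q \<longlonglongrightarrow> l" "\<And>k. 0 \<le> q k \<and> q k \<le> 1" for q l
  proof (rule nn_integral_dominated_convergence[where w = "\<lambda>t. 1 + ennreal (mass n t)"])
    show "(\<integral>\<^sup>+t. 1 + ennreal (mass n t) \<partial>TP) < \<infinity>"
      by (simp add: nn_integral_add nn_integral_mass[OF mean1] TP.emeasure_space_1[simplified])
    show "AE t in TP. ennreal (mass n t powr q k) \<le> 1 + ennreal (mass n t)" for k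
      using AE_tree_pos
    proof eventually_elim
      case (elim t)
      have p: "mass n t > 0" by (rule mass_pos[OF elim])
      have "mass n t powr q k \<le> 1 + mass n t"
        using powr_le_one_plus[OF p] that(2)[of k] by simp
      then have "ennreal (mass n t powr q k) \<le> ennreal (1 + mass n t)" by (rule ennreal_leI)
      then show ?case using p by simp
    qed
    show "AE t in TP. (\<lambda>k. ennreal (mass n t powr q k)) \<longlonglongrightarrow> ennreal (mass n t powr l)"
      using AE_tree_pos
    proof eventually_elim
      case (elim t)
      have p: "mass n t > 0" by (rule mass_pos[OF elim])
      then show ?case
        by (intro tendsto_ennrealI tendsto_powr tendsto_const that(1)) auto
    qed
  qed measurable
  have M1: "?M 1 = 1"
  proof -
    have "?M 1 = (\<integral>\<^sup>+t. ennreal (mass n t) \<partial>TP)"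
      using AE_tree_pos by (intro nn_integral_cong_AE, eventually_elim) (simp add: abs_of_pos[OF mass_pos])
    then show ?thesis by (simp add: nn_integral_mass[OF mean1])
  qed
  \<comment> \<open>The tangent at 1 gives finiteness, so that the inequality can be read in the
    reals and the common moment cancelled.\<close>
  have fin: "?M q \<le> 2" if "0 \<le> q" "q \<le> 1" for q
  proof -
    have "?M q \<le> (\<integral>\<^sup>+t. ennreal (1 - q) * ennreal (1 powr q) + ennreal q * (ennreal (1 powr (q - 1)) * ennreal (mass n t)) \<partial>TP)"
    proof (rule nn_integral_mono_tree_pos, goal_cases)
      case elim: (1 t)
      have p: "mass n t > 0" by (rule mass_pos[OF elim])
      show ?case
        using powr_le_tangent[OF p zero_less_one that] that p
        by (simp add: ennreal_mult[symmetric] ennreal_plus[symmetric] ennreal_leI less_imp_le del: ennreal_plus)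
    qed
    also have "\<dots> = ennreal (1 - q) + ennreal q"
      by (simp add: nn_integral_add nn_integral_cmult nn_integral_mass[OF mean1] TP.emeasure_space_1[simplified])
    also have "\<dots> = 1" using that by (simp add: ennreal_plus[symmetric] del: ennreal_plus)
    also have "(1 :: ennreal) \<le> 2" by simp
    finally show ?thesis .
  qed
  have step: "ennreal \<delta> * ?M (h k) \<le> ennreal C * (?M (h k / 2))\<^sup>2" if "h0 < h k" for k
  proof -
    have "h k \<le> 1" "0 \<le> h k" "0 \<le> h k / 2" "h k / 2 \<le> 1" using h[of k] by auto
    then obtain x y where x: "?M (h k) = ennreal x" "x \<ge> 0" and y: "?M (h k / 2) = ennreal y" "y \<ge> 0"
      using fin[of "h k"] fin[of "h k / 2"]
      by (cases "?M (h k)"; cases "?M (h k / 2)") (auto simp: top_unique)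
    have "ennreal (1 + \<delta> * (1 - h k)) * ?M (h k) \<le> ?M (h k) + ennreal (12 * (1 - h k) * (real CARD('d))\<^sup>2) * (?M (h k / 2))\<^sup>2"
      using kahane_peyriere_step[OF mean1 h, of k n] f[OF that h(2)]
      by (meson mult_right_mono order_trans zero_le)
    then have "ennreal ((1 + \<delta> * (1 - h k)) * x) \<le> ennreal (x + 12 * (1 - h k) * (real CARD('d))\<^sup>2 * y\<^sup>2)"
      unfolding x y using x y h[of k] \<delta>
      by (simp add: ennreal_mult[symmetric] ennreal_power ennreal_plus[symmetric] del: ennreal_plus)
    then have "(1 + \<delta> * (1 - h k)) * x \<le> x + 12 * (1 - h k) * (real CARD('d))\<^sup>2 * y\<^sup>2"
      using x y h[of k] by (subst (asm) ennreal_le_iff) (auto intro!: add_nonneg_nonneg mult_nonneg_nonneg)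
    then have "(1 - h k) * (\<delta> * x) \<le> (1 - h k) * (C * y\<^sup>2)"
      by (simp add: C_def algebra_simps)
    then have "\<delta> * x \<le> C * y\<^sup>2" using h[of k] by simp
    then show ?thesis
      unfolding x y using x y C \<delta> by (simp add: ennreal_mult[symmetric] ennreal_power ennreal_leI)
  qed
  have l1: "(\<lambda>k. ennreal \<delta> * ?M (h k)) \<longlonglongrightarrow> ennreal \<delta> * ?M 1"
    using h by (intro ennreal_tendsto_cmult lim hlim) (auto simp: less_imp_le intro: order_trans[of 0 "1/2"])
  have l2: "(\<lambda>k. ennreal C * (?M (h k / 2))\<^sup>2) \<longlonglongrightarrow> ennreal C * (?M (1 / 2))\<^sup>2"
  proof -
    have hh: "0 \<le> h k / 2 \<and> h k / 2 \<le> 1" for k using h[of k] by auto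
    have "(\<lambda>k. ?M (h k / 2)) \<longlonglongrightarrow> ?M (1 / 2)"
      by (rule lim) (use hh in \<open>auto intro!: tendsto_divide hlim\<close>)
    moreover have "?M (1 / 2) \<noteq> \<infinity>" using fin[of "1/2"] by (auto simp: top_unique)
    ultimately have "(\<lambda>k. ?M (h k / 2) * ?M (h k / 2)) \<longlonglongrightarrow> ?M (1/2) * ?M (1/2)"
      by (intro tendsto_mult_ennreal) auto
    then show ?thesis
      unfolding power2_eq_square by (intro ennreal_tendsto_cmult) auto
  qed
  have "eventually (\<lambda>k. h0 < h k) sequentially" by (rule order_tendstoD(1)[OF hlim h0])
  then have "eventually (\<lambda>k. ennreal \<delta> * ?M (h k) \<le> ennreal C * (?M (h k / 2))\<^sup>2) sequentially"
    by eventually_elim (rule step)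
  then have "ennreal \<delta> * ?M 1 \<le> ennreal C * (?M (1 / 2))\<^sup>2"
    by (rule tendsto_le[OF sequentially_bot l2 l1])
  then have "ennreal \<delta> \<le> ennreal C * (?M (1 / 2))\<^sup>2"
    unfolding M1 by simp
  moreover obtain s where s: "?M (1/2) = ennreal s" "s \<ge> 0"
    using fin[of "1/2"] by (cases "?M (1/2)") (auto simp: top_unique)
  ultimately have "ennreal \<delta> \<le> ennreal (C * s\<^sup>2)"
    using C by (simp add: ennreal_mult[symmetric] ennreal_power)
  then have "\<delta> \<le> C * s\<^sup>2" using C by (subst (asm) ennreal_le_iff) auto
  then have "\<delta> / C \<le> s\<^sup>2" using C by (simp add: pos_divide_le_eq mult.commute)
  then show ?thesis using s by (simp add: C_def[symmetric] ennreal_power ennreal_leI)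
qed

text \<open>Square roots of masses of mean 1 are uniformly integrable, so their lower bound in mean
  is incompatible with almost sure convergence to 0; the zero-one law then removes the event of a
  zero limit.\<close>

lemma mass_limit_pos:
  assumes mean1: "(\<Sum>j\<in>UNIV. \<integral>\<^sup>+x. ennreal (x j) \<partial>\<nu>) = 1"
    and \<delta>: "\<delta> > 0" and h0: "h0 < 1"
    and f: "\<And>h. h0 < h \<Longrightarrow> h < 1 \<Longrightarrow> ennreal (1 + \<delta> * (1 - h)) \<le> (\<Sum>j\<in>UNIV. \<integral>\<^sup>+x. ennreal (x j powr h) \<partial>\<nu>)"
    and d2: "CARD('d) \<ge> 2"
  shows "AE t in TP. \<exists>l>0. (\<lambda>n. mass n t) \<longlonglongrightarrow> l"
proof -
  define \<sigma> where "\<sigma> = sqrt (\<delta> / (12 * (real CARD('d))\<^sup>2))"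
  have \<sigma>: "\<sigma> > 0" using \<delta> by (simp add: \<sigma>_def)
  have ge: "ennreal \<sigma> \<le> (\<integral>\<^sup>+t. ennreal (mass n t powr (1/2)) \<partial>TP)" for n
  proof (cases "\<integral>\<^sup>+t. ennreal (mass n t powr (1/2)) \<partial>TP")
    case (real s)
    have "ennreal (\<sigma>\<^sup>2) \<le> ennreal (s\<^sup>2)"
      using sqrt_mass_bounded_below[OF mean1 \<delta> h0 f, of n] real \<delta> by (simp add: \<sigma>_def ennreal_power)
    then have "\<sigma>\<^sup>2 \<le> s\<^sup>2" by simp
    then have "\<sigma> \<le> s" using real by (rule_tac power2_le_imp_le) auto
    then show ?thesis using real by (simp add: ennreal_leI)
  qed simp
  \<comment> \<open>From \<open>s \<le> min s K + s\<^sup>2 / K\<close> with \<open>s\<close> the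
    square root of the mass, whose square has mean 1: this \<open>K\<close> loses half of
    \<open>\<sigma>\<close>.\<close>
  define K where "K = 2 / \<sigma>"
  have K: "K > 0" using \<sigma> by (simp add: K_def)
  have min_ge: "ennreal (\<sigma> / 2) \<le> (\<integral>\<^sup>+t. ennreal (min (mass n t powr (1/2)) K) \<partial>TP)" for n
  proof -
    have "(\<integral>\<^sup>+t. ennreal (mass n t powr (1/2)) \<partial>TP) \<le>
        (\<integral>\<^sup>+t. ennreal (min (mass n t powr (1/2)) K) + ennreal (1 / K) * ennreal (mass n t) \<partial>TP)"
    proof (rule nn_integral_mono_tree_pos, goal_cases)
      case elim: (1 t)
      have p: "mass n t > 0" by (rule mass_pos[OF elim])
      define s where "s = mass n t powr (1/2)"
      have s: "s > 0" "s * s = mass n t"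
        using p by (auto simp: s_def powr_add[symmetric])
      have "s \<le> min s K + (1 / K) * (s * s)"
      proof (cases "s \<le> K")
        case False
        then have "s * 1 \<le> s * (s / K)" using s K by (intro mult_left_mono) auto
        then show ?thesis using False K by simp
      qed (use s K p in auto)
      then show ?case
        using s K p by (simp add: s_def[symmetric] ennreal_mult[symmetric] ennreal_plus[symmetric] ennreal_leI less_imp_le
            del: ennreal_plus)
    qed
    also have "\<dots> = (\<integral>\<^sup>+t. ennreal (min (mass n t powr (1/2)) K) \<partial>TP) + ennreal (\<sigma> / 2)"
      by (simp add: nn_integral_add nn_integral_cmult nn_integral_mass[OF mean1] K_def)
    finally have le: "ennreal \<sigma> \<le> (\<integral>\<^sup>+t. ennreal (min (mass n t powr (1/2)) K) \<partial>TP) + ennreal (\<sigma> / 2)"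
      using ge[of n] by (rule order_trans[rotated])
    show ?thesis
    proof (cases "\<integral>\<^sup>+t. ennreal (min (mass n t powr (1/2)) K) \<partial>TP")
      case (real a)
      then have "ennreal \<sigma> \<le> ennreal (a + \<sigma> / 2)" using le \<sigma> by simp
      then have "\<sigma> \<le> a + \<sigma> / 2" using real \<sigma> by (subst (asm) ennreal_le_iff) auto
      then have "\<sigma> / 2 \<le> a" by simp
      then show ?thesis using real by (simp add: ennreal_leI)
    qed simp
  qed
  \<comment> \<open>The upper limit makes the event measurable at once; on positive trees it means
    convergence to 0.\<close>
  define Z where "Z = {t :: 'd list \<Rightarrow> 'd \<Rightarrow> real. limsup (\<lambda>n. ennreal (mass n t)) = 0}"
  have Z: "Z \<in> sets TP"
  proof -
    have "{t \<in> space TP. limsup (\<lambda>n. ennreal (mass n t)) = 0} \<in> sets TP" by measurable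
    then show ?thesis by (simp add: Z_def)
  qed
  have Z_iff: "t \<in> Z \<longleftrightarrow> (\<lambda>n. mass n t) \<longlonglongrightarrow> 0" if "tree_pos t" for t
  proof -
    have "t \<in> Z \<longleftrightarrow> (\<lambda>n. ennreal (mass n t)) \<longlonglongrightarrow> ennreal 0"
      unfolding Z_def ennreal_0 mem_Collect_eq
      using tendsto_0_if_Limsup_eq_0_ennreal lim_imp_Limsup[OF sequentially_bot] by blast
    also have "\<dots> \<longleftrightarrow> (\<lambda>n. mass n t) \<longlonglongrightarrow> 0"
      using mass_pos[OF that]
      by (intro iffI tendsto_ennrealI) (auto intro!: tendsto_ennrealD simp: less_imp_le)
    finally show ?thesis .
  qed
  have sub: "subtree j t \<in> Z" if t: "tree_pos t" "t \<in> Z" for j t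
  proof -
    have tj: "t [] j > 0" using t by (simp add: tree_pos_def)
    have "(\<lambda>n. mass (Suc n) t) \<longlonglongrightarrow> 0"
      using LIMSEQ_Suc t by (simp add: Z_iff del: mass.simps)
    then have "(\<lambda>n. mass (Suc n) t / t [] j) \<longlonglongrightarrow> 0 / t [] j"
      by (intro tendsto_divide tendsto_const) (use tj in auto)
    then have lim: "(\<lambda>n. mass (Suc n) t / t [] j) \<longlonglongrightarrow> 0"
      by (simp del: mass.simps)
    have le: "mass n (subtree j t) \<le> mass (Suc n) t / t [] j" for n
    proof -
      have "t [] j * mass n (subtree j t) \<le> mass (Suc n) t"
        unfolding mass.simps using t mass_pos[OF tree_pos_subtree[OF t(1)]]
        by (intro member_le_sum[of j UNIV "\<lambda>j. t [] j * mass n (subtree j t)"])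
          (auto simp: tree_pos_def less_imp_le)
      then show ?thesis using tj by (simp add: pos_le_divide_eq mult.commute del: mass.simps)
    qed
    have "(\<lambda>n. mass n (subtree j t)) \<longlonglongrightarrow> 0"
      by (rule tendsto_sandwich[OF _ _ tendsto_const lim])
        (use le mass_pos[OF tree_pos_subtree[OF t(1)]] in \<open>auto simp: less_imp_le simp del: mass.simps\<close>)
    then show ?thesis using Z_iff[OF tree_pos_subtree[OF t(1)]] by simp
  qed
  obtain i j :: 'd where ij: "i \<noteq> j"
    using d2 by (metis One_nat_def card_le_Suc0_iff_eq finite numeral_2_eq_2 not_less_eq_eq UNIV_I)
  have "AE t in TP. t \<notin> Z"
  proof (rule zero_one_law[OF Z ij])
    show "AE t in TP. t \<in> Z \<longrightarrow> subtree i t \<in> Z \<and> subtree j t \<in> Z"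
      using AE_tree_pos by eventually_elim (auto intro: sub)
    show "emeasure TP Z < 1"
    proof (rule ccontr)
      assume "\<not> emeasure TP Z < 1"
      then have "emeasure TP Z = 1"
        by (metis TP.emeasure_le_1 order_le_less)
      then have "AE t in TP. t \<in> Z"
        using Z TP.AE_in_set_eq_1[OF Z] by (simp add: TP.emeasure_eq_measure)
      with AE_tree_pos have z: "AE t in TP. (\<lambda>n. mass n t) \<longlonglongrightarrow> 0"
        by eventually_elim (simp add: Z_iff)
      have "(\<lambda>n. \<integral>\<^sup>+t. ennreal (min (mass n t powr (1/2)) K) \<partial>TP) \<longlonglongrightarrow> (\<integral>\<^sup>+t. 0 \<partial>TP)"
      proof (rule nn_integral_dominated_convergence[where w = "\<lambda>_. ennreal K"])
        show "AE t in TP. (\<lambda>n. ennreal (min (mass n t powr (1/2)) K)) \<longlonglongrightarrow> 0"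
          using z AE_tree_pos
        proof eventually_elim
          case (elim t)
          have "(\<lambda>n. mass n t powr (1/2)) \<longlonglongrightarrow> 0 powr (1/2)"
            using elim(1) mass_pos[OF elim(2)] by (intro tendsto_powr') (auto simp: less_imp_le)
          then have "(\<lambda>n. min (mass n t powr (1/2)) K) \<longlonglongrightarrow> min 0 K"
            by (intro tendsto_min) auto
          then have "(\<lambda>n. ennreal (min (mass n t powr (1/2)) K)) \<longlonglongrightarrow> ennreal 0"
            using K by (intro tendsto_ennrealI) (simp add: min_def)
          then show ?case by simp
        qed
      qed (auto simp: TP.emeasure_space_1[simplified] intro!: ennreal_leI)
      then have "ennreal (\<sigma> / 2) \<le> (\<integral>\<^sup>+t. 0 \<partial>TP)"
        by (rule LIMSEQ_le_const) (use min_ge in blast)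
      then show False using \<sigma> by simp
    qed
  qed
  with AE_tree_pos mass_converges[OF mean1] show ?thesis
  proof eventually_elim
    case (elim t)
    then obtain l where l: "(\<lambda>n. mass n t) \<longlonglongrightarrow> l" by blast
    have "l \<ge> 0" by (rule LIMSEQ_le_const[OF l]) (use mass_pos[OF elim(1)] less_imp_le in blast)
    moreover have "l \<noteq> 0" using elim(3) l Z_iff[OF elim(1)] by auto
    ultimately show ?case using l by (intro exI[of _ l]) auto
  qed
qed

end

section \<open>The random environment\<close>

lemma ergodic_if_summable_chaos:
  assumes w: "env_ok w" and s: "summable (chaos w)"
  shows "ergodic (tree_kernel w)"
  by (rule ergodic_if_finite_invariant[where \<pi> = "\<lambda>v. ennreal (rev_measure w v)"])
    (simp_all add: rev_measure_pos[OF w] rev_measure_invariant[OF w]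
      rev_measure_finite[OF w s, simplified])

lemma null_recurrent_if_chaos_converges:
  assumes w: "env_ok w" and lim: "chaos w \<longlonglongrightarrow> y" and y: "y \<noteq> 0"
  shows "null_recurrent (tree_kernel w)"
proof (rule null_recurrent_if_infinite_invariant[where \<pi> = "\<lambda>v. ennreal (rev_measure w v)"])
  have "\<not> summable (chaos w)"
    using LIMSEQ_unique[OF lim] summable_LIMSEQ_zero y by blast
  then show "(\<integral>\<^sup>+v. ennreal (rev_measure w v) \<partial>count_space UNIV) = \<infinity>"
    by (rule rev_measure_infinite[OF w])
  show "(a, b) \<in> (step_rel (tree_kernel w))\<^sup>*" for a b
    by (rule tree_kernel_irreducible[OF w])
  have "Bseq (chaos w)" using lim by (intro convergent_imp_Bseq convergentI)
  then show "hit_ever (tree_kernel w) [] [] = 1"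
    by (intro root_recurrent[OF w] esc_eq_0_if_chaos_bounded[OF w])
qed (simp_all add: rev_measure_invariant[OF w])

lemma transient_if_esc_pos:
  assumes w: "env_ok w" and pos: "esc w [j] > 0"
  shows "transient (tree_kernel w)"
proof (rule transient_if_transient_state)
  show "(a, b) \<in> (step_rel (tree_kernel w))\<^sup>*" for a b
    by (rule tree_kernel_irreducible[OF w])
  show "hit_ever (tree_kernel w) [] [] < 1" by (rule root_transient[OF w pos])
qed

lemma chaos_sum_to_infinity:
  assumes w: "env_ok w" and ns: "\<not> summable (chaos w)"
  shows "(\<lambda>n. ereal (chaos_sum w n)) \<longlonglongrightarrow> \<infinity>"
proof -
  have "incseq (\<lambda>n. ereal (chaos_sum w n))"
    using chaos_pos[OF w] by (intro incseq_SucI) (simp add: chaos_sum_def less_imp_le)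
  then have lim: "(\<lambda>n. ereal (chaos_sum w n)) \<longlonglongrightarrow> (SUP n. ereal (chaos_sum w n))"
    by (rule LIMSEQ_SUP)
  have "(SUP n. ereal (chaos_sum w n)) = \<infinity>"
  proof (rule ccontr)
    assume "(SUP n. ereal (chaos_sum w n)) \<noteq> \<infinity>"
    then obtain B where B: "(SUP n. ereal (chaos_sum w n)) \<le> ereal B"
      by (cases "SUP n. ereal (chaos_sum w n)") auto
    have "chaos_sum w n \<le> B" for n
    proof -
      have "ereal (chaos_sum w n) \<le> (SUP n. ereal (chaos_sum w n))" by (rule SUP_upper) simp
      then have "ereal (chaos_sum w n) \<le> ereal B" using B by (rule order_trans)
      then show ?thesis by simp
    qed
    then have "summable (chaos w)"
      using chaos_pos[OF w]
      by (intro bounded_imp_summable[of _ B]) (auto simp: chaos_sum_def less_imp_le)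
    then show False using ns by simp
  qed
  with lim show ?thesis by simp
qed

text \<open>Convexity of the power in its exponent, between \<open>y\<close> and 1, derived from the
  tangent inequality at \<open>z powr y\<close>.\<close>

lemma powr_convex_exponent:
  fixes z y s :: real
  assumes z: "z > 0" and s: "0 \<le> s" "s \<le> 1"
  shows "z powr ((1 - s) * y + s) \<le> (1 - s) * z powr y + s * z"
proof -
  define Y where "Y = z powr y"
  have Y: "Y > 0" using z by (simp add: Y_def)
  have "z powr ((1 - s) * y + s) = Y powr (1 - s) * z powr s"
    using z by (simp add: Y_def powr_powr powr_add mult.commute)
  also have "\<dots> \<le> Y powr (1 - s) * ((1 - s) * Y powr s + s * (Y powr (s - 1) * z))"
    by (intro mult_left_mono powr_le_tangent z Y s) simp
  also have "\<dots> = (1 - s) * (Y powr (1 - s) * Y powr s) + s * (Y powr (1 - s) * Y powr (s - 1)) * z"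
    by (simp add: algebra_simps)
  also have "Y powr (1 - s) * Y powr s = Y" using Y by (simp add: powr_add[symmetric])
  also have "Y powr (1 - s) * Y powr (s - 1) = 1" using Y by (simp add: powr_add[symmetric])
  finally show ?thesis by (simp add: Y_def)
qed

context rwre
begin

section \<open>The law of the ratio trees above the first level\<close>

definition ratio_law :: "('d \<Rightarrow> real) measure" where
  "ratio_law = distr N (PiM UNIV (\<lambda>_. borel)) (\<lambda>\<omega> j. \<eta> j \<omega>)"

lemma measurable_eta_vector: "(\<lambda>\<omega> j. \<eta> j \<omega>) \<in> measurable N (PiM UNIV (\<lambda>_. borel))"
  by (rule measurable_PiM_single') (auto intro: eta_measurable)

lemma measurable_p:
  assumes i: "i \<in> moves v"
  shows "p v i \<in> borel_measurable M"
proof -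
  have "(\<lambda>\<omega>. \<lambda>i\<in>moves v. p v i \<omega>) \<in> measurable M (PiM (moves v) (\<lambda>_. borel))"
    using indep_environment by (auto simp: indep_vars_def)
  then have "(\<lambda>\<omega>. (\<lambda>i\<in>moves v. p v i \<omega>) i) \<in> borel_measurable M"
    by (rule measurable_compose) (rule measurable_component_singleton[OF i])
  then show ?thesis using i by simp
qed

lemma AE_env_ok: "AE \<omega> in M. env_ok (\<lambda>v i. p v i \<omega>)"
proof -
  have "AE \<omega> in M. (\<forall>i\<in>moves v. p v i \<omega> > 0) \<and> (\<Sum>i\<in>moves v. p v i \<omega>) = 1" for v
  proof -
    have "AE \<omega> in M. \<forall>i\<in>moves v. p v i \<omega> > 0"
      by (rule AE_finite_allI) (auto intro: positive)
    with sum_one[of v] show ?thesis by eventually_elim auto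
  qed
  then have "AE \<omega> in M. \<forall>v. (\<forall>i\<in>moves v. p v i \<omega> > 0) \<and> (\<Sum>i\<in>moves v. p v i \<omega>) = 1"
    by (subst AE_all_countable) blast
  then show ?thesis by (simp add: env_ok_def)
qed

text \<open>Positivity passes from the environment to \<open>\<eta>\<close> through equality in law,
  at a vertex of the first level.\<close>

lemma eta_pos: "AE \<omega> in N. \<forall>j. \<eta> j \<omega> > 0"
proof -
  let ?v = "[undefined] :: 'd list"
  let ?R = "\<lambda>\<omega> j. p ?v (Some j) \<omega> / p ?v None \<omega>"
  have m: "?R \<in> measurable M (PiM UNIV (\<lambda>_. borel))"
    by (rule measurable_PiM_single')
      (auto intro!: borel_measurable_divide measurable_p simp: moves_def)
  have s: "{x \<in> space (PiM UNIV (\<lambda>_. borel)). \<forall>j. x j > (0::real)} \<in> sets (PiM UNIV (\<lambda>_::'d. borel))"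
    by measurable
  have "AE \<omega> in M. \<forall>j. ?R \<omega> j > 0"
    using AE_env_ok
  proof eventually_elim
    case (elim \<omega>)
    then show ?case using env_ok_Some[OF elim, of ?v] env_ok_None[OF elim, of ?v] by simp
  qed
  then have "AE x in distr M (PiM UNIV (\<lambda>_. borel)) ?R. \<forall>j. x j > 0"
    by (subst AE_distr_iff[OF m s])
  then have "AE x in distr N (PiM UNIV (\<lambda>_. borel)) (\<lambda>\<omega> j. \<eta> j \<omega>). \<forall>j. x j > 0"
    by (subst eta_law[of ?v]) simp_all
  then show ?thesis
    by (subst (asm) AE_distr_iff[OF measurable_eta_vector s])
qed

lemma iid_tree_ratio_law: "iid_tree ratio_law"
proof (intro iid_tree.intro iid_tree_axioms.intro)
  show "prob_space ratio_law"
    unfolding ratio_law_def by (rule N.prob_space_distr[OF measurable_eta_vector])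
  show "sets ratio_law = sets (PiM UNIV (\<lambda>_. borel))" by (simp add: ratio_law_def)
  have s: "{x \<in> space (PiM UNIV (\<lambda>_. borel)). \<forall>j. x j > (0::real)} \<in> sets (PiM UNIV (\<lambda>_::'d. borel))"
    by measurable
  show "AE x in ratio_law. \<forall>j. x j > 0"
    unfolding ratio_law_def by (subst AE_distr_iff[OF measurable_eta_vector s]) (rule eta_pos)
qed

end

sublocale rwre \<subseteq> T: iid_tree ratio_law
  by (rule iid_tree_ratio_law)

context rwre
begin

text \<open>No vertex above \<open>[j]\<close> is the root, so the ratio vectors there are
  independent with the common law; dropping the first letter identifies them with the full
  tree.\<close>

lemma distr_ratio_tree:
  "(\<lambda>\<omega>. ratio_tree (\<lambda>v i. p v i \<omega>) [j]) \<in> measurable M T.TP" (is ?m)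
  "distr M T.TP (\<lambda>\<omega>. ratio_tree (\<lambda>v i. p v i \<omega>) [j]) = T.TP" (is ?d)
proof -
  let ?B = "PiM UNIV (\<lambda>_. borel) :: ('d \<Rightarrow> real) measure"
  define R where "R = range ((#) j)"
  define Z where "Z v \<omega> = (\<lambda>r k. r (Some k) / r None) (\<lambda>i\<in>moves v. p v i \<omega>)" for v \<omega>
  have mv: "moves v = UNIV" if "v \<in> R" for v
    using that by (auto simp: moves_def R_def)
  have "indep_vars (\<lambda>v. PiM (moves v) (\<lambda>_. borel)) (\<lambda>v \<omega>. \<lambda>i\<in>moves v. p v i \<omega>) R"
    by (rule indep_vars_subset[OF indep_environment]) simp
  then have ind: "indep_vars (\<lambda>_. ?B) Z R"
    unfolding Z_def[abs_def]
  proof (rule indep_vars_compose2)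
    fix v assume "v \<in> R"
    then show "(\<lambda>r k. r (Some k) / r None) \<in> measurable (PiM (moves v) (\<lambda>_. borel)) ?B"
      unfolding mv[OF \<open>v \<in> R\<close>] by (intro measurable_PiM_single') auto
  qed
  have Zm: "Z v \<in> measurable M ?B" if "v \<in> R" for v
    using ind that by (auto simp: indep_vars_def)
  define G where "G \<omega> = (\<lambda>v\<in>R. Z v \<omega>)" for \<omega>
  define H where "H x = (\<lambda>u\<in>UNIV. x (j # u))" for x :: "'d list \<Rightarrow> 'd \<Rightarrow> real"
  have G: "G \<in> measurable M (PiM R (\<lambda>_. ?B))"
    unfolding G_def by (rule measurable_restrict) (rule Zm)
  have s: "sets ratio_law = sets ?B" by (rule T.sets_nu)
  have H: "H \<in> measurable (PiM R (\<lambda>_. ?B)) T.TP"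
    unfolding H_def T.TP_def
  proof (rule measurable_restrict)
    fix u
    have "(\<lambda>x. x (j # u)) \<in> measurable (PiM R (\<lambda>_. ?B)) ?B"
      by (rule measurable_component_singleton) (simp add: R_def)
    then show "(\<lambda>x. x (j # u)) \<in> measurable (PiM R (\<lambda>_. ?B)) ratio_law"
      by (simp only: measurable_cong_sets[OF refl s])
  qed
  have "R \<noteq> {}" by (simp add: R_def)
  then have "distr M (PiM R (\<lambda>_. ?B)) G = PiM R (\<lambda>v. distr M ?B (Z v))"
    using ind indep_vars_iff_distr_eq_PiM'[of R Z "\<lambda>_. ?B"] Zm by (simp add: G_def[abs_def])
  also have "\<dots> = PiM R (\<lambda>_. ratio_law)"
  proof (rule PiM_cong[OF refl])
    fix v assume "v \<in> R"
    then have "v \<noteq> []" by (auto simp: R_def)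
    moreover have "Z v = (\<lambda>\<omega> k. p v (Some k) \<omega> / p v None \<omega>)"
      using mv[OF \<open>v \<in> R\<close>] by (simp add: Z_def fun_eq_iff)
    ultimately show "distr M ?B (Z v) = ratio_law"
      using eta_law[of v] by (simp add: ratio_law_def)
  qed
  finally have dG: "distr M (PiM R (\<lambda>_. ?B)) G = PiM R (\<lambda>_. ratio_law)" .
  have dH: "distr (PiM R (\<lambda>_. ratio_law)) T.TP H = T.TP"
    unfolding H_def[abs_def] T.TP_def
    by (rule distr_PiM_reindex[where f = "(#) j"]) (auto simp: R_def T.prob_space_axioms intro: inj_onI)
  have rt: "ratio_tree (\<lambda>v i. p v i \<omega>) [j] = H (G \<omega>)" for \<omega>
    using mv by (auto simp: ratio_tree_def H_def G_def Z_def R_def fun_eq_iff)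
  show ?m
    unfolding rt by (rule measurable_compose[OF G H])
  show ?d
    unfolding rt using distr_distr[OF H G] dG dH by (simp add: comp_def)
qed

text \<open>Each of the finitely many subtrees above the root has the product law, and the
  exceptional null sets are united.\<close>

lemma AE_ratio_tree:
  assumes "AE t in T.TP. Q t"
  shows "AE \<omega> in M. \<forall>j. Q (ratio_tree (\<lambda>v i. p v i \<omega>) [j])"
proof -
  have "AE \<omega> in M. Q (ratio_tree (\<lambda>v i. p v i \<omega>) [j])" for j
    by (rule AE_distrD[OF distr_ratio_tree(1)]) (subst distr_ratio_tree(2), rule assms)
  then show ?thesis by (subst AE_all_countable) blast
qed

section \<open>The moment function on [0,1]\<close>

lemma eta_powr_integrable:
  assumes x: "x \<in> {0..1}"
  shows "integrable N (\<lambda>\<omega>. \<eta> i \<omega> powr x)"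
proof (rule Bochner_Integration.integrable_bound[of _ "\<lambda>\<omega>. 1 + \<eta> i \<omega>"])
  show "integrable N (\<lambda>\<omega>. 1 + \<eta> i \<omega>)" using eta_integrable by simp
  show "(\<lambda>\<omega>. \<eta> i \<omega> powr x) \<in> borel_measurable N" using eta_measurable[of i] by measurable
  show "AE \<omega> in N. norm (\<eta> i \<omega> powr x) \<le> norm (1 + \<eta> i \<omega>)"
    using eta_pos
  proof eventually_elim
    case (elim \<omega>)
    then have "\<eta> i \<omega> > 0" by simp
    then show ?case using powr_le_one_plus[of "\<eta> i \<omega>" x] x by simp
  qed
qed

lemma moment_sum_eq:
  assumes x: "x \<in> {0..1}"
  shows "moment_sum N \<eta> x = (\<Sum>i\<in>UNIV. \<integral>\<omega>. \<eta> i \<omega> powr x \<partial>N)"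
  unfolding moment_sum_def by (rule Bochner_Integration.integral_sum) (rule eta_powr_integrable[OF x])

lemma ennreal_moment_sum:
  assumes x: "x \<in> {0..1}"
  shows "(\<Sum>j\<in>UNIV. \<integral>\<^sup>+y. ennreal (y j powr x) \<partial>ratio_law) = ennreal (moment_sum N \<eta> x)"
proof -
  have "(\<integral>\<^sup>+y. ennreal (y j powr x) \<partial>ratio_law) = ennreal (\<integral>\<omega>. \<eta> j \<omega> powr x \<partial>N)" for j
  proof -
    have "(\<integral>\<^sup>+y. ennreal (y j powr x) \<partial>ratio_law) = (\<integral>\<^sup>+\<omega>. ennreal (\<eta> j \<omega> powr x) \<partial>N)"
    proof -
      have "(\<lambda>y. y j) \<in> borel_measurable (PiM UNIV (\<lambda>_::'d. borel :: real measure))"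
        by (rule measurable_component_singleton) simp
      then have "(\<lambda>y. ennreal (y j powr x)) \<in> borel_measurable (PiM UNIV (\<lambda>_::'d. borel :: real measure))"
        by (rule measurable_compose) measurable
      then show ?thesis
        unfolding ratio_law_def by (intro nn_integral_distr[OF measurable_eta_vector]) simp
    qed
    also have "\<dots> = ennreal (\<integral>\<omega>. \<eta> j \<omega> powr x \<partial>N)"
      by (rule nn_integral_eq_integral[OF eta_powr_integrable[OF x]]) simp
    finally show ?thesis .
  qed
  then show ?thesis by (simp add: moment_sum_eq[OF x])
qed

lemma moment_sum_0: "moment_sum N \<eta> 0 = real CARD('d)"
proof -
  have "(\<integral>\<omega>. \<eta> i \<omega> powr 0 \<partial>N) = (\<integral>\<omega>. 1 \<partial>N)" for i
  proof (rule integral_cong_AE)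
    \<comment> \<open>Positivity matters, as \<open>0 powr 0\<close> is 0.\<close>
    show "AE \<omega> in N. \<eta> i \<omega> powr 0 = 1"
      using eta_pos by eventually_elim (simp add: less_imp_neq[symmetric])
  qed (use eta_measurable[of i] in measurable)
  then show ?thesis by (simp add: moment_sum_eq N.prob_space)
qed

text \<open>The chord inequality for \<open>y < x < 1\<close>, multiplied by \<open>1 - y\<close> to
  clear the quotient.\<close>

lemma moment_sum_convex:
  assumes "0 \<le> y" "y < x" "x < 1"
  shows "(1 - y) * moment_sum N \<eta> x \<le> (1 - x) * moment_sum N \<eta> y + (x - y) * moment_sum N \<eta> 1"
proof -
  define s where "s = (x - y) / (1 - y)"
  have s: "0 \<le> s" "s \<le> 1" using assms by (auto simp: s_def)
  have s1: "(1 - y) * s = x - y" using assms by (simp add: s_def)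
  then have s2: "(1 - y) * (1 - s) = 1 - x" by (simp add: algebra_simps)
  have xs: "x = (1 - s) * y + s" using s1 by (simp add: algebra_simps)
  have "(\<integral>\<omega>. \<eta> i \<omega> powr x \<partial>N) \<le> (1 - s) * (\<integral>\<omega>. \<eta> i \<omega> powr y \<partial>N) + s * (\<integral>\<omega>. \<eta> i \<omega> powr 1 \<partial>N)" for i
  proof -
    have "(\<integral>\<omega>. \<eta> i \<omega> powr x \<partial>N) \<le> (\<integral>\<omega>. (1 - s) * \<eta> i \<omega> powr y + s * \<eta> i \<omega> powr 1 \<partial>N)"
    proof (rule integral_mono_AE)
      show "AE \<omega> in N. \<eta> i \<omega> powr x \<le> (1 - s) * \<eta> i \<omega> powr y + s * \<eta> i \<omega> powr 1"
        using eta_pos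
      proof eventually_elim
        case (elim \<omega>)
        then have "\<eta> i \<omega> > 0" by simp
        then show ?case using powr_convex_exponent[of "\<eta> i \<omega>" s y] s xs by simp
      qed
      show "integrable N (\<lambda>\<omega>. \<eta> i \<omega> powr x)" using assms by (intro eta_powr_integrable) auto
      show "integrable N (\<lambda>\<omega>. (1 - s) * \<eta> i \<omega> powr y + s * \<eta> i \<omega> powr 1)"
        using assms
        by (intro Bochner_Integration.integrable_add integrable_mult_right eta_powr_integrable) auto
    qed
    also have "\<dots> = (1 - s) * (\<integral>\<omega>. \<eta> i \<omega> powr y \<partial>N) + s * (\<integral>\<omega>. \<eta> i \<omega> powr 1 \<partial>N)"
      using assms eta_powr_integrable[of y i] eta_powr_integrable[of 1 i]
      by (subst Bochner_Integration.integral_add) auto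
    finally show ?thesis .
  qed
  then have "(\<Sum>i\<in>UNIV. \<integral>\<omega>. \<eta> i \<omega> powr x \<partial>N) \<le>
      (\<Sum>i\<in>UNIV. (1 - s) * (\<integral>\<omega>. \<eta> i \<omega> powr y \<partial>N) + s * (\<integral>\<omega>. \<eta> i \<omega> powr 1 \<partial>N))"
    by (rule sum_mono)
  also have "\<dots> = (1 - s) * (\<Sum>i\<in>UNIV. \<integral>\<omega>. \<eta> i \<omega> powr y \<partial>N) + s * (\<Sum>i\<in>UNIV. \<integral>\<omega>. \<eta> i \<omega> powr 1 \<partial>N)"
    by (simp only: sum.distrib sum_distrib_left)
  finally have "moment_sum N \<eta> x \<le> (1 - s) * moment_sum N \<eta> y + s * moment_sum N \<eta> 1"
    using assms moment_sum_eq[of x] moment_sum_eq[of y] moment_sum_eq[of 1] by simp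
  then have "(1 - y) * moment_sum N \<eta> x \<le> (1 - y) * ((1 - s) * moment_sum N \<eta> y + s * moment_sum N \<eta> 1)"
    using assms by (intro mult_left_mono) auto
  also have "\<dots> = ((1 - y) * (1 - s)) * moment_sum N \<eta> y + ((1 - y) * s) * moment_sum N \<eta> 1"
    by (simp add: algebra_simps)
  finally show ?thesis unfolding s1 s2 .
qed

section \<open>The three regimes in the random environment\<close>

lemma AE_summable_chaos:
  assumes x: "x \<in> {0..1}" and lt: "moment_sum N \<eta> x < 1"
  shows "AE \<omega> in M. summable (chaos (\<lambda>v i. p v i \<omega>))"
proof -
  \<comment> \<open>At exponent 0 the moment sum is the number of children, at least 1.\<close>
  have "x \<noteq> 0"
  proof
    assume "x = 0"
    then have "real CARD('d) < 1" using lt moment_sum_0 by simp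
    then show False by simp
  qed
  then have x': "0 < x" "x \<le> 1" using x by auto
  have "AE t in T.TP. summable (\<lambda>n. mass n t)"
    by (rule T.mass_summable[OF x']) (simp add: ennreal_moment_sum[OF x] lt)
  from AE_ratio_tree[OF this] show ?thesis
  proof eventually_elim
    case (elim \<omega>)
    have "summable (\<lambda>n. chaos (\<lambda>v i. p v i \<omega>) (Suc n))"
      unfolding chaos_Suc_eq by (intro summable_sum summable_mult) (use elim in auto)
    then show ?case by (simp only: summable_Suc_iff)
  qed
qed

lemma AE_esc_pos:
  assumes c: "c > 1" and f: "\<And>x. x \<in> {0..1} \<Longrightarrow> c \<le> moment_sum N \<eta> x"
  shows "AE \<omega> in M. \<forall>j. esc (\<lambda>v i. p v i \<omega>) [j] > 0"
  unfolding esc_def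
proof (intro AE_ratio_tree T.escape_pos[OF _ c])
  show "integrable ratio_law (\<lambda>x. x j)" for j
    unfolding ratio_law_def using eta_integrable[of j]
    by (subst integrable_distr_eq[OF measurable_eta_vector]) auto
  show "ennreal c \<le> (\<Sum>j\<in>UNIV. \<integral>\<^sup>+x. ennreal (x j powr q) \<partial>ratio_law)" if "q \<in> {0..1}" for q
    using f[OF that] by (simp add: ennreal_moment_sum[OF that] ennreal_leI)
  \<comment> \<open>The bound at exponent 0 forces at least two children.\<close>
  have "1 < real CARD('d)" using c f[of 0] moment_sum_0 by simp
  then show "2 \<le> CARD('d)" by simp
qed

lemma AE_chaos_converges:
  assumes f1: "moment_sum N \<eta> 1 = 1"
    and \<delta>: "\<delta> > 0" and h0: "0 \<le> h0" "h0 < 1"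
    and f: "\<And>h. h0 < h \<Longrightarrow> h < 1 \<Longrightarrow> 1 + \<delta> * (1 - h) \<le> moment_sum N \<eta> h"
    and d2: "CARD('d) \<ge> 2"
  shows "AE \<omega> in M. \<exists>y>0. chaos (\<lambda>v i. p v i \<omega>) \<longlonglongrightarrow> y"
proof -
  have "(\<Sum>j\<in>UNIV. \<integral>\<^sup>+x. ennreal (x j) \<partial>ratio_law) = (\<Sum>j\<in>UNIV. \<integral>\<^sup>+x. ennreal (x j powr 1) \<partial>ratio_law)"
    using T.nu_pos by (intro sum.cong refl nn_integral_cong_AE, eventually_elim) (simp add: abs_of_pos)
  then have mean1: "(\<Sum>j\<in>UNIV. \<integral>\<^sup>+x. ennreal (x j) \<partial>ratio_law) = 1"
    using ennreal_moment_sum[of 1] f1 by simp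
  have "AE t in T.TP. \<exists>l>0. (\<lambda>n. mass n t) \<longlonglongrightarrow> l"
  proof (rule T.mass_limit_pos[OF mean1 \<delta> h0(2) _ d2])
    fix h assume h: "h0 < h" "h < 1"
    then have "h \<in> {0..1}" using h0 by auto
    then show "ennreal (1 + \<delta> * (1 - h)) \<le> (\<Sum>j\<in>UNIV. \<integral>\<^sup>+x. ennreal (x j powr h) \<partial>ratio_law)"
      using f[OF h] by (simp only: ennreal_moment_sum ennreal_leI)
  qed
  from AE_ratio_tree[OF this] AE_env_ok show ?thesis
  proof eventually_elim
    case (elim \<omega>)
    let ?w = "\<lambda>v i. p v i \<omega>"
    obtain l where l: "\<And>j. l j > 0" "\<And>j. (\<lambda>n. mass n (ratio_tree ?w [j])) \<longlonglongrightarrow> l j"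
      using elim(1) by metis
    have "(\<lambda>n. chaos ?w (Suc n)) \<longlonglongrightarrow> (\<Sum>j\<in>UNIV. ?w [] (Some j) * l j)"
      unfolding chaos_Suc_eq by (intro tendsto_sum tendsto_mult tendsto_const l)
    then have "chaos ?w \<longlonglongrightarrow> (\<Sum>j\<in>UNIV. ?w [] (Some j) * l j)"
      by (rule LIMSEQ_imp_Suc)
    moreover have "(\<Sum>j\<in>UNIV. ?w [] (Some j) * l j) > 0"
      using l env_ok_Some[OF elim(2)] by (intro sum_pos) auto
    ultimately show ?case by blast
  qed
qed

end

theorem theorem1p2:
  fixes M :: "'w measure" and N :: "'e measure"
    and p :: "'d::finite list \<Rightarrow> 'd option \<Rightarrow> 'w \<Rightarrow> real"
    and \<eta> :: "'d \<Rightarrow> 'e \<Rightarrow> real"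
    and f :: "real \<Rightarrow> real"
    and lam x\<^sub>0 :: real
    and env :: "'w \<Rightarrow> 'd list \<Rightarrow> 'd option \<Rightarrow> real"
  assumes rwre: "rwre M p N \<eta>"
  defines "f \<equiv> moment_sum N \<eta>"
    and "lam \<equiv> (INF x\<in>{0..1}. f x)"
    and "env \<equiv> (\<lambda>\<omega> v i. p v i \<omega>)"
  assumes x0: "x\<^sub>0 \<in> {0..1}" "f x\<^sub>0 = lam"
  shows
    "(lam < 1 \<longrightarrow>
        (AE \<omega> in M. ergodic (tree_kernel (env \<omega>))) \<and>
        (AE \<omega> in M. \<exists>z<\<infinity>. (\<lambda>n. ereal (chaos_sum (env \<omega>) n)) \<longlonglongrightarrow> z)) \<and>
     (lam > 1 \<longrightarrow>
        (AE \<omega> in M. transient (tree_kernel (env \<omega>))) \<and>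
        (AE \<omega> in M. (\<lambda>n. ereal (chaos (env \<omega>) n)) \<longlonglongrightarrow> \<infinity>) \<and>
        (AE \<omega> in M. (\<lambda>n. ereal (chaos_sum (env \<omega>) n)) \<longlonglongrightarrow> \<infinity>)) \<and>
     (lam = 1 \<and> (\<exists>D. (f has_real_derivative D) (at_left 1) \<and> D < 0) \<longrightarrow>
        (AE \<omega> in M. \<exists>y. (\<lambda>n. ereal (chaos (env \<omega>) n)) \<longlonglongrightarrow> y \<and> 0 < y \<and> y < \<infinity>) \<and>
        (AE \<omega> in M. (\<lambda>n. ereal (chaos_sum (env \<omega>) n)) \<longlonglongrightarrow> \<infinity>) \<and>
        (AE \<omega> in M. null_recurrent (tree_kernel (env \<omega>))))"
proof -
  interpret rwre M p N \<eta> by (rule rwre)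
  have ok: "AE \<omega> in M. env_ok (env \<omega>)" unfolding env_def by (rule AE_env_ok)
  have lam_le: "lam \<le> f x" if "x \<in> {0..1}" for x
    unfolding lam_def
  proof (rule cINF_lower[OF _ that])
    show "bdd_below (f ` {0..1})"
      unfolding f_def moment_sum_def by (intro bdd_belowI2[of _ 0] integral_nonneg_AE AE_I2 sum_nonneg) auto
  qed
  have part1: "(AE \<omega> in M. ergodic (tree_kernel (env \<omega>))) \<and>
      (AE \<omega> in M. \<exists>z<\<infinity>. (\<lambda>n. ereal (chaos_sum (env \<omega>) n)) \<longlonglongrightarrow> z)" if "lam < 1"
  proof
    have s: "AE \<omega> in M. summable (chaos (env \<omega>))"
      unfolding env_def using x0 that by (intro AE_summable_chaos[of x\<^sub>0]) (auto simp: f_def)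
    show "AE \<omega> in M. ergodic (tree_kernel (env \<omega>))"
      using s ok by eventually_elim (rule ergodic_if_summable_chaos)
    show "AE \<omega> in M. \<exists>z<\<infinity>. (\<lambda>n. ereal (chaos_sum (env \<omega>) n)) \<longlonglongrightarrow> z"
      using s
    proof eventually_elim
      case (elim \<omega>)
      have "(\<lambda>n. ereal (chaos_sum (env \<omega>) n)) \<longlonglongrightarrow> ereal (suminf (chaos (env \<omega>)))"
        unfolding chaos_sum_def using summable_LIMSEQ'[OF elim] by simp
      then show ?case by (intro exI[of _ "ereal (suminf (chaos (env \<omega>)))"]) simp
    qed
  qed
  have part2: "(AE \<omega> in M. transient (tree_kernel (env \<omega>))) \<and>
      (AE \<omega> in M. (\<lambda>n. ereal (chaos (env \<omega>) n)) \<longlonglongrightarrow> \<infinity>) \<and>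
      (AE \<omega> in M. (\<lambda>n. ereal (chaos_sum (env \<omega>) n)) \<longlonglongrightarrow> \<infinity>)" if gt: "lam > 1"
  proof (intro conjI)
    have e: "AE \<omega> in M. \<forall>j. esc (env \<omega>) [j] > 0"
      unfolding env_def by (rule AE_esc_pos[OF gt]) (use lam_le in \<open>simp add: f_def\<close>)
    show "AE \<omega> in M. transient (tree_kernel (env \<omega>))"
      using e ok by eventually_elim (blast intro: transient_if_esc_pos)
    have lim: "AE \<omega> in M. filterlim (chaos (env \<omega>)) at_top sequentially"
      using e ok by eventually_elim (blast intro: chaos_to_infinity)
    then show "AE \<omega> in M. (\<lambda>n. ereal (chaos (env \<omega>) n)) \<longlonglongrightarrow> \<infinity>"
      by eventually_elim (simp add: tendsto_PInfty_eq_at_top)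
    show "AE \<omega> in M. (\<lambda>n. ereal (chaos_sum (env \<omega>) n)) \<longlonglongrightarrow> \<infinity>"
      using lim ok
    proof eventually_elim
      case (elim \<omega>)
      have "\<not> summable (chaos (env \<omega>))"
        using elim(1) summable_LIMSEQ_zero not_tendsto_and_filterlim_at_infinity[OF sequentially_bot]
          filterlim_at_top_imp_at_infinity by blast
      then show ?case by (rule chaos_sum_to_infinity[OF elim(2)])
    qed
  qed
  have part3: "(AE \<omega> in M. \<exists>y. (\<lambda>n. ereal (chaos (env \<omega>) n)) \<longlonglongrightarrow> y \<and> 0 < y \<and> y < \<infinity>) \<and>
      (AE \<omega> in M. (\<lambda>n. ereal (chaos_sum (env \<omega>) n)) \<longlonglongrightarrow> \<infinity>) \<and>
      (AE \<omega> in M. null_recurrent (tree_kernel (env \<omega>)))"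
    if lam1: "lam = 1" and D: "(f has_real_derivative D) (at_left 1)" "D < 0" for D
  proof (intro conjI)
    have "((\<lambda>x. (f x - f 1) / (x - 1)) \<longlongrightarrow> D) (at_left 1)"
      using D(1) by (simp add: has_field_derivative_iff)
    \<comment> \<open>Any constant strictly between \<open>D\<close> and 0 would serve;
      \<open>- D / 2\<close> becomes the constant \<open>\<delta>\<close> of the moment
      bound.\<close>
    then have "eventually (\<lambda>x. (f x - f 1) / (x - 1) < D / 2) (at_left 1)"
      by (rule order_tendstoD(2)) (use D in simp)
    then obtain b where b: "b < 1" "\<And>x. b < x \<Longrightarrow> x < 1 \<Longrightarrow> (f x - f 1) / (x - 1) < D / 2"
      unfolding eventually_at_left_field by blast
    define h0 where "h0 = max 0 b"
    have h0: "0 \<le> h0" "h0 < 1" "b \<le> h0" using b by (auto simp: h0_def)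
    have near: "f 1 + (- D / 2) * (1 - x) \<le> f x" if "h0 < x" "x < 1" for x
    proof -
      have "(f x - f 1) / (x - 1) < D / 2" using b(2)[of x] that h0 by simp
      then have "D / 2 * (x - 1) < f x - f 1" using that by (simp add: neg_divide_less_eq)
      moreover have "(- D / 2) * (1 - x) = D / 2 * (x - 1)" by (simp add: field_simps)
      ultimately show ?thesis by linarith
    qed
    \<comment> \<open>Convexity carries the strict inequality from a neighbourhood of 1 to the whole
      interval: \<open>f\<close> exceeds \<open>f 1\<close> at a nearby point \<open>x\<close>, so
      the chord from \<open>y\<close> to 1 must start above \<open>f 1\<close>.\<close>
    have far: "f 1 < f y" if "0 \<le> y" "y < 1" for y
    proof -
      define x where "x = (max y h0 + 1) / 2"
      have x: "y < x" "h0 < x" "x < 1" using that h0 by (auto simp: x_def)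
      have "0 < (- D / 2) * (1 - x)" using D x by (intro mult_pos_pos) auto
      then have "f 1 < f x" using near[OF x(2,3)] by linarith
      then have "(1 - y) * f 1 < (1 - y) * f x" using that by simp
      also have "\<dots> \<le> (1 - x) * f y + (x - y) * f 1"
        unfolding f_def by (rule moment_sum_convex[OF that(1) x(1,3)])
      finally have "(1 - x) * f 1 < (1 - x) * f y" by (simp add: algebra_simps)
      then show ?thesis using x by simp
    qed
    have "x\<^sub>0 = 1"
      using far[of x\<^sub>0] x0 lam_le[of 1] by (cases "x\<^sub>0 < 1") auto
    then have f1: "f 1 = 1" using x0 lam1 by simp
    \<comment> \<open>\<open>f 0\<close> is the number of children, and it exceeds
      \<open>f 1 = 1\<close>.\<close>
    have "real CARD('d) > 1" using far[of 0] f1 moment_sum_0 by (simp add: f_def)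
    then have d2: "CARD('d) \<ge> 2" by simp
    have conv: "AE \<omega> in M. \<exists>y>0. chaos (env \<omega>) \<longlonglongrightarrow> y"
      unfolding env_def
    proof (rule AE_chaos_converges[OF _ _ h0(1,2) _ d2])
      show "moment_sum N \<eta> 1 = 1" using f1 by (simp add: f_def)
      show "- D / 2 > 0" using D by simp
      show "1 + (- D / 2) * (1 - h) \<le> moment_sum N \<eta> h" if "h0 < h" "h < 1" for h
        using near[OF that] f1 by (simp add: f_def)
    qed
    then show "AE \<omega> in M. \<exists>y. (\<lambda>n. ereal (chaos (env \<omega>) n)) \<longlonglongrightarrow> y \<and> 0 < y \<and> y < \<infinity>"
    proof eventually_elim
      case (elim \<omega>)
      then obtain y where "y > 0" "chaos (env \<omega>) \<longlonglongrightarrow> y" by blast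
      then show ?case by (intro exI[of _ "ereal y"]) simp
    qed
    show "AE \<omega> in M. (\<lambda>n. ereal (chaos_sum (env \<omega>) n)) \<longlonglongrightarrow> \<infinity>"
      using conv ok
    proof eventually_elim
      case (elim \<omega>)
      then obtain y where y: "y > 0" "chaos (env \<omega>) \<longlonglongrightarrow> y" by blast
      have "\<not> summable (chaos (env \<omega>))"
        using LIMSEQ_unique[OF y(2)] summable_LIMSEQ_zero y(1) by (metis less_irrefl)
      then show ?case by (rule chaos_sum_to_infinity[OF elim(2)])
    qed
    show "AE \<omega> in M. null_recurrent (tree_kernel (env \<omega>))"
      using conv ok
    proof eventually_elim
      case (elim \<omega>)
      then obtain y where "y > 0" "chaos (env \<omega>) \<longlonglongrightarrow> y" by blast
      then show ?case using null_recurrent_if_chaos_converges[OF elim(2)] by simp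
    qed
  qed
  show ?thesis using part1 part2 part3 by blast
qed

end
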